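(* For every $k\ge 9$, the connected components of $\mathbf{DCM}_k$ form exactly three isomorphism classes: there is a positive number of pairwise isomorphic components of the smallest order, a positive number of pairwise isomorphic components of the second smallest order, and exactly one component of the largest order.
   Context: Let $k\ge 1$ and let $X_{2k}=\{P_1,\dots,P_{2k}\}$ be $2k$ points in convex position in the plane, labeled in clockwise cyclic order; indices are taken modulo $2k$ (so $P_{2k}$ and $P_1$ are consecutive). A matching of $X_{2k}$ means a set of $k$ pairwise non-crossing straight segments (edges) with endpoints in $X_{2k}$ covering every point exactly once; its size is $k$. Two matchings $M,M'$ of $X_{2k}$ are disjoint compatible if they have no common edge and no edge of $M$ crosses an edge of $M'$. $\mathbf{DCM}_k$ is the graph whose vertices are the matchings of $X_{2k}$, two being adjacent iff they are disjoint compatible (this graph depends only on $k$). The order of a component is its number of vertices. *)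

theory Defs
  imports Main
begin

text \<open>Points of X_{2k} are encoded by their labels 0,...,2k-1 (label i stands for P_{i+1}),
  in clockwise cyclic order. For points in convex position, two segments with four distinct
  endpoints cross iff their endpoints interleave in the cyclic order; this is invariant under
  rotation, so linear interleaving of labels suffices. Segments sharing an endpoint do not cross.\<close>

definition crosses :: "nat set \<Rightarrow> nat set \<Rightarrow> bool" where
  "crosses e f \<longleftrightarrow> (\<exists>a b c d. a < c \<and> c < b \<and> b < d \<and>
      ((e = {a, b} \<and> f = {c, d}) \<or> (e = {c, d} \<and> f = {a, b})))"

definition is_matching :: "nat \<Rightarrow> nat set set \<Rightarrow> bool" where
  "is_matching k M \<longleftrightarrow>
     (\<forall>e\<in>M. \<exists>i j. i < j \<and> j < 2 * k \<and> e = {i, j}) \<and>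
     (\<forall>p < 2 * k. \<exists>!e. e \<in> M \<and> p \<in> e) \<and>
     (\<forall>e\<in>M. \<forall>f\<in>M. \<not> crosses e f)"

definition dcm_vertices :: "nat \<Rightarrow> nat set set set" where
  "dcm_vertices k = {M. is_matching k M}"

definition dcm_adj :: "nat \<Rightarrow> nat set set \<Rightarrow> nat set set \<Rightarrow> bool" where
  "dcm_adj k M M' \<longleftrightarrow> is_matching k M \<and> is_matching k M' \<and> M \<inter> M' = {} \<and>
     (\<forall>e\<in>M. \<forall>f\<in>M'. \<not> crosses e f)"

definition dcm_components :: "nat \<Rightarrow> nat set set set set" where
  "dcm_components k = {C. \<exists>M \<in> dcm_vertices k.
      C = {M'. (dcm_adj k)\<^sup>*\<^sup>* M M'}}"

definition dcm_comp_iso :: "nat \<Rightarrow> nat set set set \<Rightarrow> nat set set set \<Rightarrow> bool" where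
  "dcm_comp_iso k C D \<longleftrightarrow> (\<exists>f. bij_betw f C D \<and>
      (\<forall>x\<in>C. \<forall>y\<in>C. dcm_adj k x y \<longleftrightarrow> dcm_adj k (f x) (f y)))"

end

theory Submission
  imports Defs
begin

text \<open>
  Matchings are encoded by plane forests, read as balanced words. The union of two disjoint compatible
  matchings consists of non-crossing polygons whose sides alternate between the two; hence the neighbours of a
  matching can be computed by cutting it along one edge (theorem \<open>nb_Arc_iff\<close>). A matching of size at least 2
  contains two edges on four consecutive points, forming \<open>()()\<close> or \<open>(())\<close>; flipping this pair together with a
  neighbour of the rest gives a neighbour of the whole, so that walks for \<open>k - 2\<close> lift to walks for \<open>k\<close>. From
  \<open>k = 9\<close> on, the matching formed by all the edges \<open>P\<^sub>1P\<^sub>2, P\<^sub>3P\<^sub>4, \<dots>\<close> lies on a closed walk of odd length. Therefore,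
  if the rest is joined to that matching, then so is the whole, whichever pair was removed and wherever it stood.
  The matchings that cannot be reached in this way are chains of quadrilaterals. For odd \<open>k\<close> these are
  isolated vertices and stars with \<open>(k - 1) / 2\<close> leaves; for even \<open>k\<close> they are single edges and components of order
  \<open>3k - 6\<close>, which consist of a half graph with two pendant vertices attached to each of its vertices.
\<close>

section \<open>Arc diagrams\<close>

text \<open>The obstacle is parity. Each step of the rest flips the pair once, so a walk of parity
  \<open>b\<close> carries the pair \<open>c\<close> to \<open>c \<noteq> b\<close>. A rest joined
  to the ring therefore leads only to one of two words, the next larger ring or \<open>(())\<close>
  followed by a ring; which one depends on the walk. An odd closed walk removes this dependence. It
  is supplied at sizes 9 and 10, one for each residue, since removing a pair lowers the size by two;
  below that, \<open>big\<close> has to admit two classes at sizes 7 and 8. The second difficulty is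
  that the removed pair may sit at any gap. The exceptional rests are therefore put into normal
  forms for a chain cut open at an arbitrary gap (\<open>hub_form\<close>, \<open>comb_form\<close>,
  and \<open>med_form\<close> up to walks). When a pair is put back, the result is exceptional again
  or arises from one of finitely many small words of the large class by inserting further pairs.
  That the large component is strictly the largest follows by counting: putting \<open>()()\<close>
  or \<open>(())\<close> in front at least doubles the class, while the other components grow at
  most linearly.\<close>

text \<open>\<open>Arc u v\<close> is the word \<open>(u)v\<close>, with the points labelled from left to right.\<close>

datatype arcs = Emp | Arc arcs arcs

primrec sz :: "arcs \<Rightarrow> nat" where
  "sz Emp = 0"
| "sz (Arc u v) = Suc (sz u + sz v)"

primrec cat :: "arcs \<Rightarrow> arcs \<Rightarrow> arcs"  (infixr "\<oplus>" 65) where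
  "Emp \<oplus> w = w"
| "Arc u v \<oplus> w = Arc u (v \<oplus> w)"

abbreviation over :: "arcs \<Rightarrow> arcs" where
  "over u \<equiv> Arc u Emp"

text \<open>The first point is moved to the end: \<open>(u)v\<close> becomes \<open>u(v)\<close>.\<close>

primrec rot :: "arcs \<Rightarrow> arcs" where
  "rot Emp = Emp"
| "rot (Arc u v) = u \<oplus> over v"

text \<open>\<open>ins p d u\<close> puts \<open>d\<close> into the gap before point \<open>p\<close> of \<open>u\<close>; for \<open>p > 2 * sz u\<close> the value is junk.\<close>

fun ins :: "nat \<Rightarrow> arcs \<Rightarrow> arcs \<Rightarrow> arcs" where
  "ins p d Emp = d"
| "ins p d (Arc u v) =
    (if p = 0 then d \<oplus> Arc u v
     else if p \<le> 2 * sz u + 1 then Arc (ins (p - 1) d u) v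
     else Arc u (ins (p - (2 * sz u + 2)) d v))"

primrec edges :: "nat \<Rightarrow> arcs \<Rightarrow> (nat \<times> nat) set" where
  "edges p Emp = {}"
| "edges p (Arc u v) = insert (p, p + 2 * sz u + 1) (edges (p + 1) u \<union> edges (p + 2 * sz u + 2) v)"

text \<open>Compatibility of two edges. The inequalities are strict because edges of two matchings
  of the same points do share endpoints, and such edges do not cross.\<close>

fun fits :: "nat \<times> nat \<Rightarrow> nat \<times> nat \<Rightarrow> bool" where
  "fits (i, j) (k, l) \<longleftrightarrow> (i, j) \<noteq> (k, l) \<and> \<not> (i < k \<and> k < j \<and> j < l) \<and> \<not> (k < i \<and> i < l \<and> l < j)"

definition nb :: "arcs \<Rightarrow> arcs \<Rightarrow> bool" where
  "nb u v \<longleftrightarrow> sz u = sz v \<and> (\<forall>e\<in>edges 0 u. \<forall>f\<in>edges 0 v. fits e f)"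

lemma cat_Emp [simp]: "u \<oplus> Emp = u"
  by (induction u) auto

lemma cat_assoc [simp]: "(u \<oplus> v) \<oplus> w = u \<oplus> v \<oplus> w"
  by (induction u) auto

lemma sz_cat [simp]: "sz (u \<oplus> v) = sz u + sz v"
  by (induction u) auto

lemma sz_rot [simp]: "sz (rot u) = sz u"
  by (cases u) auto

lemma sz_rot_pow [simp]: "sz ((rot ^^ n) u) = sz u"
  by (induction n) auto

lemma sz_ins [simp]: "sz (ins p d u) = sz d + sz u"
  by (induction p d u rule: ins.induct) auto

lemma sz_eq_0 [simp]: "sz u = 0 \<longleftrightarrow> u = Emp"
  by (cases u) auto

lemma cat_eq_Emp [simp]: "u \<oplus> v = Emp \<longleftrightarrow> u = Emp \<and> v = Emp"
  by (cases u) auto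

lemma Emp_eq_cat [simp]: "Emp = u \<oplus> v \<longleftrightarrow> u = Emp \<and> v = Emp"
  by (cases u) auto

lemma cat_inj: "sz u = sz u' \<Longrightarrow> u \<oplus> v = u' \<oplus> v' \<longleftrightarrow> u = u' \<and> v = v'"
proof (induction u arbitrary: u')
  case Emp then show ?case by (cases u') auto
next
  case (Arc a b)
  show ?case
  proof (cases u')
    case Emp then show ?thesis using Arc.prems by auto
  next
    case (Arc c d)
    then show ?thesis using Arc.IH(2)[of d] Arc.prems by auto
  qed
qed

lemma cat_cancel_left [simp]: "u \<oplus> v = u \<oplus> v' \<longleftrightarrow> v = v'"
  by (simp add: cat_inj)

lemma cat_cancel_right [simp]: "u \<oplus> v = u' \<oplus> v \<longleftrightarrow> u = u'"
  by (metis add_right_cancel cat_inj sz_cat)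

text \<open>A nonempty word splits uniquely before its last outer arc; this is what makes
  \<open>rot\<close> injective.\<close>

lemma cat_over_inj: "u \<oplus> over v = u' \<oplus> over v' \<longleftrightarrow> u = u' \<and> v = v'"
proof (induction u arbitrary: u')
  case Emp then show ?case by (cases u') (auto)
next
  case (Arc a b) then show ?case by (cases u') auto
qed

lemma rot_eq_iff [simp]: "rot u = rot v \<longleftrightarrow> u = v"
  by (cases u; cases v) (auto simp: cat_over_inj)

lemma ins_0 [simp]: "ins 0 d u = d \<oplus> u"
  by (cases u) auto

lemma edges_cat [simp]: "edges p (u \<oplus> v) = edges p u \<union> edges (p + 2 * sz u) v"
  by (induction u arbitrary: p) (auto simp: algebra_simps)

lemma edges_bounds: "(i, j) \<in> edges p u \<Longrightarrow> p \<le> i \<and> i < j \<and> j < p + 2 * sz u"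
  by (induction u arbitrary: p) force+

lemma edges_parity: "(i, j) \<in> edges p u \<Longrightarrow> odd (i + j)"
  by (induction u arbitrary: p) auto

lemma edges_shift: "edges (p + q) u = (\<lambda>(i, j). (i + q, j + q)) ` edges p u"
proof (induction u arbitrary: p)
  case (Arc u v)
  show ?case using Arc(1)[of "p + 1"] Arc(2)[of "p + 2 * sz u + 2"]
    by (auto simp: image_Un algebra_simps)
qed auto

definition gap_shift :: "nat \<Rightarrow> nat \<Rightarrow> nat \<Rightarrow> nat" where
  "gap_shift p m i = (if i < p then i else i + m)"

lemma edges_ins:
  assumes "p \<le> 2 * sz u"
  shows "edges q (ins p d u) = map_prod (gap_shift (q + p) (2 * sz d)) (gap_shift (q + p) (2 * sz d)) ` edges q u \<union> edges (q + p) d"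
  using assms
proof (induction p d u arbitrary: q rule: ins.induct)
  case (1 p d) then show ?case by auto
next
  case (2 p d u v)
  have low: "map_prod (gap_shift r m) (gap_shift r m) ` edges s w = edges s w" if "s + 2 * sz w \<le> r" for r m s w
  proof -
    have "map_prod (gap_shift r m) (gap_shift r m) e = e" if "e \<in> edges s w" for e
      using that edges_bounds[of "fst e" "snd e" s w] \<open>s + 2 * sz w \<le> r\<close> by (cases e) (auto simp: gap_shift_def)
    then show ?thesis by (simp cong: image_cong_simp)
  qed
  have high: "map_prod (gap_shift r m) (gap_shift r m) ` edges s w = edges (s + m) w" if "r \<le> s" for r m s w
  proof -
    have "map_prod (gap_shift r m) (gap_shift r m) e = (\<lambda>(i, j). (i + m, j + m)) e" if "e \<in> edges s w" for e
      using that edges_bounds[of "fst e" "snd e" s w] \<open>r \<le> s\<close> by (cases e) (auto simp: gap_shift_def)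
    then show ?thesis unfolding edges_shift by (intro image_cong) auto
  qed
  define G where "G = map_prod (gap_shift (q + p) (2 * sz d)) (gap_shift (q + p) (2 * sz d))"
  consider "p = 0" | "p > 0" "p \<le> 2 * sz u + 1" | "p > 2 * sz u + 1" by linarith
  then show ?case unfolding G_def[symmetric]
  proof cases
    case 1
    then show "edges q (ins p d (Arc u v)) = G ` edges q (Arc u v) \<union> edges (q + p) d"
      using high[of q q "2 * sz d" "Arc u v"]
      by (simp add: G_def del: edges.simps) (simp add: Un_commute)
  next
    case c: 2
    have IH: "edges (q + 1) (ins (p - 1) d u) = G ` edges (q + 1) u \<union> edges (q + p) d"
      using "2.IH"(1)[of "q + 1"] c by (simp add: G_def)
    have v: "G ` edges (q + 2 * sz u + 2) v = edges (q + 2 * sz u + 2 + 2 * sz d) v"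
      unfolding G_def by (rule high) (use c in auto)
    have "G (q, q + 2 * sz u + 1) = (q, q + 2 * (sz d + sz u) + 1)"
      using c by (auto simp: G_def gap_shift_def)
    then show "edges q (ins p d (Arc u v)) = G ` edges q (Arc u v) \<union> edges (q + p) d"
      using c IH v[symmetric] by (simp add: image_Un Un_ac algebra_simps del: One_nat_def)
  next
    case c: 3
    have IH: "edges (q + 2 * sz u + 2) (ins (p - (2 * sz u + 2)) d v) = G ` edges (q + 2 * sz u + 2) v \<union> edges (q + p) d"
    proof -
      have eq: "q + 2 * sz u + 2 + (p - (2 * sz u + 2)) = q + p" using c by simp
      have "edges (q + 2 * sz u + 2) (ins (p - (2 * sz u + 2)) d v) =
          map_prod (gap_shift (q + 2 * sz u + 2 + (p - (2 * sz u + 2))) (2 * sz d))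
            (gap_shift (q + 2 * sz u + 2 + (p - (2 * sz u + 2))) (2 * sz d)) ` edges (q + 2 * sz u + 2) v
          \<union> edges (q + 2 * sz u + 2 + (p - (2 * sz u + 2))) d"
        by (rule "2.IH"(2)) (use c "2.prems" in auto)
      then show ?thesis unfolding eq G_def .
    qed
    have u: "G ` edges (q + 1) u = edges (q + 1) u"
      unfolding G_def by (rule low) (use c in auto)
    have "G (q, q + 2 * sz u + 1) = (q, q + 2 * sz u + 1)"
      using c by (auto simp: G_def gap_shift_def)
    then show "edges q (ins p d (Arc u v)) = G ` edges q (Arc u v) \<union> edges (q + p) d"
      using c IH u by (simp add: image_Un Un_ac del: One_nat_def)
  qed
qed

section \<open>Adjacency under insertion and rotation\<close>

lemma fits_gap_shift [simp]:
  "fits (map_prod (gap_shift p m) (gap_shift p m) e) (map_prod (gap_shift p m) (gap_shift p m) f) \<longleftrightarrow> fits e f"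
  by (cases e; cases f) (auto simp: gap_shift_def split: if_splits)

lemma fits_sym: "fits e f \<longleftrightarrow> fits f e"
  by (cases e; cases f) auto

lemma nb_sym: "nb u v \<longleftrightarrow> nb v u"
  unfolding nb_def using fits_sym by metis

lemma nb_sz: "nb u v \<Longrightarrow> sz u = sz v"
  by (simp add: nb_def)

lemma fits_shift: "fits (map_prod (\<lambda>i. i + p) (\<lambda>i. i + p) e) (map_prod (\<lambda>i. i + p) (\<lambda>i. i + p) f) \<longleftrightarrow> fits e f"
  by (cases e; cases f) auto

lemma fits_ball_shift:
  "(\<forall>e\<in>edges p u. \<forall>f\<in>edges p v. fits e f) \<longleftrightarrow> (\<forall>e\<in>edges 0 u. \<forall>f\<in>edges 0 v. fits e f)"
proof -
  have "edges p w = map_prod (\<lambda>i. i + p) (\<lambda>i. i + p) ` edges 0 w" for w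
    using edges_shift[of 0 p w] by (simp add: map_prod_def)
  then show ?thesis by (simp only: ball_simps fits_shift)
qed

lemma fits_gap_block:
  assumes "(i, j) \<in> edges p d" "e \<in> map_prod (gap_shift p (2 * sz d)) (gap_shift p (2 * sz d)) ` X"
  shows "fits e (i, j)"
  using assms(2) edges_bounds[OF assms(1)] by (auto simp: gap_shift_def)

text \<open>The edges of the inserted block use consecutive points of their own, so they neither
  cross nor equal an edge from outside the block. Compatibility thus splits into a condition on the
  blocks and one on the rest; this is what lifts walks from the rest to the whole.\<close>

theorem nb_ins_iff:
  assumes "sz d = sz d'" "sz u = sz u'" "p \<le> 2 * sz u"
  shows "nb (ins p d u) (ins p d' u') \<longleftrightarrow> nb d d' \<and> nb u u'"
proof -
  let ?g = "\<lambda>X. map_prod (gap_shift p (2 * sz d)) (gap_shift p (2 * sz d)) ` X"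
  have 1: "edges 0 (ins p d u) = ?g (edges 0 u) \<union> edges p d" "edges 0 (ins p d' u') = ?g (edges 0 u') \<union> edges p d'"
    using edges_ins[of p u 0 d] edges_ins[of p u' 0 d'] assms by auto
  have 2: "fits e f" if "e \<in> ?g X" "f \<in> edges p d" for e f X
    using that fits_gap_block[of "fst f" "snd f" p d e X] by auto
  have 3: "fits f e" if "e \<in> ?g X" "f \<in> edges p d" for e f X
    using 2[OF that] fits_sym by blast
  have 4: "fits e f" if "e \<in> ?g X" "f \<in> edges p d'" for e f X
    using that fits_gap_block[of "fst f" "snd f" p d' e X] assms by auto
  have "(\<forall>e\<in>edges 0 (ins p d u). \<forall>f\<in>edges 0 (ins p d' u'). fits e f) \<longleftrightarrow>
      (\<forall>e\<in>?g (edges 0 u). \<forall>f\<in>?g (edges 0 u'). fits e f) \<and> (\<forall>e\<in>edges p d. \<forall>f\<in>edges p d'. fits e f)"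
    unfolding 1 ball_Un using 3 4 by meson
  also have "\<dots> \<longleftrightarrow> (\<forall>e\<in>edges 0 u. \<forall>f\<in>edges 0 u'. fits e f) \<and> (\<forall>e\<in>edges 0 d. \<forall>f\<in>edges 0 d'. fits e f)"
    unfolding fits_ball_shift[of p] by (simp del: fits.simps)
  finally show ?thesis unfolding nb_def using assms by auto
qed

lemma nb_cat_iff:
  assumes "sz u = sz u'"
  shows "nb (u \<oplus> v) (u' \<oplus> v') \<longleftrightarrow> nb u u' \<and> nb v v'"
proof (cases "sz v = sz v'")
  case True
  then show ?thesis using nb_ins_iff[of u u' v v' 0] assms by auto
next
  case False
  then show ?thesis using assms by (auto dest!: nb_sz)
qed

definition rot_edge :: "nat \<Rightarrow> nat \<times> nat \<Rightarrow> nat \<times> nat" where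
  "rot_edge n e = (if fst e = 0 then (snd e - 1, n - 1) else (fst e - 1, snd e - 1))"

lemma edges_rot: "edges 0 (rot u) = rot_edge (2 * sz u) ` edges 0 u"
proof (cases u)
  case (Arc a b)
  have 1: "rot_edge m ` edges (Suc q) w = edges q w" for m q w
  proof -
    have "rot_edge m ` edges (Suc q) w = (\<lambda>e. rot_edge m (fst e + 1, snd e + 1)) ` edges q w"
      using edges_shift[of q 1 w] by (simp add: image_image case_prod_beta)
    also have "\<dots> = edges q w" by (auto simp: rot_edge_def)
    finally show ?thesis .
  qed
  show ?thesis using 1[of _ 0 a] 1[of _ "2 * sz a + 1" b]
    by (auto simp: Arc image_Un) (auto simp: rot_edge_def)
qed auto

lemma fits_rot_edge:
  assumes "i < j" "j < n" "k < l" "l < n"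
  shows "fits (rot_edge n (i, j)) (rot_edge n (k, l)) \<longleftrightarrow> fits (i, j) (k, l)"
  using assms by (cases i; cases k; cases j; cases l) (auto simp: rot_edge_def)

lemma nb_rot [simp]: "nb (rot u) (rot v) \<longleftrightarrow> nb u v"
proof (cases "sz u = sz v")
  case True
  have "fits (rot_edge (2 * sz u) e) (rot_edge (2 * sz u) f) \<longleftrightarrow> fits e f" if "e \<in> edges 0 u" "f \<in> edges 0 v" for e f
    using that edges_bounds[of "fst e" "snd e" 0 u] edges_bounds[of "fst f" "snd f" 0 v] True
      fits_rot_edge[of "fst e" "snd e" "2 * sz u" "fst f" "snd f"] by simp
  then show ?thesis unfolding nb_def edges_rot using True by (simp del: fits.simps)
qed (auto simp: nb_def)

lemma nb_rot_pow [simp]: "nb ((rot ^^ n) u) ((rot ^^ n) v) \<longleftrightarrow> nb u v"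
  by (induction n) auto

lemma rot_pow_eq_iff [simp]: "(rot ^^ n) u = (rot ^^ n) v \<longleftrightarrow> u = v"
  by (induction n) auto

lemma rot_pow_cat [simp]: "(rot ^^ (2 * sz u)) (u \<oplus> v) = v \<oplus> u"
proof (induction u arbitrary: v)
  case (Arc a b)
  have "2 * sz (Arc a b) = 2 * sz b + Suc (2 * sz a + 1)" by simp
  then have "(rot ^^ (2 * sz (Arc a b))) (Arc a b \<oplus> v) = (rot ^^ (2 * sz b)) (rot ((rot ^^ (2 * sz a)) (rot (Arc a (b \<oplus> v)))))"
    by (simp only: funpow_add funpow.simps comp_apply One_nat_def id_apply cat.simps)
  also have "\<dots> = (rot ^^ (2 * sz b)) (b \<oplus> v \<oplus> over a)"
    using Arc.IH(1)[of "over (b \<oplus> v)"] by simp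
  also have "\<dots> = v \<oplus> over a \<oplus> b" using Arc.IH(2)[of "v \<oplus> over a"] by simp
  finally show ?case by simp
qed auto

lemma rot_period [simp]: "(rot ^^ (2 * sz u)) u = u"
  using rot_pow_cat[of u Emp] by simp

text \<open>\<open>rot\<close> has finite order on words of a given size, so a rotation is undone by
  rotating further. This turns invariance under rotation, proved as an implication, into an
  equivalence.\<close>

lemma rot_pow_inverse:
  obtains m where "(rot ^^ m) ((rot ^^ n) u) = u"
proof (cases "sz u = 0")
  case True
  then have "(rot ^^ 0) ((rot ^^ n) u) = u" by (induction n) auto
  then show thesis by (rule that)
next
  case False
  have "(rot ^^ (k * (2 * sz u))) u = u" for k
    by (induction k) (simp_all only: mult_Suc funpow_add comp_apply mult_0 funpow_0 rot_period)
  moreover have "n * (2 * sz u) = (n * (2 * sz u) - n) + n" using False by (cases "sz u") auto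
  ultimately have "(rot ^^ (n * (2 * sz u) - n)) ((rot ^^ n) u) = u"
    by (metis comp_apply funpow_add)
  then show thesis by (rule that)
qed

lemma ins_cat_left: "p \<le> 2 * sz a \<Longrightarrow> ins p d (a \<oplus> b) = ins p d a \<oplus> b"
  by (induction p d a rule: ins.induct) auto

lemma ins_cat_right: "p \<ge> 2 * sz a \<Longrightarrow> ins p d (a \<oplus> b) = a \<oplus> ins (p - 2 * sz a) d b"
  by (induction a arbitrary: p) auto

lemma rot_ins:
  assumes "p < 2 * sz u"
  shows "rot (ins (Suc p) d u) = ins p d (rot u)"
proof (cases u)
  case (Arc a b)
  show ?thesis
  proof (cases "p \<le> 2 * sz a")
    case True then show ?thesis by (simp add: Arc ins_cat_left)
  next
    case False
    then have "p - 2 * sz a \<le> 2 * sz b + 1" "p - 2 * sz a > 0" using assms Arc by auto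
    then show ?thesis using False by (simp add: Arc ins_cat_right)
  qed
qed (use assms in auto)

text \<open>Rotating until the gap stands in front turns an insertion into a prefix. Hence later
  arguments about removed pairs only treat words of the form
  \<open>pair c \<oplus> u\<close>.\<close>

lemma rot_pow_ins: "p \<le> 2 * sz u \<Longrightarrow> (rot ^^ p) (ins p d u) = d \<oplus> (rot ^^ p) u"
  by (induction p arbitrary: u) (auto simp: rot_ins funpow_swap1 simp del: funpow.simps(2) simp add: funpow_Suc_right)

text \<open>No edge passes over the gap before point \<open>q\<close>, so this gap lies on the outer
  level of the word.\<close>

lemma split_at_gap:
  assumes "\<And>i j. (i, j) \<in> edges p w \<Longrightarrow> i < q \<Longrightarrow> j < q" "p \<le> q" "q \<le> p + 2 * sz w"
  shows "\<exists>a b. w = a \<oplus> b \<and> q = p + 2 * sz a"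
  using assms
proof (induction w arbitrary: p)
  case Emp then show ?case by auto
next
  case (Arc u v)
  show ?case
  proof (cases "q = p")
    case True then show ?thesis by (intro exI[of _ Emp] exI[of _ "Arc u v"]) simp
  next
    case False
    then have 1: "p + 2 * sz u + 1 < q" using Arc.prems(1)[of p "p + 2 * sz u + 1"] Arc.prems(2) by auto
    have "\<exists>a b. v = a \<oplus> b \<and> q = p + 2 * sz u + 2 + 2 * sz a"
    proof (rule Arc.IH(2))
      fix i j
      assume "(i, j) \<in> edges (p + 2 * sz u + 2) v" "i < q"
      then show "j < q" using Arc.prems(1) by auto
    qed (use 1 Arc.prems(3) in auto)
    then obtain a b where "v = a \<oplus> b" "q = p + 2 * sz u + 2 + 2 * sz a" by blast
    then show ?thesis by (intro exI[of _ "Arc u a"] exI[of _ b]) simp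
  qed
qed

lemma edges_disjoint:
  assumes "(i, j) \<in> edges p u" "(k, l) \<in> edges p u" "i = k \<or> j = l \<or> j = k"
  shows "i = k \<and> j = l"
  using assms
proof (induction u arbitrary: p)
  case (Arc u v)
  note b = edges_bounds[of i j "p + 1" u] edges_bounds[of k l "p + 1" u]
    edges_bounds[of i j "p + 2 * sz u + 2" v] edges_bounds[of k l "p + 2 * sz u + 2" v]
  show ?case
    using Arc.prems b Arc.IH(1)[of "p + 1"] Arc.IH(2)[of "p + 2 * sz u + 2"] by simp linarith
qed simp

lemma edges_noncrossing:
  assumes "(i, j) \<in> edges p u" "(k, l) \<in> edges p u"
  shows "\<not> (i < k \<and> k < j \<and> j < l)"
  using assms
proof (induction u arbitrary: p)
  case (Arc u v)
  note b = edges_bounds[of i j "p + 1" u] edges_bounds[of k l "p + 1" u]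
    edges_bounds[of i j "p + 2 * sz u + 2" v] edges_bounds[of k l "p + 2 * sz u + 2" v]
  show ?case
    using Arc.prems b Arc.IH(1)[of "p + 1"] Arc.IH(2)[of "p + 2 * sz u + 2"] by simp linarith
qed simp

lemma edges_cover:
  assumes "p \<le> x" "x < p + 2 * sz u"
  obtains e where "e \<in> edges p u" "x = fst e \<or> x = snd e"
  using assms
proof (induction u arbitrary: p thesis)
  case (Arc u v)
  consider "x = p \<or> x = p + 2 * sz u + 1" | "p + 1 \<le> x" "x < p + 1 + 2 * sz u" | "p + 2 * sz u + 2 \<le> x"
    using Arc.prems by linarith
  then show ?case
  proof cases
    case 1 then show ?thesis using Arc.prems(1)[of "(p, p + 2 * sz u + 1)"] by auto
  next
    case 2 then show ?thesis using Arc.IH(1)[of "p + 1"] Arc.prems(1) by auto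
  next
    case 3
    then show ?thesis using Arc.IH(2)[of "p + 2 * sz u + 2"] Arc.prems by auto
  qed
qed simp

text \<open>The arc over \<open>d\<close> belongs to a polygon that lies either under it or beside it.\<close>

theorem nb_Arc_iff:
  "nb (Arc d u) w \<longleftrightarrow>
    (\<exists>e a. w = e \<oplus> a \<and> nb (over d) e \<and> nb u a) \<or>
    (\<exists>f a b. w = Arc (f \<oplus> a) b \<and> nb d f \<and> nb (Arc Emp u) (Arc a b))" (is "?L \<longleftrightarrow> ?A \<or> ?B")
proof
  assume "?A \<or> ?B"
  then show ?L
  proof
    assume ?A
    then obtain e a where ea: "w = e \<oplus> a" "nb (over d) e" "nb u a" by auto
    then show ?L using nb_cat_iff[OF nb_sz[OF ea(2)], of u a] by simp
  next
    assume ?B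
    then obtain f a b where fab: "w = Arc (f \<oplus> a) b" "nb d f" "nb (Arc Emp u) (Arc a b)" by auto
    then show ?L using nb_ins_iff[of d f "Arc Emp u" "Arc a b" 1] nb_sz[OF fab(2)] nb_sz[OF fab(3)] by simp
  qed
next
  assume L: ?L
  then obtain x y where w: "w = Arc x y" by (cases w) (auto simp: nb_def)
  define n where "n = 2 * sz d"
  have sizes: "sz x + sz y = sz d + sz u" using nb_sz[OF L] w by simp
  have fits0: "fits (0, n + 1) e" if "e \<in> edges 0 w" for e
    using L that by (auto simp: nb_def n_def)
  have first: "(0, 2 * sz x + 1) \<in> edges 0 w" by (simp add: w)
  have ne: "sz x \<noteq> sz d" using fits0[OF first] by (auto simp: n_def)
  show "?A \<or> ?B"
  \<comment> \<open>The partner of point 0 in \<open>w\<close> shows on which side of the edge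
    \<open>(0, n + 1)\<close> their common polygon lies: under it if \<open>sz x < sz d\<close>,
    beside it otherwise.\<close>
  proof (cases "sz x < sz d")
    case True
    \<comment> \<open>Parity: if point \<open>n + 1\<close> opened an edge of \<open>w\<close>,
      every edge of \<open>y\<close> starting before it would also end before it, and
      \<open>y\<close> would split at \<open>n + 1\<close>. The blocks have even length, but
      \<open>n + 1\<close> is odd.\<close>
    have no: "(n + 1, j) \<notin> edges 0 w" for j
    proof
      assume j: "(n + 1, j) \<in> edges 0 w"
      have "edges 0 w = insert (0, 2 * sz x + 1) (edges 1 x \<union> edges (2 * sz x + 2) y)" by (simp add: w)
      then have jy: "(n + 1, j) \<in> edges (2 * sz x + 2) y"
        using j edges_bounds[of "n + 1" j 1 x] True by (auto simp: n_def)
      have "j' < n + 1" if "(i', j') \<in> edges (2 * sz x + 2) y" "i' < n + 1" for i' j'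
      proof -
        have "j' \<noteq> n + 1"
        proof
          assume "j' = n + 1"
          have "(i', n + 1) \<in> edges 0 w" "(n + 1, j) \<in> edges 0 w" using that jy \<open>j' = n + 1\<close> by (auto simp: w)
          then have "i' = n + 1" using edges_disjoint[of i' "n + 1" 0 w "n + 1" j] by simp
          then show False using that by simp
        qed
        then show ?thesis using that fits0[of "(i', j')"] edges_bounds[OF that(1)] by (fastforce simp: w)
      qed
      then have "\<exists>a b. y = a \<oplus> b \<and> n + 1 = 2 * sz x + 2 + 2 * sz a"
        by (rule split_at_gap) (use edges_bounds[OF jy] in auto)
      then obtain a where "2 * sz d + 1 = 2 * sz x + 2 + 2 * sz a" unfolding n_def by blast
      then show False by presburger
    qed
    have "j < n + 2" if "(i, j) \<in> edges 0 w" "i < n + 2" for i j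
    proof (rule ccontr)
      assume "\<not> j < n + 2"
      moreover have "i \<noteq> 0"
      proof
        assume "i = 0"
        then have "j = 2 * sz x + 1" using that edges_bounds[of 0 j 1 x] edges_bounds[of 0 j "2 * sz x + 2" y]
          by (auto simp: w)
        then show False using \<open>\<not> j < n + 2\<close> True by (simp add: n_def)
      qed
      moreover have "i \<noteq> n + 1" using no that by auto
      ultimately show False using fits0[OF that(1)] that(2) by auto
    qed
    then have "\<exists>e a. w = e \<oplus> a \<and> n + 2 = 0 + 2 * sz e"
      by (rule split_at_gap) (use True sizes w n_def in auto)
    then obtain e a where "w = e \<oplus> a" "n + 2 = 2 * sz e" by auto
    then show ?thesis using L nb_cat_iff[of "over d" e u a] by (auto simp: n_def)
  next
    case False
    then have gt: "sz d < sz x" using ne by simp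
    \<comment> \<open>An edge of \<open>x\<close> starting under the arc could leave it only at
      \<open>n + 1\<close>. The edges of \<open>x\<close> before \<open>i\<close> would then be
      closed off, so \<open>i\<close> would be odd, contradicting
      \<open>edges_parity\<close>.\<close>
    have closed: "j < n + 1" if "(i, j) \<in> edges 1 x" "i < n + 1" for i j
    proof (rule ccontr)
      assume c: "\<not> j < n + 1"
      have i: "0 < i" using edges_bounds[OF that(1)] by simp
      have "j = n + 1" using c i that fits0[of "(i, j)"] by (auto simp: w)
      have "j' < i" if "(i', j') \<in> edges 1 x" "i' < i" for i' j'
      proof (rule ccontr)
        assume "\<not> j' < i"
        then have "j' > n + 1"
          using edges_noncrossing[OF that(1) \<open>(i, j) \<in> edges 1 x\<close>] edges_disjoint[OF that(1) \<open>(i, j) \<in> edges 1 x\<close>] \<open>j = n + 1\<close> that(2)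
          by linarith
        then show False using fits0[of "(i', j')"] that edges_bounds[OF that(1)] \<open>i < n + 1\<close> by (auto simp: w)
      qed
      then have "\<exists>a b. x = a \<oplus> b \<and> i = 1 + 2 * sz a"
        by (rule split_at_gap) (use edges_bounds[OF that(1)] in auto)
      then show False using edges_parity[OF that(1)] \<open>j = n + 1\<close> by (auto simp: n_def)
    qed
    then have "\<exists>f a. x = f \<oplus> a \<and> n + 1 = 1 + 2 * sz f"
      by (rule split_at_gap) (use gt n_def in auto)
    then obtain f a where fa: "x = f \<oplus> a" "n + 1 = 1 + 2 * sz f" by blast
    then have "nb (ins 1 d (Arc Emp u)) (ins 1 f (Arc a y))" using L w by simp
    then have "nb d f \<and> nb (Arc Emp u) (Arc a y)"
      using fa sizes by (subst (asm) nb_ins_iff) (auto simp: n_def)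
    then show ?thesis using w fa by blast
  qed
qed

section \<open>Neighbourhoods of words with an outer arc and of small words\<close>

definition nbs :: "arcs \<Rightarrow> arcs set" where
  "nbs u = {w. nb u w}"

abbreviation lf :: arcs where "lf \<equiv> Arc Emp Emp"
abbreviation VV :: arcs where "VV \<equiv> Arc Emp lf"
abbreviation II :: arcs where "II \<equiv> over lf"
abbreviation HH :: arcs where "HH \<equiv> Arc Emp VV"

lemma mem_nbs [simp]: "w \<in> nbs u \<longleftrightarrow> nb u w"
  by (simp add: nbs_def)

lemma nbs_rot: "nbs (rot u) = rot ` nbs u"
proof -
  have "w \<in> rot ` nbs u" if "nb (rot u) w" for w
  proof -
    obtain m where "(rot ^^ m) ((rot ^^ 1) w) = w" using rot_pow_inverse by blast
    then have "rot ((rot ^^ m) w) = w" by (simp add: funpow_swap1)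
    then show ?thesis using that by (metis image_eqI mem_nbs nb_rot)
  qed
  then show ?thesis by auto
qed

lemma nbs_rot_pow: "nbs ((rot ^^ n) u) = (rot ^^ n) ` nbs u"
  by (induction n) (auto simp: nbs_rot image_image)

text \<open>A neighbourhood may be computed from any starting point; the exponent is chosen so that
  \<open>nbs_Arc\<close> or a known special case applies.\<close>

lemma nbs_eq_by_rot:
  assumes "nbs ((rot ^^ n) u) = (rot ^^ n) ` X"
  shows "nbs u = X"
proof -
  have "inj (rot ^^ n)" by (simp add: inj_def)
  then show ?thesis using assms by (simp add: nbs_rot_pow inj_image_eq_iff)
qed

lemma nbs_Arc: "nbs (Arc d u) =
    {e \<oplus> a | e a. nb (over d) e \<and> nb u a} \<union> {Arc (f \<oplus> a) b | f a b. nb d f \<and> nb (Arc Emp u) (Arc a b)}"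
  unfolding nbs_def using nb_Arc_iff[of d u] by blast

lemma nb_Emp [simp]: "nb Emp w \<longleftrightarrow> w = Emp"
  by (auto simp: nb_def)

lemma nbs_Emp: "nbs Emp = {Emp}"
  by auto

lemma not_nb_lf [simp]: "\<not> nb lf w"
  by (cases w) (auto simp: nb_def)

lemma nbs_lf: "nbs lf = {}"
  by auto

lemma sz_1: "sz w = Suc 0 \<longleftrightarrow> w = lf"
  by (cases w) auto

lemma sz_2: "sz w = Suc (Suc 0) \<longleftrightarrow> w = VV \<or> w = II"
proof
  assume "sz w = Suc (Suc 0)"
  then obtain u v where w: "w = Arc u v" "sz u + sz v = Suc 0" by (cases w) auto
  then consider "sz u = 0" "sz v = Suc 0" | "sz u = Suc 0" "sz v = 0" by linarith
  then show "w = VV \<or> w = II" using w by cases (simp_all add: sz_1)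
qed auto

lemma nb_VV_iff [simp]: "nb VV w \<longleftrightarrow> w = II"
proof
  assume w: "nb VV w"
  then have "w = VV \<or> w = II" using nb_sz[OF w] sz_2[of w] by simp
  moreover have "\<not> nb VV VV" by (simp add: nb_def)
  ultimately show "w = II" using w by auto
qed (simp add: nb_def)

lemma nb_II_iff [simp]: "nb II w \<longleftrightarrow> w = VV"
proof
  assume w: "nb II w"
  then have "w = VV \<or> w = II" using nb_sz[OF w] sz_2[of w] by simp
  moreover have "\<not> nb II II" by (simp add: nb_def)
  ultimately show "w = VV" using w by auto
qed (simp add: nb_def)

lemma nbs_two: "nbs VV = {II}" "nbs II = {VV}"
  by auto

lemma nb_II_cat: "nb (II \<oplus> u) w \<longleftrightarrow> (\<exists>v. nb u v \<and> w = VV \<oplus> v)"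
  using nb_Arc_iff[of lf u w] by auto

lemma nbs_II_cat: "nbs (II \<oplus> u) = (\<oplus>) VV ` nbs u"
  using nb_II_cat[of u] by (auto simp del: cat.simps)

text \<open>An arc whose only companion on its outer side is a single short arc must be paired with it.\<close>

lemma nbs_over_lf: "nbs (over u \<oplus> lf) = (\<lambda>v. over (v \<oplus> lf)) ` nbs u"
proof -
  have "nb VV (Arc a b) \<longleftrightarrow> a = lf \<and> b = Emp" for a b by auto
  then show ?thesis by (auto simp: nbs_Arc)
qed

lemma nbs_lf_over: "nbs (lf \<oplus> over u) = (\<lambda>v. over (lf \<oplus> v)) ` nbs u"
proof (rule nbs_eq_by_rot[where n = 2])
  show "nbs ((rot ^^ 2) (lf \<oplus> over u)) = (rot ^^ 2) ` (\<lambda>v. over (lf \<oplus> v)) ` nbs u"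
    using nbs_over_lf[of u] by (simp add: numeral_2_eq_2 image_image)
qed

lemma nbs_over_over: "nbs (over (over u)) = (\<lambda>v. lf \<oplus> v \<oplus> lf) ` nbs u"
proof (rule nbs_eq_by_rot[where n = 1])
  show "nbs ((rot ^^ 1) (over (over u))) = (rot ^^ 1) ` (\<lambda>v. lf \<oplus> v \<oplus> lf) ` nbs u"
    using nbs_over_lf[of u] by (simp add: image_image)
qed


lemma sz_3: "sz w = Suc (Suc (Suc 0)) \<longleftrightarrow>
    w = HH \<or> w = Arc Emp II \<or> w = Arc lf lf \<or> w = over VV \<or> w = over II"
proof
  assume "sz w = Suc (Suc (Suc 0))"
  then obtain u v where w: "w = Arc u v" "sz u + sz v = Suc (Suc 0)" by (cases w) auto
  then consider "sz u = 0" "sz v = Suc (Suc 0)" | "sz u = Suc 0" "sz v = Suc 0" | "sz u = Suc (Suc 0)" "sz v = 0"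
    by linarith
  then show "w = HH \<or> w = Arc Emp II \<or> w = Arc lf lf \<or> w = over VV \<or> w = over II"
    using w by cases (auto simp: sz_1 sz_2)
qed auto

text \<open>The 14 words of size 4, so that the neighbours of a word of this size can be found by
  evaluation.\<close>

lemma sz_4: "sz w = Suc (Suc (Suc (Suc 0))) \<longleftrightarrow>
    (\<exists>x\<in>{HH, Arc Emp II, Arc lf lf, over VV, over II}. w = Arc Emp x \<or> w = over x) \<or>
    w \<in> {Arc lf VV, Arc lf II, Arc VV lf, Arc II lf}"
proof
  assume "sz w = Suc (Suc (Suc (Suc 0)))"
  then obtain u v where w: "w = Arc u v" "sz u + sz v = Suc (Suc (Suc 0))" by (cases w) auto
  then consider "sz u = 0" "sz v = Suc (Suc (Suc 0))" | "sz u = Suc 0" "sz v = Suc (Suc 0)"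
    | "sz u = Suc (Suc 0)" "sz v = Suc 0" | "sz u = Suc (Suc (Suc 0))" "sz v = 0"
    by linarith
  then show "(\<exists>x\<in>{HH, Arc Emp II, Arc lf lf, over VV, over II}. w = Arc Emp x \<or> w = over x) \<or>
    w \<in> {Arc lf VV, Arc lf II, Arc VV lf, Arc II lf}"
    using w by cases (auto simp: sz_1 sz_2 sz_3)
qed auto

lemma nb_HH_iff [simp]: "nb HH w \<longleftrightarrow> w = over VV"
proof
  assume w: "nb HH w"
  then have "sz w = Suc (Suc (Suc 0))" using nb_sz[OF w] by simp
  then show "w = over VV" using w unfolding sz_3 by (auto simp: nb_def)
qed (simp add: nb_def)

text \<open>\<open>Arc Emp HH\<close> is the ring with four edges. Its unions with the three
  neighbours are the octagon and the two ways of splitting the eight points into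
  quadrilaterals.\<close>

lemma nb_R4_iff [simp]: "nb (Arc Emp HH) w \<longleftrightarrow> w = over HH \<or> w = Arc lf II \<or> w = over (over II)"
proof
  assume w: "nb (Arc Emp HH) w"
  then have "sz w = Suc (Suc (Suc (Suc 0)))" using nb_sz[OF w] by simp
  then show "w = over HH \<or> w = Arc lf II \<or> w = over (over II)" using w unfolding sz_4 by (auto simp: nb_def)
qed (auto simp: nb_def)

lemma nb_over_VV_iff [simp]: "nb (over VV) w \<longleftrightarrow> w = HH"
proof
  assume w: "nb (over VV) w"
  then have "sz w = Suc (Suc (Suc 0))" using nb_sz[OF w] by simp
  then show "w = HH" using w unfolding sz_3 by (auto simp: nb_def)
qed (simp add: nb_def)

text \<open>Either \<open>VV\<close> is flipped on its own, or its two edges lie with the outer arc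
  on one hexagon; \<open>nb_HH_iff\<close> leaves nothing else.\<close>

lemma nbs_over_VV_cat: "nbs (over u \<oplus> VV) = (\<lambda>z. z \<oplus> II) ` nbs (over u) \<union> (\<lambda>f. over (f \<oplus> VV)) ` nbs u"
proof -
  have "nb HH (Arc a b) \<longleftrightarrow> a = VV \<and> b = Emp" for a b by auto
  then show ?thesis by (auto simp: nbs_Arc)
qed

lemma nbs_VV_over: "nbs (VV \<oplus> over u) = (\<lambda>z. II \<oplus> z) ` nbs (over u) \<union> (\<lambda>f. over (VV \<oplus> f)) ` nbs u"
proof (rule nbs_eq_by_rot[where n = 4])
  have 1: "(rot ^^ 4) (VV \<oplus> w) = w \<oplus> VV" "(rot ^^ 4) (II \<oplus> w) = w \<oplus> II" for w
    using rot_pow_cat[of VV w] rot_pow_cat[of II w] by (simp_all add: eval_nat_numeral)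
  have "(rot ^^ 4) (over (VV \<oplus> f)) = over (f \<oplus> VV)" for f by (simp add: eval_nat_numeral)
  then show "nbs ((rot ^^ 4) (VV \<oplus> over u)) = (rot ^^ 4) ` ((\<lambda>z. II \<oplus> z) ` nbs (over u) \<union> (\<lambda>f. over (VV \<oplus> f)) ` nbs u)"
    using nbs_over_VV_cat[of u] unfolding 1 image_Un image_image by simp
qed

section \<open>Chains of quadrilaterals\<close>

text \<open>The list records on which side of the chain the short edge of each quadrilateral lies; \<open>SS a\<close> and \<open>UU a\<close>
  are the two matchings carried by the same chain.\<close>

definition lr :: "bool \<Rightarrow> arcs \<Rightarrow> arcs \<Rightarrow> arcs" where
  "lr x u v = (if x then u \<oplus> v else v \<oplus> u)"

lemma lr_simps [simp]: "lr True u v = u \<oplus> v" "lr False u v = v \<oplus> u"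
  by (simp_all add: lr_def)

primrec SS :: "bool list \<Rightarrow> arcs" where
  "SS [] = Emp"
| "SS (x # a) = over (lr x lf (SS a))"

primrec UU :: "bool list \<Rightarrow> arcs" where
  "UU [] = Emp"
| "UU (x # a) = lr x lf (over (UU a))"

text \<open>The chains of odd size: up to rotation they are the centres of the stars, with one leaf
  for each quadrilateral (\<open>card_nbs_TT\<close>).\<close>

abbreviation TT :: "bool list \<Rightarrow> arcs" where
  "TT a \<equiv> over (UU a)"

lemma sz_lr [simp]: "sz (lr x u v) = sz u + sz v"
  by (cases x) auto

lemma sz_SS [simp]: "sz (SS a) = 2 * length a"
  by (induction a) auto

lemma sz_UU [simp]: "sz (UU a) = 2 * length a"
  by (induction a) auto

lemma nbs_lr_lf_over: "nbs (lr x lf (over u)) = (\<lambda>v. over (lr x lf v)) ` nbs u"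
  using nbs_over_lf[of u] nbs_lf_over[of u] by (cases x) auto

text \<open>Without a neighbour of \<open>u\<close> the second alternative of
  \<open>nb_Arc_iff\<close> is void: the polygon of the outer arc has to lie under it.\<close>

lemma nbs_over_isolated_cat:
  assumes "nbs u = {}"
  shows "nbs (over u \<oplus> v) = {e \<oplus> a | e a. nb (over u) e \<and> nb v a}"
proof -
  have "\<not> nb u f" for f using assms by auto
  then show ?thesis using nbs_Arc[of u v] by simp
qed

text \<open>The short edge must be paired with the arc next to it, so a neighbour would yield one of
  the interior of that arc, which has the same shape. The descent ends at \<open>lf\<close>.\<close>

lemma nbs_lr_lf_SS: "nbs (lr x lf (SS a)) = {}"
proof (induction a arbitrary: x)
  case Nil then show ?case by (cases x) auto
next
  case (Cons y a) then show ?case by (simp add: nbs_lr_lf_over)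
qed

text \<open>Stated under the hypothesis \<open>nbs (SS a) = {UU a}\<close> because the induction
  that proves this equation already uses the lemma at the previous length.\<close>

lemma nbs_SS_cat_aux:
  assumes "nbs (SS a) = {UU a}"
  shows "nbs (SS a \<oplus> v) = (\<lambda>w. UU a \<oplus> w) ` nbs v"
proof (cases a)
  case (Cons x b)
  have 1: "nb (SS a) e \<longleftrightarrow> e = UU a" for e using assms by (metis mem_nbs singleton_iff)
  have "nbs (SS a \<oplus> v) = {e \<oplus> w | e w. nb (SS a) e \<and> nb v w}"
    using nbs_over_isolated_cat[OF nbs_lr_lf_SS[of x b], of v] by (simp add: Cons)
  then show ?thesis unfolding 1 by (simp add: nbs_def) blast
qed simp

lemma nbs_SS: "nbs (SS a) = {UU a}"
proof (induction a)
  case (Cons x a)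
  \<comment> \<open>Up to rotation the chain with one more link is \<open>SS a \<oplus> VV\<close>,
    and the two blocks flip independently.\<close>
  have S: "nbs (SS a \<oplus> VV) = {UU a \<oplus> II}" using nbs_SS_cat_aux[OF Cons.IH, of VV] by (simp add: nbs_two)
  show ?case
  proof (cases x)
    case True
    show ?thesis by (rule nbs_eq_by_rot[where n = 3]) (use True S in \<open>simp add: eval_nat_numeral\<close>)
  next
    case False
    show ?thesis by (rule nbs_eq_by_rot[where n = 1]) (use False S in \<open>simp add: eval_nat_numeral\<close>)
  qed
qed (simp add: nbs_Emp)

lemmas nbs_SS_cat = nbs_SS_cat_aux[OF nbs_SS]

lemma nbs_UU: "nbs (UU a) = {SS a}"
  by (induction a) (auto simp: nbs_lr_lf_over nbs_Emp)

text \<open>The neighbour of \<open>TT (x # a)\<close> in which the outer arc, the short edge of the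
  first link and the next arc lie on one hexagon; its other three sides are the three copies of
  \<open>lf\<close>, and \<open>s\<close> fills the interior of the inner arc.\<close>

definition hexagon :: "bool \<Rightarrow> arcs \<Rightarrow> arcs" where
  "hexagon x s = (if x then VV \<oplus> s \<oplus> lf else lf \<oplus> s \<oplus> VV)"

lemma sz_hexagon [simp]: "sz (hexagon x s) = sz s + 3"
  by (simp add: hexagon_def)

text \<open>Rotating \<open>VV \<oplus> w\<close> by one or three points gives the chain step
  \<open>over (lr x lf w)\<close>. The elements of \<open>Z\<close> stand for neighbours in which
  the two edges of \<open>VV\<close> are not a quadrilateral of their own.\<close>

lemma nbs_over_lr:
  assumes "nbs (VV \<oplus> w) = (\<lambda>v. II \<oplus> v) ` nbs w \<union> (\<lambda>z. over (VV \<oplus> z)) ` Z"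
  shows "nbs (over (lr x lf w)) = (\<lambda>v. lr x lf (over v)) ` nbs w \<union> hexagon x ` Z"
proof (cases x)
  case True
  have "nbs (rot (VV \<oplus> w)) = (\<lambda>v. lf \<oplus> over v) ` nbs w \<union> hexagon x ` Z"
    unfolding nbs_rot assms by (simp add: image_Un image_image hexagon_def True)
  then show ?thesis using True by simp
next
  case False
  have "nbs ((rot ^^ 3) (VV \<oplus> w)) = (\<lambda>v. over v \<oplus> lf) ` nbs w \<union> hexagon x ` Z"
    unfolding nbs_rot_pow assms by (simp add: image_Un image_image hexagon_def False eval_nat_numeral)
  then show ?thesis using False by (simp add: eval_nat_numeral)
qed

lemma nbs_TT_Cons: "nbs (TT (x # a)) = (\<lambda>z. lr x lf (over z)) ` nbs (TT a) \<union> {hexagon x (SS a)}"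
  using nbs_over_lr[of "TT a" "{SS a}" x] nbs_VV_over[of "UU a"] by (simp add: nbs_UU)

lemma nbs_hexagon_SS: "nbs (hexagon x (SS a)) = {TT (x # a)}"
proof -
  have S: "nbs (SS a \<oplus> HH) = {UU a \<oplus> over VV}" using nbs_SS_cat[of a HH] by auto
  show ?thesis
  proof (cases x)
    case True
    show ?thesis by (rule nbs_eq_by_rot[where n = 4])
      (use True S in \<open>simp add: eval_nat_numeral hexagon_def\<close>)
  next
    case False
    show ?thesis by (rule nbs_eq_by_rot[where n = 2])
      (use False S in \<open>simp add: eval_nat_numeral hexagon_def\<close>)
  qed
qed

lemma nbs_of_nb_TT: "nb (TT a) z \<Longrightarrow> nbs z = {TT a}"
proof (induction a arbitrary: z)
  case (Cons x a)
  have "z \<in> nbs (TT (x # a))" using Cons.prems by simp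
  then consider y where "nb (TT a) y" "z = lr x lf (over y)" | "z = hexagon x (SS a)"
    unfolding nbs_TT_Cons by auto
  then show ?case
  proof cases
    case 1 then show ?thesis using Cons.IH by (simp add: nbs_lr_lf_over)
  next
    case 2 then show ?thesis using nbs_hexagon_SS[of x a] by simp
  qed
qed simp

lemma hexagon_neq_lr: "hexagon x s \<noteq> lr x lf (over z)"
proof (cases x)
  case False
  have "(lf \<oplus> s \<oplus> lf) \<oplus> lf \<noteq> over z \<oplus> lf"
    unfolding cat_cancel_right by simp
  then show ?thesis using False by (simp add: hexagon_def)
qed (simp add: hexagon_def)

lemma lr_over_inj: "inj (\<lambda>z. lr x lf (over z))"
  by (cases x) (auto simp: inj_def)

text \<open>Each link contributes exactly one neighbour, its hexagon; \<open>hexagon_neq_lr\<close>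
  separates it from those inherited from the shorter chain.\<close>

lemma card_nbs_TT: "finite (nbs (TT a)) \<and> card (nbs (TT a)) = length a"
proof (induction a)
  case Nil then show ?case by (simp add: nbs_lf)
next
  case (Cons x a)
  have "hexagon x (SS a) \<notin> (\<lambda>z. lr x lf (over z)) ` nbs (TT a)" using hexagon_neq_lr by auto
  moreover have "card ((\<lambda>z. lr x lf (over z)) ` nbs (TT a)) = length a"
    using Cons.IH card_image[OF inj_on_subset[OF lr_over_inj]] by auto
  ultimately show ?case using Cons.IH unfolding nbs_TT_Cons by simp
qed

text \<open>Either \<open>HH\<close> is flipped on its own, or the outer arc and the three edges of
  \<open>HH\<close> behave like the ring of size 4 in \<open>nb_R4_iff\<close>: an octagon or two
  quadrilaterals.\<close>

lemma nbs_over_HH: "nbs (over u \<oplus> HH) =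
    (\<lambda>z. z \<oplus> over VV) ` nbs (over u) \<union> (\<Union>f\<in>nbs u. {over (f \<oplus> HH), over (f \<oplus> lf) \<oplus> II, over (f \<oplus> over II)})"
proof -
  have "nb (Arc Emp HH) (Arc a b) \<longleftrightarrow> a = HH \<and> b = Emp \<or> a = lf \<and> b = II \<or> a = over II \<and> b = Emp" for a b by auto
  then have "nbs (over u \<oplus> HH) = {e \<oplus> a | e a. nb (over u) e \<and> nb HH a} \<union> {Arc (f \<oplus> a) b | f a b. nb u f \<and>
      (a = HH \<and> b = Emp \<or> a = lf \<and> b = II \<or> a = over II \<and> b = Emp)}"
    using nbs_Arc[of u HH] by simp
  also have "\<dots> = (\<lambda>z. z \<oplus> over VV) ` {e. nb (over u) e} \<union>
      (\<Union>f\<in>{f. nb u f}. {Arc (f \<oplus> HH) Emp, Arc (f \<oplus> lf) II, Arc (f \<oplus> over II) Emp})"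
    unfolding nb_HH_iff by blast
  finally show ?thesis by (simp add: nbs_def)
qed

lemma nbs_hexagon_over: "nbs (hexagon x (over u)) = (\<lambda>z. over (lr x lf (over z))) ` nbs (over u) \<union>
    (\<Union>f\<in>nbs u. {over (hexagon x f), lr x II (over (lr (\<not> x) lf f)), over (over (over (lr x lf f)))})"
proof (cases x)
  case True
  have "nbs ((rot ^^ 4) (hexagon x (over u))) = (rot ^^ 4) ` ((\<lambda>z. over (lr x lf (over z))) ` nbs (over u) \<union>
    (\<Union>f\<in>nbs u. {over (hexagon x f), lr x II (over (lr (\<not> x) lf f)), over (over (over (lr x lf f)))}))"
    using nbs_over_HH[of u] by (simp add: True hexagon_def eval_nat_numeral image_Un image_image image_UN)
  then show ?thesis by (rule nbs_eq_by_rot)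
next
  case False
  have "nbs ((rot ^^ 2) (hexagon x (over u))) = (rot ^^ 2) ` ((\<lambda>z. over (lr x lf (over z))) ` nbs (over u) \<union>
    (\<Union>f\<in>nbs u. {over (hexagon x f), lr x II (over (lr (\<not> x) lf f)), over (over (over (lr x lf f)))}))"
    using nbs_over_HH[of u] by (simp add: False hexagon_def eval_nat_numeral image_Un image_image image_UN insert_commute)
  then show ?thesis by (rule nbs_eq_by_rot)
qed

lemma nbs_over_hexagon_SS: "nbs (over (hexagon x (SS a))) =
    {hexagon x (TT a), lr x lf (over (over (TT a))), lr x (over (lr x II (UU a))) lf}"
proof -
  have S: "nbs (SS a \<oplus> Arc Emp HH) = {UU a \<oplus> over HH, UU a \<oplus> Arc lf II, UU a \<oplus> over (over II)}"
    unfolding nbs_SS_cat by auto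
  show ?thesis
  proof (cases x)
    case True
    have "nbs ((rot ^^ 5) (over (hexagon x (SS a)))) =
      (rot ^^ 5) ` {hexagon x (TT a), lr x lf (over (over (TT a))), lr x (over (lr x II (UU a))) lf}"
      using S by (simp add: True hexagon_def eval_nat_numeral insert_commute)
    then show ?thesis by (rule nbs_eq_by_rot)
  next
    case False
    have "nbs ((rot ^^ 3) (over (hexagon x (SS a)))) =
      (rot ^^ 3) ` {hexagon x (TT a), lr x lf (over (over (TT a))), lr x (over (lr x II (UU a))) lf}"
      using S by (simp add: False hexagon_def eval_nat_numeral insert_commute)
    then show ?thesis by (rule nbs_eq_by_rot)
  qed
qed

lemma nbs_cat_II: "nbs (u \<oplus> II) = (\<lambda>v. v \<oplus> VV) ` nbs u"
proof (rule nbs_eq_by_rot[where n = "2 * sz u"])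
  have "v \<in> nbs u \<Longrightarrow> (rot ^^ (2 * sz u)) (v \<oplus> VV) = VV \<oplus> v" for v
    using nb_sz[of u v] rot_pow_cat[of v VV] by simp
  then have "(rot ^^ (2 * sz u)) ` (\<lambda>v. v \<oplus> VV) ` nbs u = (\<lambda>v. VV \<oplus> v) ` nbs u"
    unfolding image_image by (rule image_cong[OF refl])
  then show "nbs ((rot ^^ (2 * sz u)) (u \<oplus> II)) = (rot ^^ (2 * sz u)) ` (\<lambda>v. v \<oplus> VV) ` nbs u"
    unfolding rot_pow_cat using nbs_II_cat[of u] by simp
qed

text \<open>\<^term>\<open>tame w Z\<close>: the word \<^term>\<open>w\<close> is read from a gap at which the chain can be lengthened by a pair
  \<^term>\<open>VV\<close>; the set \<^term>\<open>Z\<close> accounts for the neighbours that do not come from flipping that pair.\<close>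

definition tame :: "arcs \<Rightarrow> arcs set \<Rightarrow> bool" where
  "tame w Z \<longleftrightarrow> nbs (VV \<oplus> w) = (\<lambda>v. II \<oplus> v) ` nbs w \<union> (\<lambda>z. over (VV \<oplus> z)) ` Z \<and>
    nbs (lf \<oplus> w) = (\<lambda>z. over (lf \<oplus> z)) ` Z \<and> nbs (w \<oplus> lf) = (\<lambda>z. over (z \<oplus> lf)) ` Z"

lemma tame_over: "nbs y = Z \<Longrightarrow> tame (over y) Z"
  unfolding tame_def using nbs_VV_over[of y] nbs_lf_over[of y] nbs_over_lf[of y] by simp

text \<open>The last two clauses of \<open>tame\<close> compute the neighbours of
  \<open>lr x lf w\<close>, which is what \<open>tame_over\<close> asks for.\<close>

lemma tame_step: "tame w Z \<Longrightarrow> tame (over (lr x lf w)) ((\<lambda>z. over (lr x lf z)) ` Z)"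
  by (rule tame_over) (cases x; simp add: tame_def)

text \<open>Covers type 2, the only one of the types 0, 2, 3 whose new word is not a single outer
  arc, so that \<open>tame_over\<close> does not apply. Here \<open>II\<close> and
  \<open>SS b\<close> flip as separate blocks.\<close>

lemma tame_II_SS: "tame (lr x II (SS b)) {}"
proof -
  have 4: "(rot ^^ 4) (VV \<oplus> w) = w \<oplus> VV" "(rot ^^ 4) (II \<oplus> w) = w \<oplus> II" for w
    using rot_pow_cat[of VV w] rot_pow_cat[of II w] by (simp_all add: eval_nat_numeral)
  have 2: "(rot ^^ 2) (lf \<oplus> w) = w \<oplus> lf" for w
    using rot_pow_cat[of lf w] by (simp add: eval_nat_numeral)
  let ?w = "lr x II (SS b)"
  have c: "nbs (II \<oplus> u) = (\<lambda>v. VV \<oplus> v) ` nbs u" for u using nbs_II_cat[of u] by simp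
  have A: "nbs ?w = {lr x VV (UU b)}" "nbs (?w \<oplus> VV) = {lr x VV (UU b) \<oplus> II}" "nbs (?w \<oplus> lf) = {}"
    using c[of "SS b"] c[of "SS b \<oplus> VV"] c[of "SS b \<oplus> lf"] nbs_cat_II[of "SS b"]
      nbs_SS_cat[of b "II \<oplus> VV"] nbs_SS_cat[of b "II \<oplus> lf"] c[of VV] c[of lf]
    by (cases x; simp add: nbs_SS_cat nbs_SS nbs_two nbs_lf)+
  have "nbs (VV \<oplus> ?w) = {II \<oplus> lr x VV (UU b)}"
  proof (rule nbs_eq_by_rot)
    show "nbs ((rot ^^ 4) (VV \<oplus> ?w)) = (rot ^^ 4) ` {II \<oplus> lr x VV (UU b)}"
      unfolding image_insert image_empty 4 by (rule A)
  qed
  moreover have "nbs (lf \<oplus> ?w) = {}"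
  proof (rule nbs_eq_by_rot)
    show "nbs ((rot ^^ 2) (lf \<oplus> ?w)) = (rot ^^ 2) ` {}"
      unfolding image_empty 2 by (rule A)
  qed
  ultimately show ?thesis unfolding tame_def using A by simp
qed

text \<open>The vertices of a medium component for even \<^term>\<open>k\<close>: the types 0 and 1 are the two colour classes of the
  core (a half graph), the types 2 and 3 are the pendant neighbours of type 1, the types 4 and 5 those of type 0.\<close>

definition newest :: "bool \<Rightarrow> bool list \<Rightarrow> nat \<Rightarrow> arcs" where
  "newest x a t =
    (if t = 0 then over (hexagon x (SS a)) else if t = 1 then hexagon x (TT a)
     else if t = 2 then lr x II (over (lr (\<not> x) lf (SS a))) else if t = 3 then over (over (over (lr x lf (SS a))))
     else if t = 4 then lr x lf (over (over (TT a))) else lr x (over (lr x II (UU a))) lf)"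

text \<open>Each link adds the six words \<open>newest x a t\<close>, with \<open>i\<close>
  recording how many links were present before. Older words are lengthened according to their colour
  class: the types 0, 2, 3 like \<open>SS\<close>, the types 1, 4, 5 like \<open>UU\<close>.\<close>

fun med_vertex :: "bool list \<Rightarrow> nat \<times> nat \<Rightarrow> arcs" where
  "med_vertex [] v = Emp"
| "med_vertex (x # a) (t, i) =
    (if i = length a then newest x a t
     else if t \<in> {0, 2, 3} then over (lr x lf (med_vertex a (t, i)))
     else lr x lf (over (med_vertex a (t, i))))"

definition med_adj :: "nat \<times> nat \<Rightarrow> nat \<times> nat \<Rightarrow> bool" where
  "med_adj v w \<longleftrightarrow>
    (fst v = 0 \<and> fst w = 1 \<and> snd v \<le> snd w) \<or> (fst v = 1 \<and> fst w = 0 \<and> snd w \<le> snd v) \<or>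
    (snd v = snd w \<and> ((fst v = 1 \<and> fst w \<in> {2, 3}) \<or> (fst v \<in> {2, 3} \<and> fst w = 1) \<or>
      (fst v = 0 \<and> fst w \<in> {4, 5}) \<or> (fst v \<in> {4, 5} \<and> fst w = 0)))"

definition med_labels :: "nat \<Rightarrow> (nat \<times> nat) set" where
  "med_labels j = {..<6} \<times> {..<j}"

lemma nbs_newest:
  "nbs (newest x a 0) = newest x a ` {1, 4, 5}"
  "nbs (newest x a 1) = (\<lambda>z. over (lr x lf (over z))) ` nbs (TT a) \<union> newest x a ` {0, 2, 3}"
  "nbs (newest x a 2) = {newest x a 1}"
  "nbs (newest x a 3) = {newest x a 1}"
  "nbs (newest x a 4) = {newest x a 0}"
  "nbs (newest x a 5) = {newest x a 0}"
proof -
  have c: "nbs (II \<oplus> u) = (\<lambda>v. VV \<oplus> v) ` nbs u" for u using nbs_II_cat[of u] by simp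
  show "nbs (newest x a 0) = newest x a ` {1, 4, 5}"
    unfolding newest_def by (simp add: nbs_over_hexagon_SS insert_commute)
  show "nbs (newest x a 1) = (\<lambda>z. over (lr x lf (over z))) ` nbs (TT a) \<union> newest x a ` {0, 2, 3}"
    unfolding newest_def by (simp add: nbs_hexagon_over nbs_UU insert_commute)
  show "nbs (newest x a 2) = {newest x a 1}"
    using c[of "SS (False # a)"] nbs_cat_II[of "SS (True # a)"] nbs_SS[of "False # a"] nbs_SS[of "True # a"]
    by (cases x; simp add: newest_def hexagon_def)
  show "nbs (newest x a 3) = {newest x a 1}"
    using nbs_SS[of "x # a"] by (cases x; simp add: newest_def hexagon_def nbs_over_over)
  show "nbs (newest x a 4) = {newest x a 0}"
  proof -
    have "hexagon x (SS a) = lr x lf (lf \<oplus> SS a \<oplus> lf)" by (cases x) (auto simp: hexagon_def)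
    then show ?thesis using nbs_over_over[of "UU a"] by (simp add: newest_def nbs_lr_lf_over nbs_UU)
  qed
  show "nbs (newest x a 5) = {newest x a 0}"
    using c[of "UU a"] nbs_cat_II[of "UU a"] nbs_over_lf[of "II \<oplus> UU a"] nbs_lf_over[of "UU a \<oplus> II"]
    by (cases x; simp add: newest_def hexagon_def nbs_UU)
qed

lemma tame_newest:
  "tame (newest x a 0) {TT (x # a)}" "tame (newest x a 2) {}" "tame (newest x a 3) {}"
proof -
  show "tame (newest x a 0) {TT (x # a)}"
    using tame_over[OF nbs_hexagon_SS[of x a]] by (simp add: newest_def)
  show "tame (newest x a 2) {}"
    using tame_II_SS[of x "(\<not> x) # a"] by (simp add: newest_def)
  show "tame (newest x a 3) {}"
    using tame_over[of "over (over (lr x lf (SS a)))"] nbs_over_over[of "lr x lf (SS a)"] nbs_lr_lf_SS[of x a]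
    by (simp add: newest_def)
qed


text \<open>A shape invariant that tells the two colour classes apart: the words of types 1, 4, 5
  begin or end with a short edge.\<close>

lemma newest_shape:
  "t \<in> {0, 2, 3} \<Longrightarrow> newest x a t \<noteq> lf \<oplus> u \<and> newest x a t \<noteq> u \<oplus> lf"
  "t \<in> {1, 4, 5} \<Longrightarrow> newest x a t \<noteq> over u"
proof -
  have r: "s \<oplus> VV = u \<oplus> lf \<longleftrightarrow> s \<oplus> lf = u" "II = u \<oplus> lf \<longleftrightarrow> False" "over w = u \<oplus> lf \<longleftrightarrow> u = Emp \<and> w = Emp"
    "s \<oplus> over w = u \<oplus> lf \<longleftrightarrow> s = u \<and> w = Emp" for s u w
    using cat_over_inj[of "s \<oplus> lf" Emp u Emp] cat_over_inj[of Emp lf u Emp] cat_over_inj[of Emp w u Emp] cat_over_inj[of s w u Emp]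
    by auto
  show "t \<in> {0, 2, 3} \<Longrightarrow> newest x a t \<noteq> lf \<oplus> u \<and> newest x a t \<noteq> u \<oplus> lf"
    using r(4)[of lf "lf \<oplus> SS a" u] r(4)[of "over (lf \<oplus> SS a)" lf u] r(4)[of II "SS a \<oplus> lf" u]
    by (cases x; auto simp: newest_def r hexagon_def)
  show "t \<in> {1, 4, 5} \<Longrightarrow> newest x a t \<noteq> over u"
    by (cases x; auto simp: newest_def hexagon_def)
qed

lemma newest_inj:
  assumes "t < 6" "t' < 6" "newest x a t = newest x a t'"
  shows "t = t'"
proof -
  have B: "\<exists>u. newest x a t = lf \<oplus> u \<or> newest x a t = u \<oplus> lf" if "t \<in> {1, 4, 5}" for t
  proof -
    have "newest x a 1 = lf \<oplus> (if x then lf \<oplus> TT a \<oplus> lf else TT a \<oplus> VV)" by (simp add: newest_def hexagon_def)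
    moreover have "newest x a 4 = (if x then lf \<oplus> over (over (TT a)) else over (over (TT a)) \<oplus> lf)"
      by (simp add: newest_def)
    moreover have "newest x a 5 = (if x then over (lr x II (UU a)) \<oplus> lf else lf \<oplus> over (lr x II (UU a)))"
      by (simp add: newest_def)
    ultimately show ?thesis using that by (auto simp del: cat.simps split: if_splits)
  qed
  have AB: "newest x a s \<noteq> newest x a s'" if "s \<in> {0, 2, 3}" "s' \<in> {1, 4, 5}" for s s'
    using newest_shape(1)[OF that(1), of x a] B[OF that(2)] by metis
  have A: "newest x a s \<noteq> newest x a s'" if "s \<in> {0, 2, 3}" "s' \<in> {0, 2, 3}" "s < s'" for s s'
    using that by (cases x) (auto simp: newest_def hexagon_def)
  have B': "newest x a s \<noteq> newest x a s'" if "s \<in> {1, 4, 5}" "s' \<in> {1, 4, 5}" "s < s'" for s s'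
    using that hexagon_neq_lr[of x "TT a" "over (TT a)"] by (cases x) (auto simp: newest_def hexagon_def)
  have "t \<in> {0, 2, 3} \<or> t \<in> {1, 4, 5}" "t' \<in> {0, 2, 3} \<or> t' \<in> {1, 4, 5}" using assms by auto
  then show ?thesis using assms(3) AB A B' by (metis linorder_neqE_nat)
qed

lemma sz_newest [simp]: "sz (newest x a t) = 2 * length a + 4"
  by (simp add: newest_def)

lemma sz_med_vertex: "i < length a \<Longrightarrow> sz (med_vertex a (t, i)) = 2 * length a + 2"
  by (induction a) (auto simp: less_Suc_eq)

lemma med_vertex_shape:
  assumes "i < length a"
  shows "t \<in> {0, 2, 3} \<Longrightarrow> med_vertex a (t, i) \<noteq> lf \<oplus> u \<and> med_vertex a (t, i) \<noteq> u \<oplus> lf"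
    and "t \<in> {1, 4, 5} \<Longrightarrow> med_vertex a (t, i) \<noteq> over u"
proof -
  obtain x b where a: "a = x # b" using assms by (cases a) auto
  have o: "over w \<noteq> lf \<oplus> u \<and> over w \<noteq> u \<oplus> lf" if "w \<noteq> Emp" for w u
    using that cat_over_inj[of Emp w u Emp] by auto
  have n: "lr x lf w \<noteq> Emp" for w by (cases x) auto
  have l: "lr x lf (over w) \<noteq> over u" for w u by (cases x) auto
  show "t \<in> {0, 2, 3} \<Longrightarrow> med_vertex a (t, i) \<noteq> lf \<oplus> u \<and> med_vertex a (t, i) \<noteq> u \<oplus> lf"
    using newest_shape(1)[of t x b u] o[OF n, of "med_vertex b (t, i)" u] unfolding a
    by (cases "i = length b") (simp_all del: cat.simps)
  show "t \<in> {1, 4, 5} \<Longrightarrow> med_vertex a (t, i) \<noteq> over u"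
    using newest_shape(2)[of t x b u] l[of "med_vertex b (t, i)" u] unfolding a
    by (cases "i = length b") (auto simp del: cat.simps)
qed

lemma med_vertex_old_neq_newest:
  assumes "i < length a" "t < 6" "t' < 6"
  shows "med_vertex (x # a) (t, i) \<noteq> newest x a t'"
proof -
  define w where "w = med_vertex a (t, i)"
  have w: "w \<noteq> Emp" using sz_med_vertex[OF assms(1), of t] unfolding w_def by (metis add_is_0 sz.simps(1) zero_neq_numeral)
  have lo: "lr x lf w \<noteq> over z" for z
    using w cat_over_inj[of w Emp Emp z] by (cases x) auto
  consider "t \<in> {0, 2, 3}" "t' \<in> {0, 2, 3}" | "t \<in> {0, 2, 3}" "t' \<in> {1, 4, 5}"
    | "t \<in> {1, 4, 5}" "t' \<in> {0, 2, 3}" | "t \<in> {1, 4, 5}" "t' \<in> {1, 4, 5}"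
    using assms by force
  then show ?thesis
  proof cases
    case 1
    have "hexagon x (SS a) = lr x lf (lf \<oplus> SS a \<oplus> lf)" by (cases x) (auto simp: hexagon_def)
    moreover have "w \<noteq> lf \<oplus> SS a \<oplus> lf" using med_vertex_shape(1)[OF assms(1) 1(1)] unfolding w_def by blast
    moreover have "lr x lf u = lr x lf v \<longleftrightarrow> u = v" for u v by (cases x) auto
    ultimately have "lr x lf w \<noteq> hexagon x (SS a)" by simp
    moreover have "lr x II (over z) \<noteq> over v" for z v by (cases x) auto
    ultimately show ?thesis using 1 assms(1) lo by (auto simp: newest_def w_def[symmetric]) metis+
  next
    case 2
    then show ?thesis using newest_shape(2)[OF 2(2), of x a "lr x lf w"] assms(1) by (auto simp: w_def[symmetric])
  next
    case 3
    then show ?thesis using newest_shape(1)[OF 3(2), of x a "over w"] assms(1)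
      by (cases x) (auto simp: w_def[symmetric])
  next
    case 4
    have "w \<noteq> over u" for u using med_vertex_shape(2)[OF assms(1) 4(1)] unfolding w_def .
    then have "lr x lf (over w) \<noteq> lr x lf (over (over (TT a)))" by (cases x) auto
    moreover have "lr x lf (over w) \<noteq> lr x (over (lr x II (UU a))) lf" using w by (cases x) auto
    moreover have "lr x lf (over w) \<noteq> hexagon x (TT a)" using hexagon_neq_lr by metis
    ultimately show ?thesis using 4 assms(1) by (auto simp: newest_def w_def[symmetric])
  qed
qed

lemma inj_med_vertex: "inj_on (med_vertex a) (med_labels (length a))"
proof (induction a)
  case Nil then show ?case by (simp add: med_labels_def)
next
  case (Cons x a)
  have "v = w" if vw: "v \<in> med_labels (Suc (length a))" "w \<in> med_labels (Suc (length a))"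
    "med_vertex (x # a) v = med_vertex (x # a) w" for v w
  proof -
    obtain t i t' i' where v: "v = (t, i)" "w = (t', i')" by (cases v; cases w)
    have b: "t < 6" "t' < 6" "i \<le> length a" "i' \<le> length a" using vw by (auto simp: v med_labels_def)
    consider "i = length a" "i' = length a" | "i < length a" "i' = length a" | "i = length a" "i' < length a"
      | "i < length a" "i' < length a" using b by linarith
    then show ?thesis
    proof cases
      case 1 then show ?thesis using vw(3) newest_inj[OF b(1,2), of x a] by (simp add: v)
    next
      case 2 then show ?thesis using vw(3) med_vertex_old_neq_newest[OF _ b(1,2), of i a x] by (simp add: v)
    next
      case 3 then show ?thesis using vw(3) med_vertex_old_neq_newest[OF _ b(2,1), of i' a x] by (simp add: v)
    next
      case 4
      have inj: "lr x lf p = lr x lf q \<longleftrightarrow> p = q" "lr x lf (over p) \<noteq> over q" for p q by (cases x; auto)+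
      have "med_vertex a v = med_vertex a w"
        using vw(3) 4 inj unfolding v by (auto split: if_splits) (metis inj(2))+
      moreover have "v \<in> med_labels (length a)" "w \<in> med_labels (length a)"
        using b 4 by (auto simp: v med_labels_def)
      ultimately show ?thesis using Cons.IH by (auto dest: inj_onD)
    qed
  qed
  then show ?case by (auto intro: inj_onI)
qed

text \<open>The claims need each other. Tameness of the types 0, 2, 3 determines their neighbours
  after lengthening; the last claim identifies the old neighbours of the new word of type 1.\<close>

lemma med_structure:
  "(\<forall>v\<in>med_labels (length a). nbs (med_vertex a v) = med_vertex a ` {w \<in> med_labels (length a). med_adj v w}) \<and>
   (\<forall>i<length a. tame (med_vertex a (0, i)) {TT a} \<and> tame (med_vertex a (2, i)) {} \<and> tame (med_vertex a (3, i)) {}) \<and>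
   (\<lambda>i. med_vertex a (0, i)) ` {..<length a} = over ` nbs (TT a)"
proof (induction a)
  case Nil then show ?case by (simp add: med_labels_def nbs_lf)
next
  case (Cons x a)
  let ?j = "length a" and ?g = "med_vertex a" and ?f = "med_vertex (x # a)"
  have N: "nbs (?g v) = ?g ` {w \<in> med_labels ?j. med_adj v w}" if "v \<in> med_labels ?j" for v
    using Cons.IH that by blast
  have tame: "tame (?g (0, i)) {TT a}" "tame (?g (2, i)) {}" "tame (?g (3, i)) {}" if "i < ?j" for i
    using Cons.IH that by blast+
  have C: "(\<lambda>i. ?g (0, i)) ` {..<?j} = over ` nbs (TT a)" using Cons.IH by blast
  have A: "?f (t, i) = over (lr x lf (?g (t, i)))" if "t \<in> {0, 2, 3}" "i < ?j" for t i using that by auto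
  have B: "?f (t, i) = lr x lf (over (?g (t, i)))" if "t \<in> {1, 4, 5}" "i < ?j" for t i using that by auto
  have new: "?f (t, ?j) = newest x a t" for t by simp
  have 1: "nbs (?f v) = ?f ` {w \<in> med_labels (Suc ?j). med_adj v w}" if "v \<in> med_labels (Suc ?j)" for v
  proof -
    obtain t i where v: "v = (t, i)" by (cases v)
    have t: "t < 6" "i < Suc ?j" using that by (auto simp: v med_labels_def)
    show ?thesis
    proof (cases "i < ?j")
      case True
      then have mem: "v \<in> med_labels ?j" using t by (auto simp: v med_labels_def)
      have img: "(\<lambda>u. F u) ` nbs (?g v) = ?f ` {w \<in> med_labels ?j. med_adj v w}"
        if "\<And>w. w \<in> med_labels ?j \<Longrightarrow> med_adj v w \<Longrightarrow> ?f w = F (?g w)" for F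
        unfolding N[OF mem] image_image using that by (intro image_cong) auto
      consider "t = 0" | "t \<in> {2, 3}" | "t \<in> {1, 4, 5}" using t by force
      then show ?thesis
      proof cases
        case 1
        \<comment> \<open>The single element \<open>TT a\<close> of \<open>Z\<close> contributes the
          extra neighbour \<open>hexagon x (TT a)\<close>, the new word of type 1. Every old word of
          type 0 gains just this neighbour, which is how the half graph grows.\<close>
        have "nbs (?f v) = (\<lambda>u. lr x lf (over u)) ` nbs (?g v) \<union> {hexagon x (TT a)}"
          using nbs_over_lr[of "?g v" "{TT a}" x] tame(1)[OF True] A[OF _ True, of 0] unfolding v 1 tame_def by simp
        also have "(\<lambda>u. lr x lf (over u)) ` nbs (?g v) = ?f ` {w \<in> med_labels ?j. med_adj v w}"
          by (rule img) (auto simp: v 1 med_adj_def med_labels_def)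
        also have "hexagon x (TT a) = ?f (1, ?j)" by (simp add: newest_def)
        finally have "nbs (?f v) = ?f ` {w \<in> med_labels ?j. med_adj v w} \<union> {?f (1, ?j)}" .
        moreover have "{w \<in> med_labels (Suc ?j). med_adj v w} = insert (1, ?j) {w \<in> med_labels ?j. med_adj v w}"
          using True by (auto simp: v 1 med_adj_def med_labels_def)
        ultimately show ?thesis by (simp del: med_vertex.simps)
      next
        case 2
        have "nbs (?f v) = (\<lambda>u. lr x lf (over u)) ` nbs (?g v)"
          using nbs_over_lr[of "?g v" "{}" x] tame(2,3)[OF True] A[OF _ True, of t] 2 unfolding v tame_def by auto
        also have "\<dots> = ?f ` {w \<in> med_labels ?j. med_adj v w}"
          by (rule img) (use 2 in \<open>auto simp: v med_adj_def med_labels_def\<close>)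
        also have "{w \<in> med_labels ?j. med_adj v w} = {w \<in> med_labels (Suc ?j). med_adj v w}"
          using True 2 by (auto simp: v med_adj_def med_labels_def)
        finally show ?thesis .
      next
        case 3
        have "nbs (?f v) = (\<lambda>u. over (lr x lf u)) ` nbs (?g v)"
          using nbs_lr_lf_over[of x "?g v"] B[OF 3 True] unfolding v by simp
        also have "\<dots> = ?f ` {w \<in> med_labels ?j. med_adj v w}"
          by (rule img) (use 3 in \<open>auto simp: v med_adj_def med_labels_def\<close>)
        also have "{w \<in> med_labels ?j. med_adj v w} = {w \<in> med_labels (Suc ?j). med_adj v w}"
          using True 3 by (auto simp: v med_adj_def med_labels_def)
        finally show ?thesis .
      qed
    next
      case False
      then have i: "i = ?j" using t by simp
      \<comment> \<open>These neighbours of the new word of type 1 come from the leaves of the star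
        of \<open>TT a\<close>, which by the last claim correspond to all the old words of type
        0.\<close>
      have old: "(\<lambda>z. over (lr x lf (over z))) ` nbs (TT a) = ?f ` ({0} \<times> {..<?j})"
      proof -
        have "(\<lambda>z. over (lr x lf (over z))) ` nbs (TT a) = (\<lambda>u. over (lr x lf u)) ` (\<lambda>i. ?g (0, i)) ` {..<?j}"
          unfolding C image_image ..
        also have "\<dots> = (\<lambda>i. ?f (0, i)) ` {..<?j}" unfolding image_image by (intro image_cong) auto
        finally show ?thesis by (auto simp del: med_vertex.simps)
      qed
      have adj: "{w \<in> med_labels (Suc ?j). med_adj (0, ?j) w} = (\<lambda>t. (t, ?j)) ` {1, 4, 5}"
        "{w \<in> med_labels (Suc ?j). med_adj (1, ?j) w} = {0} \<times> {..<?j} \<union> (\<lambda>t. (t, ?j)) ` {0, 2, 3}"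
        "s \<in> {2, 3} \<Longrightarrow> {w \<in> med_labels (Suc ?j). med_adj (s, ?j) w} = {(1, ?j)}"
        "s \<in> {4, 5} \<Longrightarrow> {w \<in> med_labels (Suc ?j). med_adj (s, ?j) w} = {(0, ?j)}" for s
        by (auto simp: med_adj_def med_labels_def)
      consider "t = 0" | "t = 1" | "t \<in> {2, 3}" | "t \<in> {4, 5}" using t by force
      then show ?thesis
        by cases (auto simp only: v i new nbs_newest adj image_Un image_image old image_insert image_empty insertE)
    qed
  qed
  have 2: "tame (?f (0, i)) {TT (x # a)} \<and> tame (?f (2, i)) {} \<and> tame (?f (3, i)) {}" if "i < Suc ?j" for i
  proof (cases "i < ?j")
    case True
    then show ?thesis using tame_step[OF tame(1)[OF True], of x] tame_step[OF tame(2)[OF True], of x]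
      tame_step[OF tame(3)[OF True], of x] by simp
  next
    case False
    then have "i = ?j" using that by simp
    then show ?thesis using tame_newest[of x a] by simp
  qed
  have 3: "(\<lambda>i. ?f (0, i)) ` {..<Suc ?j} = over ` nbs (TT (x # a))"
  proof -
    have "(\<lambda>i. ?f (0, i)) ` {..<?j} = (\<lambda>u. over (lr x lf u)) ` (\<lambda>i. ?g (0, i)) ` {..<?j}"
      unfolding image_image by (intro image_cong) auto
    also have "\<dots> = over ` (\<lambda>z. lr x lf (over z)) ` nbs (TT a)" unfolding C image_image ..
    finally show ?thesis unfolding lessThan_Suc image_insert nbs_TT_Cons image_Un image_empty
      by (simp add: newest_def)
  qed
  show ?case using 1 2 3 by simp
qed

section \<open>Walks to the ring\<close>

text \<open>The first argument is the parity of the length.\<close>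

inductive walk :: "bool \<Rightarrow> arcs \<Rightarrow> arcs \<Rightarrow> bool" where
  walk_refl: "walk False u u"
| walk_step: "walk b u v \<Longrightarrow> nb v w \<Longrightarrow> walk (\<not> b) u w"

definition conn :: "arcs \<Rightarrow> arcs \<Rightarrow> bool" where
  "conn u v \<longleftrightarrow> (\<exists>b. walk b u v)"

lemma walk_nb: "nb u v \<Longrightarrow> walk True u v"
  using walk_step[OF walk_refl] by simp

lemma walk_trans: "walk c v w \<Longrightarrow> walk b u v \<Longrightarrow> walk (b \<noteq> c) u w"
proof (induction rule: walk.induct)
  case (walk_step c v w x)
  have "walk (\<not> (b \<noteq> c)) u x" by (rule walk.walk_step[OF walk_step.IH[OF walk_step.prems] walk_step.hyps(2)])
  then show ?case by (cases b; cases c) auto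
qed simp

lemma walk_sym: "walk b u v \<Longrightarrow> walk b v u"
proof (induction rule: walk.induct)
  case (walk_step b u v w)
  have "walk True w v" using walk_nb nb_sym walk_step.hyps(2) by blast
  then have "walk (True \<noteq> b) w u" by (rule walk_trans[OF walk_step.IH])
  then show ?case by simp
qed (rule walk_refl)

lemma walk_sz: "walk b u v \<Longrightarrow> sz u = sz v"
  by (induction rule: walk.induct) (auto dest: nb_sz)

lemma walk_rot_pow: "walk b u v \<Longrightarrow> walk b ((rot ^^ n) u) ((rot ^^ n) v)"
  by (induction rule: walk.induct) (auto intro: walk.intros)

lemma conn_refl [simp]: "conn u u"
  using walk_refl by (auto simp: conn_def)

lemma conn_nb: "nb u v \<Longrightarrow> conn u v"
  using walk_nb by (auto simp: conn_def)

lemma conn_trans [trans]: "conn u v \<Longrightarrow> conn v w \<Longrightarrow> conn u w"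
  unfolding conn_def using walk_trans by blast

lemma conn_sym: "conn u v \<Longrightarrow> conn v u"
  unfolding conn_def using walk_sym by blast

lemma conn_sz: "conn u v \<Longrightarrow> sz u = sz v"
  unfolding conn_def using walk_sz by blast

lemma conn_rot_pow: "conn u v \<Longrightarrow> conn ((rot ^^ n) u) ((rot ^^ n) v)"
  unfolding conn_def using walk_rot_pow by blast

lemma conn_rot_of: "conn v u \<Longrightarrow> conn v (rot v) \<Longrightarrow> conn v (rot u)"
  using conn_rot_pow[of v u 1] conn_trans by simp

lemma conn_rtranclp: "conn u v \<longleftrightarrow> nb\<^sup>*\<^sup>* u v"
proof
  show "nb\<^sup>*\<^sup>* u v" if "conn u v"
  proof -
    have "walk b u v \<Longrightarrow> nb\<^sup>*\<^sup>* u v" for b by (induction rule: walk.induct) auto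
    then show ?thesis using that by (auto simp: conn_def)
  qed
  show "conn u v" if "nb\<^sup>*\<^sup>* u v"
    using that by (induction rule: rtranclp_induct) (auto intro: conn_trans conn_nb)
qed

fun chain :: "arcs list \<Rightarrow> bool" where
  "chain (u # v # us) \<longleftrightarrow> nb u v \<and> chain (v # us)"
| "chain _ \<longleftrightarrow> True"

lemma walk_chain: "chain (u # us) \<Longrightarrow> walk (odd (length us)) u (last (u # us))"
proof (induction us arbitrary: u)
  case (Cons v us)
  then have "nb u v" "walk (odd (length us)) v (last (v # us))" by simp_all
  then have "walk (True \<noteq> odd (length us)) u (last (v # us))"
    using walk_trans walk_nb by blast
  then show ?case by simp
qed (simp add: walk_refl)

section \<open>Lifting walks through an inserted pair\<close>

definition pair :: "bool \<Rightarrow> arcs" where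
  "pair c = (if c then II else VV)"

lemma sz_pair [simp]: "sz (pair c) = 2"
  by (simp add: pair_def)

text \<open>The pair is flipped in every step, so its final state is determined by the parity of the
  walk.\<close>

lemma walk_pair: "walk b u v \<Longrightarrow> walk b (pair c \<oplus> u) (pair (c \<noteq> b) \<oplus> v)"
proof (induction rule: walk.induct)
  case (walk_step b u v w)
  have "nb (pair d \<oplus> v) (pair (\<not> d) \<oplus> w)" for d
    using walk_step.hyps(2) nb_cat_iff[of "pair d" "pair (\<not> d)" v w] by (simp add: pair_def)
  then have "walk (\<not> b) (pair c \<oplus> u) (pair (\<not> (c \<noteq> b)) \<oplus> w)" by (rule walk.walk_step[OF walk_step.IH])
  then show ?case by (cases b; cases c) auto
qed (simp add: walk_refl)

primrec ring :: "nat \<Rightarrow> arcs" where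
  "ring 0 = Emp"
| "ring (Suc n) = Arc Emp (ring n)"

lemma ring_numeral [simp]: "ring (numeral k) = Arc Emp (ring (pred_numeral k))"
  by (simp add: numeral_eq_Suc)

lemma sz_ring [simp]: "sz (ring n) = n"
  by (induction n) auto

lemma ring_add: "ring (m + n) = ring m \<oplus> ring n"
  by (induction m) auto

lemma rot_ring_pow: "(rot ^^ (2 * m)) (ring n) = ring n"
proof -
  have "rot (rot (ring n)) = ring n"
  proof (cases n)
    case (Suc m)
    have "ring m \<oplus> lf = lf \<oplus> ring m" using ring_add[of m 1] ring_add[of 1 m] by (simp add: add.commute)
    then show ?thesis by (simp add: Suc)
  qed simp
  then have "(rot ^^ 2) (ring n) = ring n" by (simp add: numeral_2_eq_2)
  then show ?thesis unfolding funpow_mult[symmetric] by (induction m) auto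
qed

lemma edges_ring: "edges p (ring n) = (\<lambda>i. (p + 2 * i, p + 2 * i + 1)) ` {..<n}"
proof (induction n arbitrary: p)
  case (Suc n)
  have "{..<Suc n} = insert 0 (Suc ` {..<n})" by (auto simp: image_iff lessThan_Suc_eq_insert_0)
  then show ?case using Suc[of "p + 2"] by (simp add: image_image)
qed simp

text \<open>The two matchings together are the boundary of the polygon on all points. With a single
  edge they would coincide, hence the two successors.\<close>

lemma nb_ring: "nb (ring (Suc (Suc n))) (rot (ring (Suc (Suc n))))"
proof -
  have "fits (2 * i, 2 * i + 1) (1 + 2 * j, 1 + 2 * j + 1)" for i j by simp presburger
  moreover have "fits (2 * i, 2 * i + 1) (0, 2 * n + 3)" if "i < n + 2" for i using that by auto
  moreover have "edges 0 (rot (ring (Suc (Suc n)))) = insert (0, 2 * n + 3) ((\<lambda>i. (1 + 2 * i, 1 + 2 * i + 1)) ` {..<Suc n})"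
    using edges_ring[of 1 "Suc n"] by (simp add: eval_nat_numeral)
  ultimately show ?thesis unfolding nb_def edges_ring[of 0 "Suc (Suc n)"]
    by (auto simp del: fits.simps ring.simps rot.simps)
qed

text \<open>Walks of both parities are needed: flipping a pair ties the parity of a walk to the shape of the pair.\<close>

definition strong :: "arcs \<Rightarrow> bool" where
  "strong u \<longleftrightarrow> (\<forall>b. walk b (ring (sz u)) u)"

lemma strong_walk:
  assumes "strong u" "walk b u v"
  shows "strong v"
  unfolding strong_def
proof
  fix c
  have "walk (c \<noteq> b) (ring (sz v)) u" using assms walk_sz[OF assms(2)] by (simp add: strong_def)
  from walk_trans[OF assms(2) this] show "walk c (ring (sz v)) v" by (cases b; cases c) simp_all
qed

text \<open>The rotated ring is one step away from the ring; the change of parity does no harm,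
  because \<open>strong\<close> provides both.\<close>

lemma strong_rot:
  assumes "strong u" "2 \<le> sz u"
  shows "strong (rot u)"
proof -
  obtain n where n: "sz u = Suc (Suc n)" using assms(2) by (metis add_2_eq_Suc le_Suc_ex)
  have 1: "walk b (rot (ring (sz u))) (rot u)" for b
    using assms(1) walk_rot_pow[of b "ring (sz u)" u 1] by (simp add: strong_def)
  have "walk b (ring (sz u)) (rot u)" for b
    using walk_trans[OF 1[of "\<not> b", unfolded n] walk_nb[OF nb_ring[of n]]] n by simp
  then show ?thesis by (simp add: strong_def)
qed

lemma strong_rot_pow: "strong u \<Longrightarrow> 2 \<le> sz u \<Longrightarrow> strong ((rot ^^ n) u)"
  by (induction n) (auto intro: strong_rot)

lemma strong_rot_pow_iff: "2 \<le> sz u \<Longrightarrow> strong ((rot ^^ n) u) \<longleftrightarrow> strong u"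
  using rot_pow_inverse[of n u] strong_rot_pow[of "(rot ^^ n) u"] strong_rot_pow[of u] by (metis sz_rot_pow)

text \<open>The two strong words are \<open>pair c \<oplus> ring (n - 2)\<close> for both values of
  \<open>c\<close>.\<close>

definition base :: "nat \<Rightarrow> bool" where
  "base n \<longleftrightarrow> 2 \<le> n \<and> strong (ring n) \<and> strong (II \<oplus> ring (n - 2))"

text \<open>Choosing the walk from \<open>u\<close> to the ring with parity \<open>c\<close> turns
  the pair into \<open>VV\<close>, whichever pair it was.\<close>

lemma strong_pair_cat_aux:
  assumes "base n" "strong (ring (n + 2))" "strong u" "sz u = n"
  shows "strong (pair c \<oplus> u)"
proof -
  have "walk c u (ring n)" using assms walk_sym by (auto simp: strong_def)
  then have "walk c (pair c \<oplus> u) (VV \<oplus> ring n)" using walk_pair[of c u "ring n" c] by (simp add: pair_def)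
  moreover have "VV \<oplus> ring n = ring (n + 2)" by simp
  ultimately show ?thesis using assms(2) strong_walk walk_sym by metis
qed

text \<open>The odd closed walk at \<open>ring n\<close> lifts to an odd walk from
  \<open>ring (n + 2)\<close> to \<open>II \<oplus> ring n\<close>, and by rotation to
  \<open>ring n \<oplus> II\<close>. The latter word is
  \<open>VV \<oplus> ring (n - 2) \<oplus> II\<close>; lifting an even walk from
  \<open>ring (n - 2) \<oplus> II\<close> to \<open>ring n\<close> leads back to
  \<open>ring (n + 2)\<close>. Together they form an odd closed walk.\<close>

lemma base_step:
  assumes "base n"
  shows "base (n + 2)"
proof -
  have n: "2 \<le> n" "strong (ring n)" "strong (II \<oplus> ring (n - 2))" using assms by (auto simp: base_def)
  then obtain m where m: "n = m + 2" by (metis le_add_diff_inverse2)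
  then have r: "ring n = VV \<oplus> ring (n - 2)" by simp
  have 4: "(rot ^^ 4) (II \<oplus> u) = u \<oplus> II" for u using rot_pow_cat[of II u] by simp
  have 1: "walk True (ring (n + 2)) (II \<oplus> ring n)"
    using walk_pair[of True "ring n" "ring n" False] n(2) by (simp add: strong_def pair_def)
  have "strong (ring (n - 2) \<oplus> II)" using strong_rot_pow[OF n(3), of 4] n(1) unfolding 4 by simp
  then have "walk False (ring (sz (ring (n - 2) \<oplus> II))) (ring (n - 2) \<oplus> II)"
    unfolding strong_def by blast
  moreover have "sz (ring (n - 2) \<oplus> II) = n" using n(1) by simp
  ultimately have "walk False (ring (n - 2) \<oplus> II) (ring n)" using walk_sym by metis
  then have "walk False (VV \<oplus> ring (n - 2) \<oplus> II) (VV \<oplus> ring n)"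
    using walk_pair[of False _ _ False] by (simp add: pair_def del: cat.simps)
  moreover have "VV \<oplus> ring (n - 2) \<oplus> II = ring n \<oplus> II" "VV \<oplus> ring n = ring (n + 2)" by (simp only: r cat_assoc) simp
  ultimately have 2: "walk False ((rot ^^ 4) (II \<oplus> ring n)) (ring (n + 2))" unfolding 4 by simp
  have 3: "walk True (ring (n + 2)) ((rot ^^ 4) (II \<oplus> ring n))"
    using walk_rot_pow[OF 1, of 4] rot_ring_pow[of 2 "n + 2"] by simp
  have "walk True (ring (n + 2)) (ring (n + 2))" using walk_trans[OF 2 3] by simp
  then have "walk b (ring (n + 2)) (ring (n + 2))" for b using walk_refl by (cases b) auto
  then have s: "strong (ring (n + 2))" by (simp add: strong_def del: ring.simps)
  moreover have "strong (II \<oplus> ring n)" using strong_walk[OF s 1] .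
  ultimately show ?thesis by (simp add: base_def)
qed

text \<open>An explicit certificate with seven steps, each checked by evaluating \<open>nb\<close>
  on the edges.\<close>

lemma walk_ring_9: "walk True (ring 9) (ring 9)"
proof -
  have "chain [Arc Emp (Arc Emp (Arc Emp (Arc Emp (Arc Emp (Arc Emp HH))))),
      Arc lf (over (Arc Emp (Arc Emp (Arc Emp HH)))),
      Arc Emp (Arc Emp (Arc Emp (over (over (over (over VV)))))),
      Arc VV (Arc Emp (Arc Emp (Arc lf VV))),
      Arc (Arc lf VV) (Arc Emp (Arc Emp II)),
      Arc (Arc Emp (Arc Emp (Arc lf VV))) VV,
      over (Arc (over (over (over VV))) VV),
      Arc Emp (Arc Emp (Arc Emp (Arc Emp (Arc Emp (Arc Emp HH)))))]"
    by (simp add: nb_def)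
  from walk_chain[OF this] show ?thesis by simp
qed

lemma walk_leg_9: "walk False (ring 9) (II \<oplus> ring 7)"
proof -
  have "chain [Arc Emp (Arc Emp (Arc Emp (Arc Emp (Arc Emp (Arc Emp HH))))),
      over (Arc (Arc VV II) VV),
      Arc (Arc Emp (Arc lf (over VV))) VV,
      Arc Emp (Arc (Arc Emp (Arc Emp HH)) II),
      Arc (Arc Emp (Arc VV II)) VV,
      Arc Emp (Arc Emp (Arc lf (Arc VV II))),
      Arc lf (Arc Emp (Arc Emp (Arc Emp (Arc Emp HH))))]"
    by (simp add: nb_def)
  from walk_chain[OF this] show ?thesis by simp
qed

text \<open>A word of size 7 may be joined to \<open>II \<oplus> ring 5\<close> instead of the ring;
  this walk serves the case where a second \<open>II\<close> is put in front of it.\<close>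

lemma walk_II_II_9: "walk True (ring 9) (II \<oplus> II \<oplus> ring 5)"
proof -
  have "chain [Arc Emp (Arc Emp (Arc Emp (Arc Emp (Arc Emp (Arc Emp HH))))),
      Arc (Arc Emp (Arc Emp (Arc Emp HH))) II,
      Arc Emp (Arc (Arc lf (over VV)) VV),
      over (Arc (Arc VV (Arc lf lf)) lf),
      Arc (Arc (Arc Emp (Arc Emp HH)) lf) lf,
      over (Arc (Arc lf (Arc VV lf)) lf),
      Arc (Arc VV (Arc lf VV)) lf,
      over (Arc Emp (Arc Emp (Arc Emp (Arc Emp (Arc Emp (Arc lf lf)))))),
      Arc Emp (Arc Emp (Arc Emp (Arc Emp (over (over (over VV)))))),
      Arc lf (Arc lf (Arc Emp (Arc Emp HH)))]"
    by (simp add: nb_def)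
  from walk_chain[OF this] show ?thesis by simp
qed

lemma walk_ring_10: "walk True (ring 10) (ring 10)"
proof -
  have "chain [Arc Emp (Arc Emp (Arc Emp (Arc Emp (Arc Emp (Arc Emp (Arc Emp HH)))))),
      Arc VV (over (over (over (over (over VV))))),
      over (Arc lf (Arc Emp (Arc Emp (Arc Emp (Arc lf VV))))),
      Arc (Arc Emp (Arc Emp (Arc VV VV))) VV,
      over (Arc (over (over (over HH))) VV),
      Arc Emp (Arc Emp (Arc Emp (Arc Emp (Arc Emp (Arc Emp (Arc Emp HH))))))]"
    by (simp add: nb_def)
  from walk_chain[OF this] show ?thesis by simp
qed

lemma walk_leg_10: "walk False (ring 10) (II \<oplus> ring 8)"
proof -
  have "chain [Arc Emp (Arc Emp (Arc Emp (Arc Emp (Arc Emp (Arc Emp (Arc Emp HH)))))),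
      over (Arc (Arc HH II) VV),
      Arc (Arc Emp (Arc VV (over VV))) VV,
      Arc Emp (Arc Emp (Arc lf (Arc HH II))),
      Arc lf (Arc Emp (Arc Emp (Arc Emp (Arc Emp (Arc Emp HH)))))]"
    by (simp add: nb_def)
  from walk_chain[OF this] show ?thesis by simp
qed

lemma walk_II_II_10: "walk True (ring 10) (II \<oplus> II \<oplus> ring 6)"
proof -
  have "chain [Arc Emp (Arc Emp (Arc Emp (Arc Emp (Arc Emp (Arc Emp (Arc Emp HH)))))),
      Arc (over (Arc lf (over VV))) (over VV),
      over (Arc VV (Arc lf (Arc Emp (Arc Emp II)))),
      Arc Emp (Arc lf (over (Arc Emp (Arc Emp (Arc lf VV))))),
      over (Arc VV (over (Arc Emp (Arc VV lf)))),
      Arc HH (Arc (Arc Emp (Arc lf lf)) lf),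
      Arc Emp (Arc Emp (Arc Emp (Arc Emp (over (Arc (over VV) lf))))),
      Arc lf (Arc lf (Arc Emp (Arc Emp (Arc Emp HH))))]"
    by (simp add: nb_def)
  from walk_chain[OF this] show ?thesis by simp
qed

text \<open>Makes the class of \<open>II \<oplus> ring 5\<close> closed under rotation, as the
  rotation invariance of \<open>big\<close> at size 7 requires.\<close>

lemma walk_rot_leg_7: "walk True (II \<oplus> ring 5) (rot (II \<oplus> ring 5))"
proof -
  have "chain [Arc lf (Arc Emp (Arc Emp HH)),
      Arc Emp (Arc Emp (Arc lf (over VV))),
      over (Arc Emp (Arc VV II)),
      Arc Emp (over (Arc Emp (Arc Emp HH)))]"
    by (simp add: nb_def)
  from walk_chain[OF this] show ?thesis by simp
qed

lemma walk_rot_leg_8: "walk True (II \<oplus> ring 6) (rot (II \<oplus> ring 6))"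
proof -
  have "chain [Arc lf (Arc Emp (Arc Emp (Arc Emp HH))),
      Arc Emp (Arc Emp (Arc lf (over HH))),
      over (Arc Emp (Arc VV (over VV))),
      Arc Emp (over (Arc Emp (Arc Emp (Arc Emp HH))))]"
    by (simp add: nb_def)
  from walk_chain[OF this] show ?thesis by simp
qed

lemma strong_ring_of_odd_walk: "walk True (ring n) (ring n) \<Longrightarrow> strong (ring n)"
  unfolding strong_def sz_ring using walk_refl by (metis (full_types))

lemma base_9: "base 9"
  using strong_ring_of_odd_walk[OF walk_ring_9] strong_walk[OF _ walk_leg_9] by (simp add: base_def)

lemma base_10: "base 10"
  using strong_ring_of_odd_walk[OF walk_ring_10] strong_walk[OF _ walk_leg_10] by (simp add: base_def)

lemma base_ge_9: "9 \<le> n \<Longrightarrow> base n"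
proof (induction n rule: less_induct)
  case (less n)
  consider "n = 9" | "n = 10" | "11 \<le> n" using less.prems by linarith
  then show ?case
  proof cases
    case 3
    then have "base (n - 2 + 2)" by (intro base_step less.IH) auto
    moreover have "n - 2 + 2 = n" using 3 by simp
    ultimately show ?thesis by metis
  qed (simp_all add: base_9 base_10)
qed

lemma strong_ring: "9 \<le> n \<Longrightarrow> strong (ring n)"
  using base_ge_9 by (simp add: base_def)

lemma strong_pair_cat:
  assumes "strong u" "9 \<le> sz u"
  shows "strong (pair c \<oplus> u)"
  using strong_pair_cat_aux[OF base_ge_9[OF assms(2)] strong_ring assms(1)] assms(2) by simp

text \<open>At sizes 7 and 8 the words that are not of a special form still split into two components, those of
  \<open>()()\<dots>()\<close> and of \<open>(())()\<dots>()\<close>.\<close>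

definition big :: "arcs \<Rightarrow> bool" where
  "big u \<longleftrightarrow> 5 \<le> sz u \<and>
    (if sz u \<le> 6 then conn (ring (sz u)) u
     else if sz u \<le> 8 then conn (ring (sz u)) u \<or> conn (II \<oplus> ring (sz u - 2)) u
     else strong u)"

lemma big_conn: "big u \<Longrightarrow> conn u v \<Longrightarrow> big v"
  unfolding big_def using conn_sz[of u v] conn_trans strong_walk by (auto simp: conn_def[of u v] split: if_splits) (metis conn_def conn_trans)+

lemma big_rot:
  assumes "big u"
  shows "big (rot u)"
proof -
  obtain n where n: "sz u = Suc (Suc n)" using assms by (metis big_def add_2_eq_Suc le_Suc_ex numeral_le_iff order_trans semiring_norm(68) semiring_norm(72))
  have 1: "conn (ring (sz u)) u \<Longrightarrow> conn (ring (sz u)) (rot u)"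
    using conn_rot_of conn_nb[OF nb_ring[of n]] n by metis
  have "conn (II \<oplus> ring 5) (rot (II \<oplus> ring 5))" "conn (II \<oplus> ring 6) (rot (II \<oplus> ring 6))"
    using walk_rot_leg_7 walk_rot_leg_8 unfolding conn_def by blast+
  moreover have "sz u - 2 = 5 \<or> sz u - 2 = 6" if "6 < sz u" "sz u \<le> 8" using that by linarith
  ultimately have 2: "6 < sz u \<Longrightarrow> sz u \<le> 8 \<Longrightarrow> conn (II \<oplus> ring (sz u - 2)) u \<Longrightarrow> conn (II \<oplus> ring (sz u - 2)) (rot u)"
    using conn_rot_of by metis
  show ?thesis using assms 1 2 strong_rot[of u] unfolding big_def by auto
qed

lemma big_rot_pow_iff [simp]: "big ((rot ^^ n) u) \<longleftrightarrow> big u"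
proof -
  have r: "big u \<Longrightarrow> big ((rot ^^ m) u)" for u m by (induction m) (auto intro: big_rot)
  then show ?thesis using rot_pow_inverse[of n u] by metis
qed

lemma big_pair_cat:
  assumes "big u"
  shows "big (pair c \<oplus> u)"
proof -
  consider "sz u = 5 \<or> sz u = 6" | "sz u = 7 \<or> sz u = 8" | "9 \<le> sz u"
    using assms by (force simp: big_def)
  then show ?thesis
  proof cases
    case 1
    then obtain b where "walk b (ring (sz u)) u" using assms by (auto simp: big_def conn_def split: if_splits)
    then have "conn (pair (c \<noteq> b) \<oplus> ring (sz u)) (pair c \<oplus> u)"
      using walk_pair[of b "ring (sz u)" u "c \<noteq> b"] unfolding conn_def by (cases b; cases c) auto
    moreover have "pair (c \<noteq> b) \<oplus> ring (sz u) = ring (2 + sz u) \<or> pair (c \<noteq> b) \<oplus> ring (sz u) = II \<oplus> ring (sz u)"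
      by (simp add: pair_def)
    ultimately show ?thesis using 1 unfolding big_def by auto
  next
    case 2
    have st: "strong (pair d \<oplus> ring (sz u))" for d
      using 2 base_9 base_10 by (auto simp: base_def pair_def eval_nat_numeral)
    have II: "strong (II \<oplus> II \<oplus> ring (sz u - 2))"
      using 2 strong_walk[OF _ walk_II_II_9] strong_walk[OF _ walk_II_II_10] strong_ring[of 9] strong_ring[of 10] by auto
    \<comment> \<open>Rotating by four points moves \<open>VV\<close> to the end, where it merges
      with the ring.\<close>
    have "(rot ^^ 4) (VV \<oplus> II \<oplus> ring (sz u - 2)) = II \<oplus> ring (sz u)"
      using rot_pow_cat[of VV "II \<oplus> ring (sz u - 2)"] ring_add[of "sz u - 2" 2] 2 by (auto simp: eval_nat_numeral)
    then have VI: "strong (VV \<oplus> II \<oplus> ring (sz u - 2))"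
      using st[of True] strong_rot_pow_iff[of "VV \<oplus> II \<oplus> ring (sz u - 2)" 4] by (simp add: pair_def)
    obtain b v where v: "walk b v u" "v = ring (sz u) \<or> v = II \<oplus> ring (sz u - 2)"
      using 2 assms by (auto simp: big_def conn_def split: if_splits)
    have "strong (pair d \<oplus> (II \<oplus> ring (sz u - 2)))" for d
      using II VI by (cases d) (simp_all add: pair_def)
    then have "strong (pair (c \<noteq> b) \<oplus> v)" using v(2) st by metis
    then have "strong (pair c \<oplus> u)" using strong_walk[OF _ walk_pair[OF v(1), of "c \<noteq> b"]] by (cases b; cases c) auto
    then show ?thesis using 2 by (auto simp: big_def)
  next
    case 3
    then show ?thesis using assms strong_pair_cat[of u c] by (auto simp: big_def)
  qed
qed

lemma big_ins: "big u \<Longrightarrow> p \<le> 2 * sz u \<Longrightarrow> big (ins p (pair c) u)"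
  using big_rot_pow_iff[of p "ins p (pair c) u"] big_pair_cat[of "(rot ^^ p) u" c] by (simp add: rot_pow_ins)

lemma big_ring: "big (ring 5)" "big (ring 6)" "big (ring 7)" "big (ring 8)" "big (ring 9)"
  using strong_ring[of 9] by (simp_all add: big_def del: ring_numeral)

lemma big_leg: "big (II \<oplus> ring 5)" "big (II \<oplus> ring 6)"
  by (simp_all add: big_def)

lemma big_rot_powI: "big u \<Longrightarrow> big ((rot ^^ n) u)"
  by simp

lemma big_chain: "big u \<Longrightarrow> chain (u # us) \<Longrightarrow> big (last (u # us))"
  using walk_chain big_conn unfolding conn_def by blast

text \<open>The smallest members of the families of words that \<open>big_exts\<close> extends in the two classifications.\<close>

lemma big_base_1: "big (Arc Emp (Arc Emp (over (Arc VV (over VV)))))"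
proof -
  have "big (over (Arc Emp (Arc Emp (Arc Emp (Arc Emp (Arc Emp HH))))))"
    using big_rot_powI[OF big_ring(5), of 1] by (simp add: eval_nat_numeral)
  then show ?thesis using big_chain[of "(over (Arc Emp (Arc Emp (Arc Emp (Arc Emp (Arc Emp HH))))))"
    "[Arc Emp (Arc Emp (over (Arc VV (over VV))))]"]
    by (simp add: nb_def)
qed

lemma big_base_2: "big (Arc lf (Arc VV VV))"
proof -
  have "big (Arc Emp (Arc Emp (Arc Emp (Arc Emp (Arc Emp II)))))"
    using big_rot_powI[OF big_leg(1), of 4] by (simp add: eval_nat_numeral)
  then show ?thesis using big_chain[of "(Arc Emp (Arc Emp (Arc Emp (Arc Emp (Arc Emp II)))))"
    "[Arc lf (Arc VV VV)]"]
    by (simp add: nb_def)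
qed

lemma big_base_3: "big (Arc lf (Arc Emp (Arc Emp (over VV))))"
proof -
  have "big (Arc Emp (Arc Emp (Arc lf HH)))"
    using big_rot_powI[OF big_leg(1), of 10] by (simp add: eval_nat_numeral)
  then show ?thesis using big_chain[of "(Arc Emp (Arc Emp (Arc lf HH)))"
    "[Arc lf (Arc Emp (Arc Emp (over VV)))]"]
    by (simp add: nb_def)
qed

lemma big_base_4: "big (Arc lf (over VV))"
proof -
  have "big (Arc Emp (Arc Emp HH))" using big_ring(1) by simp
  then show ?thesis using big_chain[of "(Arc Emp (Arc Emp HH))"
    "[Arc lf (over VV)]"]
    by (simp add: nb_def)
qed

lemma big_base_5: "big (Arc Emp (Arc Emp (over (over VV))))"
proof -
  have "big (over (Arc Emp (Arc Emp HH)))"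
    using big_rot_powI[OF big_ring(2), of 1] by (simp add: eval_nat_numeral)
  then show ?thesis using big_chain[of "(over (Arc Emp (Arc Emp HH)))"
    "[Arc Emp (Arc Emp (over (over VV)))]"]
    by (simp add: nb_def)
qed

lemma big_base_6: "big (Arc Emp (Arc Emp (over (Arc Emp (Arc Emp (over VV))))))"
proof -
  have "big (over (Arc Emp (Arc Emp (Arc lf HH))))"
    using big_rot_powI[OF big_leg(2), of 11] by (simp add: eval_nat_numeral)
  then show ?thesis using big_chain[of "(over (Arc Emp (Arc Emp (Arc lf HH))))"
    "[Arc Emp (Arc Emp (over (Arc Emp (Arc Emp (over VV)))))]"]
    by (simp add: nb_def)
qed

lemma big_base_7: "big (Arc Emp (Arc Emp (over (Arc VV VV))))"
proof -
  have "big (Arc Emp (Arc Emp (over (Arc VV VV))))"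
    using big_rot_powI[OF big_base_6, of 10] by (simp add: eval_nat_numeral)
  then show ?thesis .
qed

lemma big_base_8: "big (Arc lf (over HH))"
proof -
  have "big (Arc Emp (Arc Emp (Arc Emp HH)))" using big_ring(2) by simp
  then show ?thesis using big_chain[of "(Arc Emp (Arc Emp (Arc Emp HH)))"
    "[Arc lf (over HH)]"]
    by (simp add: nb_def)
qed

lemma big_base_9: "big (Arc lf (Arc Emp (Arc Emp (Arc Emp (Arc lf lf)))))"
proof -
  have "big (Arc Emp (Arc Emp (over (Arc Emp (Arc Emp (over VV))))))" using big_base_6 by simp
  then show ?thesis using big_chain[of "(Arc Emp (Arc Emp (over (Arc Emp (Arc Emp (over VV))))))"
    "[Arc lf (Arc Emp (Arc Emp (Arc Emp (Arc lf lf))))]"]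
    by (simp add: nb_def)
qed

lemma big_base_10: "big (Arc lf (Arc Emp (Arc VV lf)))"
proof -
  have "big (over (Arc Emp (Arc Emp (Arc Emp HH))))"
    using big_rot_powI[OF big_ring(3), of 1] by (simp add: eval_nat_numeral)
  then show ?thesis using big_chain[of "(over (Arc Emp (Arc Emp (Arc Emp HH))))"
    "[Arc Emp (Arc Emp (over (over HH))),
      Arc lf (Arc Emp (Arc VV lf))]"]
    by (simp add: nb_def)
qed

lemma big_base_11: "big (Arc Emp (Arc Emp (Arc Emp (Arc VV II))))"
proof -
  have "big (over (Arc lf (Arc Emp (Arc Emp HH))))"
    using big_rot_powI[OF big_leg(2), of 15] by (simp add: eval_nat_numeral)
  then show ?thesis using big_chain[of "(over (Arc lf (Arc Emp (Arc Emp HH))))"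
    "[Arc VV (Arc Emp (Arc Emp HH)),
      Arc Emp (Arc Emp (Arc Emp (Arc VV II)))]"]
    by (simp add: nb_def)
qed

lemma big_base_12: "big (Arc Emp (Arc Emp (Arc VV (Arc lf lf))))"
proof -
  have "big (Arc Emp (Arc Emp (Arc VV (Arc lf lf))))"
    using big_rot_powI[OF big_base_11, of 2] by (simp add: eval_nat_numeral)
  then show ?thesis .
qed

lemma big_base_13: "big (Arc Emp (Arc Emp (over (Arc lf HH))))"
proof -
  have "big (Arc Emp (Arc Emp (over (Arc lf HH))))"
    using big_rot_powI[OF big_base_12, of 5] by (simp add: eval_nat_numeral)
  then show ?thesis .
qed

lemma big_base_14: "big (Arc Emp (Arc Emp (Arc Emp (Arc lf (over VV)))))"
proof -
  have "big (over (Arc Emp (Arc Emp (Arc VV II))))"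
    using big_rot_powI[OF big_base_11, of 1] by (simp add: eval_nat_numeral)
  then show ?thesis using big_chain[of "(over (Arc Emp (Arc Emp (Arc VV II))))"
    "[Arc Emp (Arc Emp (Arc Emp (Arc lf (over VV))))]"]
    by (simp add: nb_def)
qed

lemma big_base_15: "big (Arc Emp (Arc Emp (Arc lf (Arc VV lf))))"
proof -
  have "big (Arc Emp (Arc Emp (Arc lf (Arc VV lf))))"
    using big_rot_powI[OF big_base_14, of 2] by (simp add: eval_nat_numeral)
  then show ?thesis .
qed

lemma big_base_16: "big (Arc lf (Arc VV HH))"
proof -
  have "big (Arc lf (Arc VV HH))"
    using big_rot_powI[OF big_base_15, of 4] by (simp add: eval_nat_numeral)
  then show ?thesis .
qed

lemma big_base_17: "big (Arc lf (Arc Emp (Arc Emp (Arc lf VV))))"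
proof -
  have "big (over (Arc Emp (Arc Emp (Arc Emp (Arc Emp HH)))))"
    using big_rot_powI[OF big_ring(4), of 1] by (simp add: eval_nat_numeral)
  then show ?thesis using big_chain[of "(over (Arc Emp (Arc Emp (Arc Emp (Arc Emp HH)))))"
    "[Arc Emp (Arc Emp (over (over (over (over VV))))),
      Arc lf (Arc Emp (Arc Emp (Arc lf VV)))]"]
    by (simp add: nb_def)
qed

section \<open>Existence of a neighbour\<close>

definition has_nb :: "arcs \<Rightarrow> bool" where
  "has_nb u \<longleftrightarrow> (\<exists>w. nb u w)"

lemma has_nb_iff: "has_nb u \<longleftrightarrow> nbs u \<noteq> {}"
  by (auto simp: has_nb_def)

lemma has_nb_rot_pow [simp]: "has_nb ((rot ^^ n) u) \<longleftrightarrow> has_nb u"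
  by (simp add: has_nb_iff nbs_rot_pow)

lemma has_nb_cat: "has_nb u \<Longrightarrow> has_nb v \<Longrightarrow> has_nb (u \<oplus> v)"
  unfolding has_nb_def using nb_cat_iff nb_sz by metis

lemma has_nb_cat_commute: "has_nb (u \<oplus> v) \<longleftrightarrow> has_nb (v \<oplus> u)"
  using has_nb_rot_pow[of "2 * sz u" "u \<oplus> v"] by simp

lemma has_nb_over: "has_nb (over u) \<longleftrightarrow> has_nb (lf \<oplus> u)"
  using has_nb_rot_pow[of 1 "lf \<oplus> u"] by simp

lemma has_nb_Arc_insert: "has_nb d \<Longrightarrow> has_nb (lf \<oplus> u) \<Longrightarrow> has_nb (over d \<oplus> u)"
proof -
  assume "has_nb d" "has_nb (lf \<oplus> u)"
  then obtain f w where f: "nb d f" and w: "nb (Arc Emp u) w" by (auto simp: has_nb_def)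
  obtain a b where "w = Arc a b" using nb_sz[OF w] by (cases w) auto
  then have "nb (Arc d u) (Arc (f \<oplus> a) b)" using f w nb_Arc_iff[of d u] by blast
  then show ?thesis by (auto simp: has_nb_def)
qed

text \<open>Since \<open>over d\<close> is a rotation of \<open>lf \<oplus> d\<close>, the
  hypotheses say that \<open>d\<close> or \<open>over d\<close>, and \<open>u\<close> or
  \<open>lf \<oplus> u\<close>, has a neighbour. Each of the four combinations serves
  \<open>Arc d u\<close> with or without the extra short edge.\<close>

lemma has_nb_or_lf: "has_nb u \<or> has_nb (lf \<oplus> u)"
proof (induction u)
  case Emp then show ?case using nb_Emp by (auto simp: has_nb_def)
next
  case (Arc d u)
  have 1: "has_nb (over d) \<Longrightarrow> has_nb u \<Longrightarrow> has_nb (Arc d u)"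
    using has_nb_cat[of "over d" u] by simp
  have 2: "has_nb (over d) \<Longrightarrow> has_nb (lf \<oplus> u) \<Longrightarrow> has_nb (lf \<oplus> Arc d u)"
    using has_nb_cat[of "over d" "u \<oplus> lf"] has_nb_cat_commute[of lf u] has_nb_cat_commute[of lf "Arc d u"] by simp
  have 3: "has_nb d \<Longrightarrow> has_nb (lf \<oplus> u) \<Longrightarrow> has_nb (Arc d u)"
    using has_nb_Arc_insert[of d u] by simp
  have 4: "has_nb d \<Longrightarrow> has_nb u \<Longrightarrow> has_nb (lf \<oplus> Arc d u)"
    using has_nb_cat[of "lf \<oplus> over d" u] nbs_lf_over[of d] by (simp add: has_nb_iff)
  show ?case using Arc.IH 1 2 3 4 has_nb_over by blast
qed

text \<open>Two adjacent short edges always suffice for a neighbour. The length of the ring is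
  generalised because an outer arc whose interior has a neighbour is traded for one more short
  edge.\<close>

lemma has_nb_ring_cat: "has_nb (ring (Suc (Suc m)) \<oplus> u)"
proof (induction u arbitrary: m)
  case Emp then show ?case using nb_ring[of m] by (auto simp: has_nb_def)
next
  case (Arc d u)
  let ?r = "ring (Suc (Suc m))"
  have "has_nb (over d) \<or> has_nb d" using has_nb_or_lf has_nb_over by blast
  then show ?case
  proof
    assume "has_nb (over d)"
    then have "has_nb (over d \<oplus> u \<oplus> ?r)" using has_nb_cat Arc.IH(2) has_nb_cat_commute by blast
    then show ?thesis using has_nb_cat_commute[of ?r "Arc d u"] by simp
  next
    assume d: "has_nb d"
    have "has_nb (ring (Suc (Suc (Suc m))) \<oplus> u)" by (rule Arc.IH(2))
    moreover have "ring 1 = lf" by simp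
    ultimately have "has_nb ((?r \<oplus> lf) \<oplus> u)"
      using ring_add[of "Suc (Suc m)" 1] by (metis Suc_eq_plus1)
    then have "has_nb (lf \<oplus> (u \<oplus> ?r))"
      using has_nb_cat_commute[of "?r \<oplus> lf" u] has_nb_cat_commute[of "u \<oplus> ?r" lf] cat_assoc by metis
    then have "has_nb (over d \<oplus> u \<oplus> ?r)" by (rule has_nb_Arc_insert[OF d])
    then show ?thesis using has_nb_cat_commute[of ?r "Arc d u"] by simp
  qed
qed

lemma has_nb_VV_cat: "has_nb (VV \<oplus> u)"
  using has_nb_ring_cat[of 0 u] by simp

section \<open>Removing pairs\<close>

definition ext :: "arcs \<Rightarrow> arcs \<Rightarrow> bool" where
  "ext u w \<longleftrightarrow> (\<exists>p c. p \<le> 2 * sz u \<and> w = ins p (pair c) u)"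

lemma ext_Arc_left: "ext u w \<Longrightarrow> ext (Arc u v) (Arc w v)"
proof -
  assume "ext u w"
  then obtain p c where "p \<le> 2 * sz u" "w = ins p (pair c) u" by (auto simp: ext_def)
  then have "Suc p \<le> 2 * sz (Arc u v) \<and> Arc w v = ins (Suc p) (pair c) (Arc u v)" by simp
  then show ?thesis unfolding ext_def by blast
qed

lemma ext_cat_right: "ext u w \<Longrightarrow> ext (v \<oplus> u) (v \<oplus> w)"
proof -
  assume "ext u w"
  then obtain p c where "p \<le> 2 * sz u" "w = ins p (pair c) u" by (auto simp: ext_def)
  then have "p + 2 * sz v \<le> 2 * sz (v \<oplus> u) \<and> v \<oplus> w = ins (p + 2 * sz v) (pair c) (v \<oplus> u)"
    by (simp add: ins_cat_right)
  then show ?thesis unfolding ext_def by blast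
qed

lemma ext_cat_left: "ext u w \<Longrightarrow> ext (u \<oplus> v) (w \<oplus> v)"
proof -
  assume "ext u w"
  then obtain p c where "p \<le> 2 * sz u" "w = ins p (pair c) u" by (auto simp: ext_def)
  then have "p \<le> 2 * sz (u \<oplus> v) \<and> w \<oplus> v = ins p (pair c) (u \<oplus> v)"
    by (simp add: ins_cat_left)
  then show ?thesis unfolding ext_def by blast
qed

lemma ext_Arc_right: "ext u w \<Longrightarrow> ext (Arc v u) (Arc v w)"
  using ext_cat_right[of u w "over v"] by simp

lemma ext_lr: "ext u w \<Longrightarrow> ext (lr x v u) (lr x v w)"
  by (cases x) (auto intro: ext_cat_right ext_cat_left)

lemma ext_Emp_pair: "ext Emp VV" "ext Emp II"
  unfolding ext_def pair_def by (intro exI[of _ 0] exI[of _ False]; simp) (intro exI[of _ 0] exI[of _ True]; simp)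

lemma ex_ext: "2 \<le> sz w \<Longrightarrow> \<exists>u. ext u w"
proof (induction w)
  case (Arc u v)
  consider "2 \<le> sz u" | "2 \<le> sz v" | "sz u = 0" "sz v = Suc 0" | "sz u = Suc 0" "sz v = 0" | "sz u = Suc 0" "sz v = Suc 0"
  proof -
    have "2 \<le> sz u \<or> 2 \<le> sz v \<or> (sz u = 0 \<and> sz v = Suc 0) \<or> (sz u = Suc 0 \<and> sz v = 0) \<or> (sz u = Suc 0 \<and> sz v = Suc 0)"
      using Arc.prems by (simp only: sz.simps) presburger
    then show thesis using that by blast
  qed
  then show ?case
  proof cases
    case 1 then show ?thesis using Arc.IH(1) ext_Arc_left by blast
  next
    case 2 then show ?thesis using Arc.IH(2) ext_Arc_right by blast
  next
    case 3 then show ?thesis using ext_Emp_pair by (auto simp: sz_1)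
  next
    case 4 then show ?thesis using ext_Emp_pair by (auto simp: sz_1)
  next
    case 5 then show ?thesis using ext_cat_left[OF ext_Emp_pair(2), of lf] by (auto simp: sz_1)
  qed
qed simp

lemma ext_rot:
  assumes "ext u w"
  obtains p c where "(rot ^^ p) w = pair c \<oplus> (rot ^^ p) u"
  using assms rot_pow_ins unfolding ext_def by metis

definition exts :: "arcs \<Rightarrow> arcs \<Rightarrow> bool" where
  "exts = ext\<^sup>*\<^sup>*"

lemma exts_refl: "exts u u"
  by (simp add: exts_def)

lemma exts_trans: "exts u v \<Longrightarrow> exts v w \<Longrightarrow> exts u w"
  by (simp add: exts_def)

lemma exts_mono:
  assumes "\<And>u w. ext u w \<Longrightarrow> ext (f u) (f w)" "exts u w"
  shows "exts (f u) (f w)"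
  using assms(2) unfolding exts_def
  by (induction rule: rtranclp_induct) (auto intro: rtranclp.rtrancl_into_rtrancl assms(1))

lemma exts_Arc: "exts u u' \<Longrightarrow> exts v v' \<Longrightarrow> exts (Arc u v) (Arc u' v')"
  using exts_mono[of "\<lambda>u. Arc u v" u u'] exts_mono[of "Arc u'" v v'] ext_Arc_left ext_Arc_right exts_trans by blast

lemma exts_cat: "exts u u' \<Longrightarrow> exts v v' \<Longrightarrow> exts (u \<oplus> v) (u' \<oplus> v')"
  using exts_mono[of "\<lambda>u. u \<oplus> v" u u'] exts_mono[of "\<lambda>v. u' \<oplus> v" v v'] ext_cat_left ext_cat_right exts_trans by blast

text \<open>A link added at the inner end of a chain is an inserted pair. This reduces families of
  words with arbitrary chains to their smallest members.\<close>

lemma ext_UU_snoc: "ext (UU a) (UU (a @ [x]))"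
proof (induction a)
  case Nil then show ?case using ext_Emp_pair by (cases x) auto
next
  case (Cons y a) then show ?case by (auto intro: ext_lr ext_Arc_left)
qed

lemma ext_SS_snoc: "ext (SS a) (SS (a @ [x]))"
proof (induction a)
  case Nil then show ?case using ext_Emp_pair by (cases x) auto
next
  case (Cons y a) then show ?case by (auto intro: ext_lr ext_Arc_left)
qed

lemma exts_UU_append: "exts (UU a) (UU (a @ b))"
proof (induction b rule: rev_induct)
  case (snoc x b)
  then show ?case using ext_UU_snoc[of "a @ b" x] unfolding exts_def by (simp add: rtranclp.rtrancl_into_rtrancl)
qed (simp add: exts_refl)

lemma exts_SS_append: "exts (SS a) (SS (a @ b))"
proof (induction b rule: rev_induct)
  case (snoc x b)
  then show ?case using ext_SS_snoc[of "a @ b" x] unfolding exts_def by (simp add: rtranclp.rtrancl_into_rtrancl)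
qed (simp add: exts_refl)

lemma exts_UU: "exts Emp (UU a)" "a \<noteq> [] \<Longrightarrow> exts VV (UU a)"
proof -
  show "exts Emp (UU a)" using exts_UU_append[of "[]" a] by simp
  show "exts VV (UU a)" if a: "a \<noteq> []"
  proof -
    obtain x b where "a = [x] @ b" using a by (cases a) auto
    moreover have "UU [x] = VV" by (cases x) auto
    ultimately show ?thesis using exts_UU_append[of "[x]" b] by metis
  qed
qed

lemma exts_SS: "exts Emp (SS a)" "a \<noteq> [] \<Longrightarrow> exts II (SS a)"
proof -
  show "exts Emp (SS a)" using exts_SS_append[of "[]" a] by simp
  show "exts II (SS a)" if a: "a \<noteq> []"
  proof -
    obtain x b where "a = [x] @ b" using a by (cases a) auto
    moreover have "SS [x] = II" by (cases x) auto
    ultimately show ?thesis using exts_SS_append[of "[x]" b] by metis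
  qed
qed

lemma big_exts: "big u \<Longrightarrow> exts u w \<Longrightarrow> big w"
proof -
  assume "exts u w" "big u"
  then show "big w" unfolding exts_def
    by (induction rule: rtranclp_induct) (auto simp: ext_def big_ins)
qed

lemmas exts_intros = exts_refl exts_UU exts_SS exts_cat exts_Arc

section \<open>Odd sizes\<close>

definition hub :: "arcs \<Rightarrow> bool" where
  "hub w \<longleftrightarrow> (\<exists>n a. w = (rot ^^ n) (TT a))"

definition star :: "arcs \<Rightarrow> bool" where
  "star w \<longleftrightarrow> hub w \<or> (\<exists>c. hub c \<and> nb c w)"

text \<open>What a hub can look like when it is cut open at an arbitrary gap: two odd chains and one
  short edge, in any position of the short edge, or with an arc around both chains in its
  place.\<close>

definition hub_form :: "arcs \<Rightarrow> bool" where
  "hub_form w \<longleftrightarrow> (\<exists>a b. w = TT a \<oplus> lf \<oplus> TT b \<or> w = lf \<oplus> TT a \<oplus> TT b \<or> w = TT a \<oplus> TT b \<oplus> lf \<or>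
    w = over (TT a \<oplus> TT b))"

lemma hub_rot_pow: "hub ((rot ^^ n) w) \<longleftrightarrow> hub w"
proof -
  have 1: "hub w \<Longrightarrow> hub ((rot ^^ n) w)" for n w
    unfolding hub_def by (metis comp_apply funpow_add)
  then show ?thesis using rot_pow_inverse[of n w] by metis
qed

lemma star_rot_pow: "star ((rot ^^ n) w) \<longleftrightarrow> star w"
proof -
  have 1: "star w \<Longrightarrow> star ((rot ^^ n) w)" for n w
    unfolding star_def using hub_rot_pow nb_rot_pow by blast
  then show ?thesis using rot_pow_inverse[of n w] by metis
qed

lemma nbs_of_nb_hub: "hub c \<Longrightarrow> nb c z \<Longrightarrow> nbs z = {c}"
proof -
  assume "hub c" and z: "nb c z"
  then obtain n a where c: "c = (rot ^^ n) (TT a)" by (auto simp: hub_def)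
  have "z \<in> (rot ^^ n) ` nbs (TT a)" using z unfolding c by (simp flip: nbs_rot_pow)
  then obtain y where y: "nb (TT a) y" "z = (rot ^^ n) y" by auto
  then show ?thesis using nbs_of_nb_TT[OF y(1)] c by (simp add: nbs_rot_pow)
qed

lemma star_nb: "star w \<Longrightarrow> nb w v \<Longrightarrow> star v"
  unfolding star_def using nbs_of_nb_hub by (metis mem_nbs singletonD)

lemma star_conn: "star w \<Longrightarrow> conn w v \<Longrightarrow> star v"
proof -
  assume "conn w v" "star w"
  then show "star v" unfolding conn_rtranclp
    by (induction rule: rtranclp_induct) (auto intro: star_nb)
qed

text \<open>When the gap passes an edge of the first chain, that chain loses a link and the second
  one gains it.\<close>

lemma hub_form_rot: "hub_form w \<Longrightarrow> hub_form (rot w)"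
proof -
  assume "hub_form w"
  then consider a b where "w = TT a \<oplus> lf \<oplus> TT b" | a b where "w = lf \<oplus> TT a \<oplus> TT b"
    | a b where "w = TT a \<oplus> TT b \<oplus> lf" | a b where "w = over (TT a \<oplus> TT b)"
    by (auto simp: hub_form_def)
  then show ?thesis
  proof cases
    case (1 a b)
    have "rot w = UU a \<oplus> TT (True # b)" by (simp add: 1)
    then have "(\<exists>c. rot w = TT c \<oplus> lf \<oplus> TT (True # b)) \<or> (\<exists>c. rot w = lf \<oplus> TT c \<oplus> TT (True # b)) \<or> rot w = over (TT [] \<oplus> TT b)"
      by (cases a) (auto simp: lr_def)
    then show ?thesis unfolding hub_form_def by blast
  next
    case (2 a b)
    then have "rot w = over (TT a \<oplus> TT b)" by simp
    then show ?thesis unfolding hub_form_def by blast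
  next
    case (3 a b)
    have "rot w = UU a \<oplus> TT (False # b)" by (simp add: 3)
    then have "(\<exists>c. rot w = TT c \<oplus> lf \<oplus> TT (False # b)) \<or> (\<exists>c. rot w = lf \<oplus> TT c \<oplus> TT (False # b)) \<or> rot w = over (TT b \<oplus> TT [])"
      by (cases a) (auto simp: lr_def)
    then show ?thesis unfolding hub_form_def by blast
  next
    case (4 a b)
    then have "rot w = TT a \<oplus> TT b \<oplus> lf" by simp
    then show ?thesis unfolding hub_form_def by blast
  qed
qed

lemma hub_form_of_hub: "hub w \<Longrightarrow> 2 \<le> sz w \<Longrightarrow> hub_form w"
proof -
  assume "hub w" and sz: "2 \<le> sz w"
  then obtain n a where w: "w = (rot ^^ n) (TT a)" by (auto simp: hub_def)
  have "a \<noteq> []" using sz w by auto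
  then obtain x b where "a = x # b" by (cases a) auto
  then have "TT a = over (TT [] \<oplus> TT b) \<or> TT a = over (TT b \<oplus> TT [])" by (cases x) auto
  then have "hub_form (TT a)" unfolding hub_form_def by blast
  then have "hub_form ((rot ^^ m) (TT a))" for m by (induction m) (auto intro: hub_form_rot)
  then show ?thesis using w by simp
qed

lemma hub_VV_TT: "hub (VV \<oplus> TT a)"
proof -
  have "rot (VV \<oplus> TT a) = TT (True # a)" by simp
  then have "hub ((rot ^^ 1) (VV \<oplus> TT a))" unfolding hub_def by (metis comp_apply funpow_0 funpow_simps_right(2) One_nat_def)
  then show ?thesis by (simp only: hub_rot_pow)
qed

text \<open>In the first three shapes the whole arises from \<open>ring 5\<close> by inserting
  pairs. Under an outer arc the chain becomes longer if one of the two parts is a single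
  edge.\<close>

lemma VV_hub_form: "hub_form w \<Longrightarrow> hub (VV \<oplus> w) \<or> big (VV \<oplus> w)"
proof -
  assume "hub_form w"
  then consider a b where "w = TT a \<oplus> lf \<oplus> TT b" | a b where "w = lf \<oplus> TT a \<oplus> TT b"
    | a b where "w = TT a \<oplus> TT b \<oplus> lf" | a b where "w = over (TT a \<oplus> TT b)"
    by (auto simp: hub_form_def)
  then show ?thesis
  proof cases
    case (1 a b)
    have "big (VV \<oplus> w)" unfolding 1
      by (rule big_exts[of "VV \<oplus> lf \<oplus> lf \<oplus> lf"]) (use big_ring(1) in simp, intro exts_intros)
    then show ?thesis ..
  next
    case (2 a b)
    have "big (VV \<oplus> w)" unfolding 2
      by (rule big_exts[of "VV \<oplus> lf \<oplus> lf \<oplus> lf"]) (use big_ring(1) in simp, intro exts_intros)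
    then show ?thesis ..
  next
    case (3 a b)
    have "big (VV \<oplus> w)" unfolding 3
      by (rule big_exts[of "VV \<oplus> lf \<oplus> lf \<oplus> lf"]) (use big_ring(1) in simp, intro exts_intros)
    then show ?thesis ..
  next
    case (4 a b)
    consider "a = []" | "b = []" | "a \<noteq> []" "b \<noteq> []" by blast
    then show ?thesis
    proof cases
      case 1 then show ?thesis using hub_VV_TT[of "True # b"] by (simp add: 4)
    next
      case 2 then show ?thesis using hub_VV_TT[of "False # a"] by (simp add: 4)
    next
      case 3
      have "big (VV \<oplus> w)" unfolding 4
        by (rule big_exts[of "VV \<oplus> over (over VV \<oplus> over VV)"]) (use big_base_1 in simp, intro exts_intros 3)
      then show ?thesis ..
    qed
  qed
qed

lemma II_hub_form: "hub_form w \<Longrightarrow> 5 \<le> sz w \<Longrightarrow> big (II \<oplus> w)"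
proof -
  assume "hub_form w" and sz: "5 \<le> sz w"
  then consider a b where "w = TT a \<oplus> lf \<oplus> TT b" | a b where "w = lf \<oplus> TT a \<oplus> TT b"
    | a b where "w = TT a \<oplus> TT b \<oplus> lf" | a b where "w = over (TT a \<oplus> TT b)"
    by (auto simp: hub_form_def)
  then show ?thesis
  proof cases
    case (1 a b)
    then consider "a \<noteq> []" | "b \<noteq> []" using sz by fastforce
    then show ?thesis
    proof cases
      case a: 1
      show ?thesis unfolding 1
        by (rule big_exts[of "II \<oplus> over VV \<oplus> lf \<oplus> lf"]) (use big_base_2 in simp, intro exts_intros a)
    next
      case b: 2
      show ?thesis unfolding 1
        by (rule big_exts[of "II \<oplus> lf \<oplus> lf \<oplus> over VV"]) (use big_base_3 in simp, intro exts_intros b)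
    qed
  next
    case (2 a b)
    then consider "a \<noteq> []" | "b \<noteq> []" using sz by fastforce
    then show ?thesis
    proof cases
      case a: 1
      show ?thesis unfolding 2
        by (rule big_exts[of "II \<oplus> lf \<oplus> over VV \<oplus> lf"]) (use big_base_10 in simp, intro exts_intros a)
    next
      case b: 2
      show ?thesis unfolding 2
        by (rule big_exts[of "II \<oplus> lf \<oplus> lf \<oplus> over VV"]) (use big_base_3 in simp, intro exts_intros b)
    qed
  next
    case (3 a b)
    then consider "a \<noteq> []" | "b \<noteq> []" using sz by fastforce
    then show ?thesis
    proof cases
      case a: 1
      show ?thesis unfolding 3
        by (rule big_exts[of "II \<oplus> over VV \<oplus> lf \<oplus> lf"]) (use big_base_2 in simp, intro exts_intros a)
    next
      case b: 2
      show ?thesis unfolding 3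
        by (rule big_exts[of "II \<oplus> lf \<oplus> over VV \<oplus> lf"]) (use big_base_10 in simp, intro exts_intros b)
    qed
  next
    case (4 a b)
    show ?thesis unfolding 4
      by (rule big_exts[of "II \<oplus> over (lf \<oplus> lf)"]) (use big_base_4 in simp, intro exts_intros)
  qed
qed

lemma star_HH: "star HH" and star_over_VV: "star (over VV)"
proof -
  have "hub (over VV)" unfolding hub_def by (intro exI[of _ 0] exI[of _ "[True]"]) simp
  then show "star (over VV)" "star HH" unfolding star_def by auto
qed

text \<open>At size 3 the star is a single edge, so the hub \<open>HH\<close> is also a leaf, and
  \<open>II\<close> in front makes it a leaf of a longer hub. This is why \<open>II_hub_form\<close>
  starts at size 5.\<close>

lemma star_II_HH: "star (II \<oplus> HH)"
proof -
  have "hub (VV \<oplus> over VV)" using hub_VV_TT[of "[True]"] by simp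
  moreover have "nb (VV \<oplus> over VV) (II \<oplus> HH)" by (simp add: nb_def)
  ultimately show ?thesis unfolding star_def by blast
qed

text \<open>The pair \<open>(())\<close> is preferred because its flip is forced, so that the rest inherits a neighbour.\<close>

lemma odd_reduction:
  assumes "has_nb w" "5 \<le> sz w"
  obtains v m u where "conn w v" "(rot ^^ m) v = II \<oplus> u" "has_nb u"
proof -
  note result = that
  have w2: "2 \<le> sz w" using assms(2) by simp
  obtain u0 where "ext u0 w" using ex_ext[OF w2] by blast
  then obtain p c where pc: "(rot ^^ p) w = pair c \<oplus> (rot ^^ p) u0" by (rule ext_rot)
  define u where "u = (rot ^^ p) u0"
  have "sz (pair c \<oplus> u) = sz w" unfolding u_def pc[symmetric] by (rule sz_rot_pow)
  then have "2 \<le> sz u" using assms(2) by simp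
  have II: thesis if "(rot ^^ m) w = II \<oplus> v" for m v
  proof (rule result[OF conn_refl])
    have "has_nb (II \<oplus> v)" using that assms(1) has_nb_rot_pow by metis
    then show "has_nb v" using nbs_II_cat[of v] by (simp add: has_nb_iff)
  qed (rule \<open>(rot ^^ m) w = II \<oplus> v\<close>)
  show thesis
  proof (cases c)
    case True then show ?thesis using II pc by (simp add: pair_def)
  next
    case False
    then have w: "(rot ^^ p) w = VV \<oplus> u" using pc by (simp add: pair_def u_def)
    obtain u1 where u1: "ext u1 u" using ex_ext[OF \<open>2 \<le> sz u\<close>] by blast
    then obtain q d where q: "q \<le> 2 * sz u1" "u = ins q (pair d) u1" by (auto simp: ext_def)
    show ?thesis
    proof (cases d)
      case True
      \<comment> \<open>The four points of \<open>VV\<close> in front shift the gap by 4. Some pair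
        \<open>(())\<close> is thus present already, without taking a step.\<close>
      have "VV \<oplus> u = ins (q + 4) II (VV \<oplus> u1)" using q(2) True by (simp add: pair_def)
      then have "(rot ^^ (q + 4)) (VV \<oplus> u) = II \<oplus> (rot ^^ (q + 4)) (VV \<oplus> u1)"
        using rot_pow_ins[of "q + 4" "VV \<oplus> u1" II] q(1) by simp
      then show ?thesis using II[of "q + 4 + p"] w by (simp add: funpow_add)
    next
      case False
      \<comment> \<open>With \<open>()()\<close> inside it, the rest has a neighbour, so one step
        turns the removed \<open>VV\<close> into \<open>II\<close>.\<close>
      then have "(rot ^^ q) u = VV \<oplus> (rot ^^ q) u1" using rot_pow_ins[OF q(1), of VV] q(2) by (simp add: pair_def)
      then have "has_nb u" using has_nb_VV_cat has_nb_rot_pow by metis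
      then obtain u' where u': "nb u u'" by (auto simp: has_nb_def)
      then have "nb (VV \<oplus> u) (II \<oplus> u')" using nb_cat_iff[of VV II u u'] by simp
      obtain m where m: "(rot ^^ m) ((rot ^^ p) w) = w" using rot_pow_inverse by blast
      have "nb w ((rot ^^ m) (II \<oplus> u'))"
        using nb_rot_pow[of m "VV \<oplus> u" "II \<oplus> u'"] m w \<open>nb (VV \<oplus> u) (II \<oplus> u')\<close> by metis
      moreover obtain m' where "(rot ^^ m') ((rot ^^ m) (II \<oplus> u')) = II \<oplus> u'" using rot_pow_inverse by blast
      moreover have "has_nb u'" using u' nb_sym by (auto simp: has_nb_def)
      ultimately show ?thesis using result conn_nb by blast
    qed
  qed
qed

theorem odd_classification:
  assumes "odd (sz w)"
  shows "\<not> has_nb w \<or> star w \<or> big w"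
  using assms
proof (induction "sz w" arbitrary: w rule: less_induct)
  case less
  consider "\<not> has_nb w" | "sz w = 1" | "sz w = 3" "has_nb w" | "5 \<le> sz w" "has_nb w"
  proof -
    have "sz w = 1 \<or> sz w = 3 \<or> 5 \<le> sz w" using less.prems by presburger
    then show thesis using that by blast
  qed
  then show ?case
  proof cases
    case 1 then show ?thesis by simp
  next
    case 2 then show ?thesis using sz_1[of w] by (simp add: has_nb_def)
  next
    case 3
    then have "sz w = Suc (Suc (Suc 0))" by simp
    \<comment> \<open>Of the five words of size 3, two form the star; the others are rotations of
      the isolated word \<open>II \<oplus> lf\<close>.\<close>
    then have "w = HH \<or> w = over VV \<or> w = II \<oplus> lf \<or> (rot ^^ 4) w = II \<oplus> lf \<or> (rot ^^ 5) w = II \<oplus> lf"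
      unfolding sz_3 by (auto simp: eval_nat_numeral)
    moreover have "\<not> has_nb (II \<oplus> lf)" using nbs_II_cat[of lf] by (simp add: has_nb_iff nbs_lf)
    ultimately show ?thesis using star_HH star_over_VV 3(2) has_nb_rot_pow by metis
  next
    case 4
    obtain v m u where v: "conn w v" "(rot ^^ m) v = II \<oplus> u" "has_nb u" using odd_reduction[OF 4(2,1)] .
    have sz: "sz w = sz u + 2" using conn_sz[OF v(1)] arg_cong[OF v(2), of sz] by simp
    have "star (II \<oplus> u) \<or> big (II \<oplus> u)"
    proof -
      have "star u \<or> big u" using less.hyps[of u] less.prems sz v(3) by auto
      then consider "big u" | "hub u" | c where "hub c" "nb c u" by (auto simp: star_def)
      then show ?thesis
      proof cases
        case 1 then show ?thesis using big_pair_cat[of u True] by (simp add: pair_def)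
      next
        case 2
        have "hub_form u" using hub_form_of_hub[OF 2] sz 4(1) by simp
        have "sz u = Suc (Suc (Suc 0)) \<or> 5 \<le> sz u" using sz 4(1) less.prems by presburger
        then show ?thesis
        proof
          assume "5 \<le> sz u" then show ?thesis using II_hub_form[OF \<open>hub_form u\<close>] by blast
        next
          assume s: "sz u = Suc (Suc (Suc 0))"
          have "nbs (Arc Emp II) = {}" "nbs (over II) = {}" "nbs (Arc lf lf) = {}"
            using nbs_lf_over[of lf] nbs_over_over[of lf] nbs_II_cat[of lf] by (simp_all add: nbs_lf)
          then have "u = HH \<or> u = over VV" using s v(3) unfolding sz_3 has_nb_iff by auto
          then show ?thesis using star_II_HH big_base_4 by auto
        qed
      next
        case 3
        \<comment> \<open>For a leaf \<open>u\<close> one flips the pair and moves to the hub, so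
          only \<open>VV\<close> before a hub has to be examined.\<close>
        have nbc: "nb (VV \<oplus> c) (II \<oplus> u)" using 3 nb_cat_iff[of VV II c u] by simp
        have "2 \<le> sz c" using nb_sz[OF 3(2)] sz 4(1) by simp
        then have "hub (VV \<oplus> c) \<or> big (VV \<oplus> c)" using VV_hub_form hub_form_of_hub 3(1) by blast
        then show ?thesis using nbc conn_nb big_conn unfolding star_def by blast
      qed
    qed
    then have "star v \<or> big v" using v(2) star_rot_pow big_rot_pow_iff by metis
    then show ?thesis using star_conn big_conn v(1) conn_sym by blast
  qed
qed

section \<open>Even sizes\<close>

lemma nb_ins: "nb u u' \<Longrightarrow> nb d d' \<Longrightarrow> p \<le> 2 * sz u \<Longrightarrow> nb (ins p d u) (ins p d' u')"
  using nb_ins_iff nb_sz by metis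

text \<open>Reduces steps between words with chain parameters to small fixed words that can be
  evaluated: the chains are inserted as blocks that flip between \<open>SS\<close> and
  \<open>UU\<close>. The later gap \<open>q\<close> is filled first, so \<open>p\<close> keeps its
  position whenever \<open>p < q\<close>.\<close>

lemma nb_ins2:
  assumes "nb u u'" "nb d d'" "nb e e'" "p \<le> 2 * sz u" "q \<le> 2 * sz u"
  shows "nb (ins p e (ins q d u)) (ins p e' (ins q d' u'))"
  using assms by (intro nb_ins) auto

lemma nb_SS_UU: "nb (SS a) (UU a)" and nb_UU_SS: "nb (UU a) (SS a)"
  using nbs_SS[of a] nbs_UU[of a] by auto

lemma conn_rot_pow_iff [simp]: "conn ((rot ^^ n) u) ((rot ^^ n) v) \<longleftrightarrow> conn u v"
  unfolding conn_rtranclp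
proof
  show "nb\<^sup>*\<^sup>* u v" if "nb\<^sup>*\<^sup>* ((rot ^^ n) u) ((rot ^^ n) v)"
  proof -
    have c: "conn ((rot ^^ n) u) ((rot ^^ n) v)" using that by (simp add: conn_rtranclp)
    \<comment> \<open>One exponent must undo the rotation on both words, while
      \<open>rot_pow_inverse\<close> yields one for a single word. The sizes agree, so the periods
      do as well.\<close>
    define m where "m = n * (2 * sz u) - n"
    have p: "(rot ^^ (n * (2 * sz w))) w = w" for w
      by (induction n) (simp_all only: mult_Suc funpow_add comp_apply mult_0 funpow_0 rot_period)
    have "sz v = sz u" using conn_sz[OF c] by simp
    then have "(rot ^^ m) ((rot ^^ n) u) = u \<and> (rot ^^ m) ((rot ^^ n) v) = v"
    proof (cases "sz u = 0")
      case True
      have "(rot ^^ k) Emp = Emp" for k by (induction k) auto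
      then show ?thesis using True \<open>sz v = sz u\<close> by simp
    next
      case False
      then have "m + n = n * (2 * sz u)" by (cases "sz u") (simp_all add: m_def)
      then show ?thesis using p[of u] p[of v] \<open>sz v = sz u\<close> by (metis comp_apply funpow_add)
    qed
    then show ?thesis using conn_rot_pow[OF c, of m] by (simp add: conn_rtranclp)
  qed
qed (use conn_rot_pow conn_rtranclp in blast)

definition comb :: "arcs \<Rightarrow> bool" where
  "comb w \<longleftrightarrow> (\<exists>n a. a \<noteq> [] \<and> (w = (rot ^^ n) (UU a) \<or> w = (rot ^^ n) (SS a)))"

text \<open>\<open>TT a \<oplus> HH\<close> is a rotation of \<open>newest True a 1\<close>, so
  \<open>med_structure\<close> describes the component of every such word up to rotation.\<close>

definition med :: "arcs \<Rightarrow> bool" where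
  "med w \<longleftrightarrow> (\<exists>n a. conn ((rot ^^ n) (TT a \<oplus> HH)) w)"

lemma comb_rot_pow [simp]: "comb ((rot ^^ n) w) \<longleftrightarrow> comb w"
proof -
  have 1: "comb w \<Longrightarrow> comb ((rot ^^ n) w)" for n w
    unfolding comb_def by (metis comp_apply funpow_add)
  then show ?thesis using rot_pow_inverse[of n w] by metis
qed

lemma comb_nb: "comb w \<Longrightarrow> nb w v \<Longrightarrow> comb v \<and> nbs w = {v}"
proof -
  assume w: "comb w" and v: "nb w v"
  from w obtain n a where a: "a \<noteq> []" "w = (rot ^^ n) (UU a) \<or> w = (rot ^^ n) (SS a)" unfolding comb_def by blast
  from a(2) show ?thesis
  proof
    assume "w = (rot ^^ n) (UU a)"
    then have "nbs w = {(rot ^^ n) (SS a)}" by (simp add: nbs_rot_pow nbs_UU)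
    then show ?thesis using v a(1) unfolding comb_def by (metis mem_nbs singletonD)
  next
    assume "w = (rot ^^ n) (SS a)"
    then have "nbs w = {(rot ^^ n) (UU a)}" by (simp add: nbs_rot_pow nbs_SS)
    then show ?thesis using v a(1) unfolding comb_def by (metis mem_nbs singletonD)
  qed
qed

lemma med_conn: "med u \<Longrightarrow> conn u v \<Longrightarrow> med v"
  unfolding med_def using conn_trans by blast

lemma med_rot_pow [simp]: "med ((rot ^^ n) w) \<longleftrightarrow> med w"
proof -
  have 1: "med ((rot ^^ n) w)" if w: "med w" for n w
  proof -
    obtain m a where "conn ((rot ^^ m) (TT a \<oplus> HH)) w" using w unfolding med_def by blast
    then have "conn ((rot ^^ (n + m)) (TT a \<oplus> HH)) ((rot ^^ n) w)"
      unfolding funpow_add comp_apply by (rule conn_rot_pow)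
    then show ?thesis unfolding med_def by blast
  qed
  then show ?thesis using rot_pow_inverse[of n w] by metis
qed

lemma med_rot [simp]: "med (rot w) \<longleftrightarrow> med w"
  using med_rot_pow[of 1 w] by simp

lemma med_cat_commute: "med (u \<oplus> v) \<longleftrightarrow> med (v \<oplus> u)"
  using med_rot_pow[of "2 * sz u" "u \<oplus> v"] by simp

lemma med_iff_conn: "conn u v \<Longrightarrow> med u \<longleftrightarrow> med v"
  using med_conn conn_sym by blast

text \<open>The extra pair can be moved along the chain by walks; hence every word of a medium component is connected
  to one of four words in which it sits at the face containing the first gap, or next to it.\<close>

definition med_word1 :: "bool list \<Rightarrow> bool list \<Rightarrow> arcs" where
  "med_word1 a b = TT a \<oplus> lf \<oplus> SS b \<oplus> VV"

definition med_word2 :: "bool list \<Rightarrow> bool list \<Rightarrow> arcs" where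
  "med_word2 a b = over (SS b \<oplus> VV \<oplus> TT a)"

definition med_word3 :: "bool list \<Rightarrow> bool list \<Rightarrow> arcs" where
  "med_word3 a b = lf \<oplus> TT a \<oplus> lf \<oplus> SS b \<oplus> lf"

definition med_word4 :: "bool list \<Rightarrow> bool list \<Rightarrow> arcs" where
  "med_word4 a b = over (TT a \<oplus> lf \<oplus> SS b \<oplus> lf)"

lemma rot_med_word2: "rot (med_word2 a b) = SS b \<oplus> VV \<oplus> TT a \<oplus> lf"
  by (simp add: med_word2_def)

lemma rot_med_word3: "rot (med_word3 a b) = med_word4 a b"
  by (simp add: med_word3_def med_word4_def)

lemma rot_med_word4: "rot (med_word4 a b) = med_word1 a b"
  by (simp add: med_word4_def med_word1_def)

text \<open>This and the next five lemmas move the first gap by one point in the words 1 and 2,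
  passing a link from one chain to the other if there is one. The words 3 and 4 need no walk: they
  rotate to 4 and 1.\<close>

lemma conn_rot_med_word1_Nil: "conn (rot (med_word1 [] b)) (med_word3 b [])"
proof -
  have "nb (over (lf \<oplus> VV)) (Arc Emp (Arc Emp VV))" by (simp add: nb_def)
  from nb_ins[OF this nb_SS_UU[of b], of 3] show ?thesis
    by (intro conn_nb) (simp add: med_word1_def med_word3_def)
qed

lemma conn_rot_med_word1_True: "conn (rot (med_word1 (True # a) b)) (med_word3 a (False # b))"
proof -
  have 1: "nb (lf \<oplus> lf \<oplus> over (lf \<oplus> VV)) (over (lf \<oplus> lf \<oplus> over VV))" by (simp add: nb_def)
  have 2: "nb (over (lf \<oplus> lf \<oplus> over VV)) (lf \<oplus> lf \<oplus> lf \<oplus> II \<oplus> lf)" by (simp add: nb_def)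
  have "nb (lf \<oplus> TT a \<oplus> over (lf \<oplus> SS b \<oplus> VV)) (over (lf \<oplus> SS a \<oplus> lf \<oplus> over (TT b \<oplus> lf)))"
    using nb_ins2[OF 1 nb_SS_UU[of b] nb_UU_SS[of a], of 3 7] by simp
  moreover have "nb (over (lf \<oplus> SS a \<oplus> lf \<oplus> over (TT b \<oplus> lf))) (lf \<oplus> TT a \<oplus> lf \<oplus> over (SS b \<oplus> lf) \<oplus> lf)"
    using nb_ins2[OF 2 nb_UU_SS[of b] nb_SS_UU[of a], of 3 7] by simp
  ultimately have "conn (lf \<oplus> TT a \<oplus> over (lf \<oplus> SS b \<oplus> VV)) (lf \<oplus> TT a \<oplus> lf \<oplus> over (SS b \<oplus> lf) \<oplus> lf)"
    using conn_nb conn_trans by blast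
  then show ?thesis by (simp add: med_word1_def med_word3_def)
qed

lemma conn_rot_med_word1_False: "conn (rot (med_word1 (False # a) b)) (med_word2 (False # b) a)"
proof -
  have 1: "nb (lf \<oplus> lf \<oplus> over (lf \<oplus> VV)) (over (VV \<oplus> over VV))" by (simp add: nb_def)
  have "nb (TT a \<oplus> lf \<oplus> over (lf \<oplus> SS b \<oplus> VV)) (over (SS a \<oplus> VV \<oplus> over (TT b \<oplus> lf)))"
    using nb_ins2[OF 1 nb_SS_UU[of b] nb_UU_SS[of a], of 1 7] by simp
  then show ?thesis by (intro conn_nb) (simp add: med_word1_def med_word2_def)
qed

lemma conn_rot_med_word2_Nil: "conn (rot (med_word2 a [])) (med_word4 [] a)"
proof -
  have "nb (Arc Emp HH) (over HH)" by simp
  from nb_ins[OF this nb_UU_SS[of a], of 5] show ?thesis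
    by (intro conn_nb) (simp add: med_word2_def med_word4_def)
qed

lemma conn_rot_med_word2_True: "conn (rot (med_word2 a (True # b))) (med_word3 b (True # a))"
proof -
  have 1: "nb (II \<oplus> VV \<oplus> lf \<oplus> lf) (lf \<oplus> lf \<oplus> over (VV \<oplus> lf))" by (simp add: nb_def)
  have 2: "nb (lf \<oplus> lf \<oplus> over (VV \<oplus> lf)) (over (lf \<oplus> lf \<oplus> over VV))" by (simp add: nb_def)
  have 3: "nb (over (lf \<oplus> lf \<oplus> over VV)) (lf \<oplus> lf \<oplus> lf \<oplus> II \<oplus> lf)" by (simp add: nb_def)
  have "nb (over (lf \<oplus> SS b) \<oplus> VV \<oplus> TT a \<oplus> lf) (lf \<oplus> TT b \<oplus> over (VV \<oplus> SS a \<oplus> lf))"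
    using nb_ins2[OF 1 nb_UU_SS[of a] nb_SS_UU[of b], of 3 9] by simp
  moreover have "nb (lf \<oplus> TT b \<oplus> over (VV \<oplus> SS a \<oplus> lf)) (over (lf \<oplus> SS b \<oplus> lf \<oplus> over (lf \<oplus> TT a)))"
    using nb_ins2[OF 2 nb_SS_UU[of a] nb_UU_SS[of b], of 3 9] by simp
  moreover have "nb (over (lf \<oplus> SS b \<oplus> lf \<oplus> over (lf \<oplus> TT a))) (lf \<oplus> TT b \<oplus> lf \<oplus> over (lf \<oplus> SS a) \<oplus> lf)"
    using nb_ins2[OF 3 nb_UU_SS[of a] nb_SS_UU[of b], of 3 9] by simp
  ultimately have "conn (over (lf \<oplus> SS b) \<oplus> VV \<oplus> TT a \<oplus> lf) (lf \<oplus> TT b \<oplus> lf \<oplus> over (lf \<oplus> SS a) \<oplus> lf)"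
    using conn_nb conn_trans by blast
  then show ?thesis by (simp add: med_word2_def med_word3_def)
qed

lemma conn_rot_med_word2_False: "conn (rot (med_word2 a (False # b))) (med_word2 (True # a) b)"
proof -
  have 1: "nb (II \<oplus> VV \<oplus> lf \<oplus> lf) (lf \<oplus> lf \<oplus> over (VV \<oplus> lf))" by (simp add: nb_def)
  have 2: "nb (lf \<oplus> lf \<oplus> over (VV \<oplus> lf)) (over (VV \<oplus> over VV))" by (simp add: nb_def)
  have "nb (over (SS b \<oplus> lf) \<oplus> VV \<oplus> TT a \<oplus> lf) (TT b \<oplus> lf \<oplus> over (VV \<oplus> SS a \<oplus> lf))"
    using nb_ins2[OF 1 nb_UU_SS[of a] nb_SS_UU[of b], of 1 9] by simp
  moreover have "nb (TT b \<oplus> lf \<oplus> over (VV \<oplus> SS a \<oplus> lf)) (over (SS b \<oplus> VV \<oplus> over (lf \<oplus> TT a)))"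
    using nb_ins2[OF 2 nb_SS_UU[of a] nb_UU_SS[of b], of 1 9] by simp
  ultimately have "conn (over (SS b \<oplus> lf) \<oplus> VV \<oplus> TT a \<oplus> lf) (over (SS b \<oplus> VV \<oplus> over (lf \<oplus> TT a)))"
    using conn_nb conn_trans by blast
  then show ?thesis by (simp add: med_word2_def)
qed

lemma med_med_word3_iff: "med (med_word3 a b) \<longleftrightarrow> med (med_word1 a b)"
  using med_rot[of "med_word3 a b"] med_rot[of "med_word4 a b"] unfolding rot_med_word3 rot_med_word4 by simp

lemma med_med_word2_iff: "med (med_word2 a b) \<longleftrightarrow> med (med_word1 a b)"
  using med_rot[of "med_word2 a b"] med_cat_commute[of "SS b \<oplus> VV" "TT a \<oplus> lf"] unfolding rot_med_word2 med_word1_def by simp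

lemma med_med_word1_Nil: "med (med_word1 a [])"
  unfolding med_def by (intro exI[of _ 0] exI[of _ a]) (simp add: med_word1_def)

text \<open>The walks shorten one chain, lengthen the other and exchange their roles. Hence the
  induction follows the length of either chain, which the disjunction expresses.\<close>

lemma med_med_word1_aux: "length a = n \<or> length b = n \<Longrightarrow> med (med_word1 a b)"
proof (induction n arbitrary: a b)
  case 0
  then show ?case
    using med_med_word1_Nil med_rot[of "med_word1 [] b"] med_iff_conn[OF conn_rot_med_word1_Nil[of b]] med_med_word3_iff by auto
next
  case (Suc n)
  from Suc.prems show ?case
  proof
    assume "length a = Suc n"
    then obtain x c where a: "a = x # c" "length c = n" by (cases a) auto
    then show ?thesis
      using Suc.IH[of c "False # b"] Suc.IH[of "False # b" c] med_rot[of "med_word1 a b"] med_med_word3_iff med_med_word2_iff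
        med_iff_conn[OF conn_rot_med_word1_True[of c b]] med_iff_conn[OF conn_rot_med_word1_False[of c b]] by (cases x) simp_all
  next
    assume "length b = Suc n"
    then obtain x c where b: "b = x # c" "length c = n" by (cases b) auto
    then show ?thesis
      using Suc.IH[of c "True # a"] Suc.IH[of "True # a" c] med_rot[of "med_word2 a b"] med_med_word3_iff med_med_word2_iff
        med_iff_conn[OF conn_rot_med_word2_True[of a c]] med_iff_conn[OF conn_rot_med_word2_False[of a c]] by (cases x) simp_all
  qed
qed

lemma med_med_word1: "med (med_word1 a b)"
  using med_med_word1_aux by blast

text \<open>The mirror image of \<open>med_word1 a b\<close> up to rotation. One step leads from it
  to a rotation of \<open>med_word1 b a\<close>, so no separate treatment of reflections is
  required.\<close>

lemma med_mirror: "med (SS b \<oplus> lf \<oplus> TT a \<oplus> VV)"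
proof -
  have 1: "nb (lf \<oplus> lf \<oplus> VV) (over (lf \<oplus> VV))" by (simp add: nb_def)
  have "nb (SS b \<oplus> lf \<oplus> TT a \<oplus> VV) (UU b \<oplus> over (lf \<oplus> SS a \<oplus> VV))"
    using nb_ins2[OF 1 nb_UU_SS[of a] nb_SS_UU[of b], of 0 3] by simp
  moreover have "rot (med_word1 b a) = UU b \<oplus> over (lf \<oplus> SS a \<oplus> VV)" by (simp add: med_word1_def)
  ultimately show ?thesis using med_rot[of "med_word1 b a"] med_med_word1 med_iff_conn[OF conn_nb] by metis
qed

definition med_form :: "arcs \<Rightarrow> bool" where
  "med_form w \<longleftrightarrow> (\<exists>a b. w = med_word1 a b \<or> w = med_word2 a b \<or> w = med_word3 a b \<or> w = med_word4 a b)"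

text \<open>In contrast to \<open>hub_form\<close>, closed under rotation only up to walks; this
  suffices because membership in \<open>med\<close> is invariant under walks.\<close>

lemma med_form_rot:
  assumes "med_form w"
  shows "\<exists>v. med_form v \<and> conn (rot w) v"
proof -
  have f: "med_form (med_word1 a b)" "med_form (med_word2 a b)" "med_form (med_word3 a b)" "med_form (med_word4 a b)" for a b
    unfolding med_form_def by blast+
  have r1: "\<exists>v. med_form v \<and> conn (rot (med_word1 a b)) v" for a b
  proof (cases a)
    case Nil then show ?thesis using conn_rot_med_word1_Nil f by blast
  next
    case (Cons x c)
    then show ?thesis using conn_rot_med_word1_True[of c b] conn_rot_med_word1_False[of c b] f by (metis (full_types))
  qed
  have r2: "\<exists>v. med_form v \<and> conn (rot (med_word2 a b)) v" for a b
  proof (cases b)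
    case Nil then show ?thesis using conn_rot_med_word2_Nil f by blast
  next
    case (Cons x c)
    then show ?thesis using conn_rot_med_word2_True[of a c] conn_rot_med_word2_False[of a c] f by (metis (full_types))
  qed
  show ?thesis using assms r1 r2 f rot_med_word3 rot_med_word4 conn_refl unfolding med_form_def[of w] by metis
qed

lemma med_conn_form:
  assumes "med w"
  shows "\<exists>v. med_form v \<and> conn v w"
proof -
  obtain n a where na: "conn ((rot ^^ n) (TT a \<oplus> HH)) w" using assms unfolding med_def by blast
  have "\<exists>v. med_form v \<and> conn ((rot ^^ m) (TT a \<oplus> HH)) v" for m
  proof (induction m)
    case 0
    have "med_word1 a [] = TT a \<oplus> HH" by (simp add: med_word1_def)
    then have "med_form (TT a \<oplus> HH)" unfolding med_form_def by metis
    then show ?case using conn_refl by (metis funpow_0)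
  next
    case (Suc m)
    then obtain v where v: "med_form v" "conn ((rot ^^ m) (TT a \<oplus> HH)) v" by blast
    then show ?case using med_form_rot[OF v(1)] conn_rot_pow[OF v(2), of 1] conn_trans by simp blast
  qed
  then show ?thesis using na conn_trans conn_sym by blast
qed

section \<open>Inserting a pair into a word of a medium component\<close>

lemma pair_med_word1: "4 < sz (med_word1 a b) \<Longrightarrow> big (pair c \<oplus> med_word1 a b)"
proof -
  assume "4 < sz (med_word1 a b)"
  then consider "\<not> c" | "c" "a \<noteq> []" | "c" "b \<noteq> []" by (fastforce simp: med_word1_def)
  then show ?thesis
  proof cases
    case 1
    have "big (VV \<oplus> TT a \<oplus> lf \<oplus> SS b \<oplus> VV)"
      by (rule big_exts[of "VV \<oplus> lf \<oplus> lf \<oplus> Emp \<oplus> VV"]) (use big_ring(2) in simp, intro exts_intros)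
    then show ?thesis using 1 by (simp add: pair_def med_word1_def)
  next
    case 2
    have "big (II \<oplus> TT a \<oplus> lf \<oplus> SS b \<oplus> VV)"
      by (rule big_exts[of "II \<oplus> over VV \<oplus> lf \<oplus> Emp \<oplus> VV"]) (use big_base_16 in simp, intro exts_intros 2)
    then show ?thesis using 2 by (simp add: pair_def med_word1_def)
  next
    case 3
    have "big (II \<oplus> TT a \<oplus> lf \<oplus> SS b \<oplus> VV)"
      by (rule big_exts[of "II \<oplus> lf \<oplus> lf \<oplus> II \<oplus> VV"]) (use big_base_17 in simp, intro exts_intros 3)
    then show ?thesis using 3 by (simp add: pair_def med_word1_def)
  qed
qed

lemma pair_med_word2: "4 < sz (med_word2 a b) \<Longrightarrow> big (pair c \<oplus> med_word2 a b)"
proof -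
  assume "4 < sz (med_word2 a b)"
  then consider "c" | "\<not> c" "a \<noteq> []" | "\<not> c" "b \<noteq> []" by (fastforce simp: med_word2_def)
  then show ?thesis
  proof cases
    case 1
    have "big (II \<oplus> over (SS b \<oplus> VV \<oplus> TT a))"
      by (rule big_exts[of "II \<oplus> over (Emp \<oplus> VV \<oplus> lf)"]) (use big_base_8 in simp, intro exts_intros)
    then show ?thesis using 1 by (simp add: pair_def med_word2_def)
  next
    case 2
    have "big (VV \<oplus> over (SS b \<oplus> VV \<oplus> TT a))"
      by (rule big_exts[of "VV \<oplus> over (Emp \<oplus> VV \<oplus> over VV)"]) (use big_base_6 in simp, intro exts_intros 2)
    then show ?thesis using 2 by (simp add: pair_def med_word2_def)
  next
    case 3
    have "big (VV \<oplus> over (SS b \<oplus> VV \<oplus> TT a))"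
      by (rule big_exts[of "VV \<oplus> over (II \<oplus> VV \<oplus> lf)"]) (use big_base_13 in simp, intro exts_intros 3)
    then show ?thesis using 3 by (simp add: pair_def med_word2_def)
  qed
qed

lemma pair_med_word3: "med (pair c \<oplus> med_word3 a b) \<or> big (pair c \<oplus> med_word3 a b)"
proof -
  consider "\<not> c" | "c" "b = []" | "c" "b \<noteq> []" by blast
  then show ?thesis
  proof cases
    case 1
    have "big (VV \<oplus> lf \<oplus> TT a \<oplus> lf \<oplus> SS b \<oplus> lf)"
      by (rule big_exts[of "VV \<oplus> lf \<oplus> lf \<oplus> lf \<oplus> Emp \<oplus> lf"]) (use big_ring(2) in simp, intro exts_intros)
    then show ?thesis using 1 by (simp add: pair_def med_word3_def)
  next
    case 2
    then show ?thesis using med_mirror[of "[True]" a] by (simp add: pair_def med_word3_def)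
  next
    case 3
    have "big (II \<oplus> lf \<oplus> TT a \<oplus> lf \<oplus> SS b \<oplus> lf)"
      by (rule big_exts[of "II \<oplus> lf \<oplus> lf \<oplus> lf \<oplus> II \<oplus> lf"]) (use big_base_9 in simp, intro exts_intros 3)
    then show ?thesis using 3 by (simp add: pair_def med_word3_def)
  qed
qed

lemma pair_med_word4: "med (pair c \<oplus> med_word4 a b) \<or> big (pair c \<oplus> med_word4 a b)"
proof -
  consider "c" | "\<not> c" "a = []" | "\<not> c" "a \<noteq> []" by blast
  then show ?thesis
  proof cases
    case 1
    have "big (II \<oplus> over (TT a \<oplus> lf \<oplus> SS b \<oplus> lf))"
      by (rule big_exts[of "II \<oplus> over (lf \<oplus> lf \<oplus> Emp \<oplus> lf)"]) (use big_base_8 in simp, intro exts_intros)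
    then show ?thesis using 1 by (simp add: pair_def med_word4_def)
  next
    case 2
    have "med ((lf \<oplus> over VV \<oplus> VV) \<oplus> SS b)"
      using med_mirror[of b "[True]"] by (subst med_cat_commute) simp
    then have "med ((over VV \<oplus> VV \<oplus> SS b) \<oplus> lf)" by (subst med_cat_commute) simp
    then have "med ((VV \<oplus> SS b \<oplus> lf) \<oplus> over VV)" by (subst med_cat_commute) simp
    then have "med (rot (over (VV \<oplus> SS b \<oplus> lf) \<oplus> VV))" by simp
    then have "med (over (VV \<oplus> SS b \<oplus> lf) \<oplus> VV)" by (simp only: med_rot)
    then have "med (VV \<oplus> over (VV \<oplus> SS b \<oplus> lf))" by (subst med_cat_commute)
    then show ?thesis using 2 by (simp add: pair_def med_word4_def)
  next
    case 3
    have "big (VV \<oplus> over (TT a \<oplus> lf \<oplus> SS b \<oplus> lf))"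
      by (rule big_exts[of "VV \<oplus> over (over VV \<oplus> lf \<oplus> Emp \<oplus> lf)"]) (use big_base_7 in simp, intro exts_intros 3)
    then show ?thesis using 3 by (simp add: pair_def med_word4_def)
  qed
qed

lemma pair_med:
  assumes "med u"
  shows "med (pair c \<oplus> u) \<or> big (pair c \<oplus> u)"
proof -
  \<comment> \<open>The walk from \<open>v\<close> to \<open>u\<close> may flip the pair, so both
    pairs have to be known in front of \<open>v\<close>.\<close>
  have step: "med (pair c \<oplus> u) \<or> big (pair c \<oplus> u)"
    if vu: "conn v u" and v: "\<And>d. med (pair d \<oplus> v) \<or> big (pair d \<oplus> v)" for v
  proof -
    obtain b where "walk b v u" using vu unfolding conn_def by blast
    then have "walk b (pair (c \<noteq> b) \<oplus> v) (pair ((c \<noteq> b) \<noteq> b) \<oplus> u)" by (rule walk_pair)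
    then have "conn (pair (c \<noteq> b) \<oplus> v) (pair c \<oplus> u)" unfolding conn_def by (cases b; cases c) auto
    then show ?thesis using v med_conn big_conn by blast
  qed
  obtain v where v: "med_form v" "conn v u" using med_conn_form[OF assms] by blast
  show ?thesis
  proof (cases "4 < sz u")
    case True
    have "med (pair d \<oplus> v) \<or> big (pair d \<oplus> v)" for d
      using v(1) True conn_sz[OF v(2)] pair_med_word1 pair_med_word2 pair_med_word3 pair_med_word4 unfolding med_form_def by metis
    then show ?thesis using step v(2) by blast
  next
    case False
    then have "sz v \<le> 4" using conn_sz[OF v(2)] by simp
    \<comment> \<open>At size 4 the normal forms reduce to the ring and its rotation. There
      \<open>II\<close> in front gives a medium word again, namely \<open>med_mirror\<close> at
      \<open>[True]\<close> and \<open>[]\<close>, while \<open>VV\<close> gives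
      \<open>ring 6\<close>.\<close>
    then have "v = med_word1 [] [] \<or> v = med_word2 [] [] \<or> v = med_word3 [] [] \<or> v = med_word4 [] []"
      using v(1) unfolding med_form_def by (auto simp: med_word1_def med_word2_def med_word3_def med_word4_def)
    then have "v = Arc Emp HH \<or> v = over HH" by (auto simp: med_word1_def med_word2_def med_word3_def med_word4_def)
    then have "conn (Arc Emp HH) v" using conn_refl conn_nb[of "Arc Emp HH" "over HH"] by auto
    then have c: "conn (Arc Emp HH) u" using v(2) conn_trans by blast
    have "VV \<oplus> Arc Emp HH = ring 6" by simp
    then have "big (VV \<oplus> Arc Emp HH)" using big_ring(2) by metis
    moreover have "med (II \<oplus> Arc Emp HH)" using med_mirror[of "[True]" "[]"] by simp
    ultimately have "med (pair d \<oplus> Arc Emp HH) \<or> big (pair d \<oplus> Arc Emp HH)" for d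
      unfolding pair_def by presburger
    then show ?thesis using step[OF c] by blast
  qed
qed


text \<open>The counterpart of \<open>hub_form\<close> for even size: an odd chain
  \<open>TT a\<close>, an even chain \<open>SS b\<close> and one short edge in all six orders, or an
  arc around the two chains in both orders.\<close>

definition comb_form :: "arcs \<Rightarrow> bool" where
  "comb_form w \<longleftrightarrow> (\<exists>a b. w = TT a \<oplus> lf \<oplus> SS b \<or> w = SS b \<oplus> lf \<oplus> TT a \<or> w = lf \<oplus> TT a \<oplus> SS b \<or>
    w = lf \<oplus> SS b \<oplus> TT a \<or> w = TT a \<oplus> SS b \<oplus> lf \<or> w = SS b \<oplus> TT a \<oplus> lf \<or>
    w = over (TT a \<oplus> SS b) \<or> w = over (SS b \<oplus> TT a))"

lemma comb_form_intros:
  "comb_form (TT a \<oplus> lf \<oplus> SS b)" "comb_form (SS b \<oplus> lf \<oplus> TT a)" "comb_form (lf \<oplus> TT a \<oplus> SS b)"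
  "comb_form (lf \<oplus> SS b \<oplus> TT a)" "comb_form (TT a \<oplus> SS b \<oplus> lf)" "comb_form (SS b \<oplus> TT a \<oplus> lf)"
  "comb_form (over (TT a \<oplus> SS b))" "comb_form (over (SS b \<oplus> TT a))"
  unfolding comb_form_def by blast+

lemma comb_form_cases:
  assumes "comb_form w"
  obtains a b where "w = TT a \<oplus> lf \<oplus> SS b" | a b where "w = SS b \<oplus> lf \<oplus> TT a"
    | a b where "w = lf \<oplus> TT a \<oplus> SS b" | a b where "w = lf \<oplus> SS b \<oplus> TT a"
    | a b where "w = TT a \<oplus> SS b \<oplus> lf" | a b where "w = SS b \<oplus> TT a \<oplus> lf"
    | a b where "w = over (TT a \<oplus> SS b)" | a b where "w = over (SS b \<oplus> TT a)"
  using assms unfolding comb_form_def by blast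

lemma comb_form_UU_SS: "comb_form (UU (x # a) \<oplus> SS b)"
  using comb_form_intros(1,3)[where a = a and b = b] by (cases x) simp_all

lemma comb_form_SS_TT: "comb_form (lr y lf (SS b) \<oplus> TT a)"
  using comb_form_intros(2,4)[where a = a and b = b] by (cases y) simp_all

lemma comb_form_rot:
  assumes "comb_form w"
  shows "comb_form (rot w)"
  using assms
proof (cases rule: comb_form_cases)
  case (1 a b)
  then have r: "rot w = UU a \<oplus> SS (True # b)" by simp
  show ?thesis
  proof (cases a)
    case Nil then show ?thesis using r comb_form_intros(7)[of "[]" b] by simp
  next
    case (Cons x c) then show ?thesis unfolding r Cons by (intro comb_form_UU_SS)
  qed
next
  case (2 a b)
  show ?thesis
  proof (cases b)
    case Nil then show ?thesis using 2 comb_form_intros(7)[of a "[]"] by simp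
  next
    case (Cons y c)
    then have "rot w = lr y lf (SS c) \<oplus> TT (True # a)" by (simp add: 2)
    then show ?thesis using comb_form_SS_TT by metis
  qed
next
  case (3 a b)
  then show ?thesis using comb_form_intros(7)[of a b] by simp
next
  case (4 a b)
  then have "rot w = over (SS b \<oplus> TT a)" by simp
  then show ?thesis using comb_form_intros(8) by metis
next
  case (5 a b)
  then have r: "rot w = UU a \<oplus> SS (False # b)" by simp
  show ?thesis
  proof (cases a)
    case Nil then show ?thesis using r comb_form_intros(8)[where a = "[]" and b = b] by simp
  next
    case (Cons x c) then show ?thesis unfolding r Cons by (intro comb_form_UU_SS)
  qed
next
  case (6 a b)
  show ?thesis
  proof (cases b)
    case Nil
    then have r: "rot w = UU a \<oplus> SS [True]" by (simp add: 6)
    show ?thesis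
    proof (cases a)
      case Nil then show ?thesis using r comb_form_intros(7)[of "[]" "[]"] by simp
    next
      case (Cons x c) then show ?thesis unfolding r Cons by (intro comb_form_UU_SS)
    qed
  next
    case (Cons y c)
    then have "rot w = lr y lf (SS c) \<oplus> TT (False # a)" by (simp add: 6)
    then show ?thesis using comb_form_SS_TT by metis
  qed
next
  case (7 a b)
  then have "rot w = TT a \<oplus> SS b \<oplus> lf" by simp
  then show ?thesis using comb_form_intros(5) by metis
next
  case (8 a b)
  then have "rot w = SS b \<oplus> TT a \<oplus> lf" by simp
  then show ?thesis using comb_form_intros(6) by metis
qed

lemma comb_form_comb: "comb w \<Longrightarrow> comb_form w"
proof -
  assume "comb w"
  then obtain n a where a: "a \<noteq> []" "w = (rot ^^ n) (UU a) \<or> w = (rot ^^ n) (SS a)" unfolding comb_def by blast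
  obtain x c where c: "a = x # c" using a(1) by (cases a) auto
  have "comb_form (UU a)" using comb_form_UU_SS[of x c "[]"] unfolding c by simp
  moreover have "comb_form (SS a)"
    using comb_form_intros(7)[of "[]" c] comb_form_intros(8)[where a = "[]" and b = c] unfolding c by (cases x) simp_all
  moreover have "comb_form v \<Longrightarrow> comb_form ((rot ^^ n) v)" for v by (induction n) (auto intro: comb_form_rot)
  ultimately show ?thesis using a(2) by blast
qed

lemma med_VV_TT_lf: "med (VV \<oplus> TT a \<oplus> lf)" "med (VV \<oplus> lf \<oplus> TT a)"
proof -
  have H: "med (TT a \<oplus> HH)" using med_med_word1_Nil[of a] by (simp add: med_word1_def)
  then have "med ((TT a \<oplus> lf) \<oplus> VV)" by simp
  then show "med (VV \<oplus> TT a \<oplus> lf)" by (subst (asm) med_cat_commute)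
  have "med (TT a \<oplus> (VV \<oplus> lf))" using H by simp
  then have "med ((VV \<oplus> lf) \<oplus> TT a)" by (subst (asm) med_cat_commute)
  then show "med (VV \<oplus> lf \<oplus> TT a)" by simp
qed

lemma med_four_lf: "med (VV \<oplus> VV \<oplus> SS b)" "med (VV \<oplus> lf \<oplus> SS b \<oplus> lf)" "med (VV \<oplus> SS b \<oplus> VV)"
proof -
  have "med (SS b \<oplus> (VV \<oplus> VV))" using med_mirror[of b "[]"] by simp
  then have 1: "med ((VV \<oplus> VV) \<oplus> SS b)" by (subst (asm) med_cat_commute)
  then show "med (VV \<oplus> VV \<oplus> SS b)" by simp
  have "med (lf \<oplus> (HH \<oplus> SS b))" using 1 by simp
  then have "med ((HH \<oplus> SS b) \<oplus> lf)" by (subst (asm) med_cat_commute)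
  then show "med (VV \<oplus> lf \<oplus> SS b \<oplus> lf)" by simp
  have "med (VV \<oplus> (VV \<oplus> SS b))" using 1 by simp
  then have "med ((VV \<oplus> SS b) \<oplus> VV)" by (subst (asm) med_cat_commute)
  then show "med (VV \<oplus> SS b \<oplus> VV)" by simp
qed

lemma comb_VV_SS: "comb (VV \<oplus> SS b)"
proof -
  have "comb (SS (True # b))" unfolding comb_def by (intro exI[of _ 0] exI[of _ "True # b"]) simp
  moreover have "(rot ^^ 1) (VV \<oplus> SS b) = SS (True # b)" by simp
  ultimately show ?thesis by (metis comb_rot_pow)
qed

text \<open>The chain becomes longer only under an outer arc with \<open>a = []\<close>. The first
  two shapes, and the next four when one chain is empty, give medium words; the remaining ones arise
  from a small large-class word.\<close>

lemma VV_comb_form: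
  assumes "comb_form w"
  shows "comb (VV \<oplus> w) \<or> med (VV \<oplus> w) \<or> big (VV \<oplus> w)"
  using assms
proof (cases rule: comb_form_cases)
  case (1 a b)
  have "med ((TT a \<oplus> lf \<oplus> SS b) \<oplus> VV)" using med_med_word1[of a b] by (simp add: med_word1_def)
  then have "med (VV \<oplus> w)" unfolding 1 by (subst med_cat_commute)
  then show ?thesis by blast
next
  case (2 a b)
  have "med ((SS b \<oplus> lf \<oplus> TT a) \<oplus> VV)" using med_mirror[of b a] by simp
  then have "med (VV \<oplus> w)" unfolding 2 by (subst med_cat_commute)
  then show ?thesis by blast
next
  case (3 a b)
  consider "a = []" | "b = []" | "a \<noteq> []" "b \<noteq> []" by blast
  then show ?thesis
  proof cases
    case 1 then show ?thesis using 3 med_four_lf(1)[of b] by simp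
  next
    case 2 then show ?thesis using 3 med_VV_TT_lf(2)[of a] by simp
  next
    case c: 3
    have "big (VV \<oplus> w)" unfolding 3
      by (rule big_exts[of "VV \<oplus> lf \<oplus> over VV \<oplus> II"]) (use big_base_11 in simp, intro exts_intros c)
    then show ?thesis by blast
  qed
next
  case (4 a b)
  consider "a = []" | "b = []" | "a \<noteq> []" "b \<noteq> []" by blast
  then show ?thesis
  proof cases
    case 1 then show ?thesis using 4 med_four_lf(2)[of b] by simp
  next
    case 2 then show ?thesis using 4 med_VV_TT_lf(2)[of a] by simp
  next
    case c: 3
    have "big (VV \<oplus> w)" unfolding 4
      by (rule big_exts[of "VV \<oplus> lf \<oplus> II \<oplus> over VV"]) (use big_base_14 in simp, intro exts_intros c)
    then show ?thesis by blast
  qed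
next
  case (5 a b)
  consider "a = []" | "b = []" | "a \<noteq> []" "b \<noteq> []" by blast
  then show ?thesis
  proof cases
    case 1 then show ?thesis using 5 med_four_lf(2)[of b] by simp
  next
    case 2 then show ?thesis using 5 med_VV_TT_lf(1)[of a] by simp
  next
    case c: 3
    have "big (VV \<oplus> w)" unfolding 5
      by (rule big_exts[of "VV \<oplus> over VV \<oplus> II \<oplus> lf"]) (use big_base_12 in simp, intro exts_intros c)
    then show ?thesis by blast
  qed
next
  case (6 a b)
  consider "a = []" | "b = []" | "a \<noteq> []" "b \<noteq> []" by blast
  then show ?thesis
  proof cases
    case 1 then show ?thesis using 6 med_four_lf(3)[of b] by simp
  next
    case 2 then show ?thesis using 6 med_VV_TT_lf(1)[of a] by simp
  next
    case c: 3
    have "big (VV \<oplus> w)" unfolding 6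
      by (rule big_exts[of "VV \<oplus> II \<oplus> over VV \<oplus> lf"]) (use big_base_15 in simp, intro exts_intros c)
    then show ?thesis by blast
  qed
next
  case (7 a b)
  show ?thesis
  proof (cases "a = []")
    case True then show ?thesis using 7 comb_VV_SS[of "True # b"] by simp
  next
    case False
    have "big (VV \<oplus> w)" unfolding 7
      by (rule big_exts[of "VV \<oplus> over (over VV \<oplus> Emp)"]) (use big_base_5 in simp, intro exts_intros False)
    then show ?thesis by blast
  qed
next
  case (8 a b)
  show ?thesis
  proof (cases "a = []")
    case True then show ?thesis using 8 comb_VV_SS[of "False # b"] by simp
  next
    case False
    have "big (VV \<oplus> w)" unfolding 8
      by (rule big_exts[of "VV \<oplus> over (Emp \<oplus> over VV)"]) (use big_base_5 in simp, intro exts_intros False)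
    then show ?thesis by blast
  qed
qed

theorem even_classification:
  assumes "even (sz w)" "w \<noteq> Emp"
  shows "comb w \<or> med w \<or> big w"
  using assms
proof (induction "sz w" arbitrary: w rule: less_induct)
  case less
  have w2: "2 \<le> sz w" using less.prems sz_eq_0[of w] by presburger
  obtain u0 where "ext u0 w" using ex_ext[OF w2] by blast
  then obtain p c where pc: "(rot ^^ p) w = pair c \<oplus> (rot ^^ p) u0" by (rule ext_rot)
  define u where "u = (rot ^^ p) u0"
  have sz: "sz w = sz u + 2" using arg_cong[OF pc, of sz] by (simp add: u_def)
  have "comb (pair c \<oplus> u) \<or> med (pair c \<oplus> u) \<or> big (pair c \<oplus> u)"
  proof (cases "u = Emp")
    case True
    have "comb VV" "comb II" unfolding comb_def
      by (intro exI[of _ 0] exI[of _ "[True]"]; simp)+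
    then show ?thesis using True by (simp add: pair_def)
  next
    case False
    then have "comb u \<or> med u \<or> big u" using less.hyps[of u] sz less.prems(1) by auto
    then consider "comb u" | "med u" | "big u" by blast
    then show ?thesis
    proof cases
      case 1
      show ?thesis
      proof (cases c)
        case True
        \<comment> \<open>The pair \<open>II\<close> flips together with \<open>u\<close> into
          \<open>VV\<close> before the unique neighbour of \<open>u\<close>, again a comb; hence
          only inserted \<open>VV\<close> needs analysis.\<close>
        have "nbs u \<noteq> {}" using 1 nbs_UU nbs_SS unfolding comb_def by (auto simp: nbs_rot_pow simp del: mem_nbs)
        then obtain v where v: "nb u v" by auto
        then have "nb (VV \<oplus> v) (II \<oplus> u)" using nb_cat_iff[of VV II v u] nb_sym by simp
        then have "nb (VV \<oplus> v) (pair c \<oplus> u)" using True by (simp add: pair_def)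
        moreover have "comb (VV \<oplus> v) \<or> med (VV \<oplus> v) \<or> big (VV \<oplus> v)"
          using VV_comb_form comb_form_comb comb_nb[OF 1 v] by blast
        ultimately show ?thesis using comb_nb med_conn big_conn conn_nb by blast
      next
        case False
        then show ?thesis using VV_comb_form[OF comb_form_comb[OF 1]] by (simp add: pair_def)
      qed
    next
      case 2 then show ?thesis using pair_med by blast
    next
      case 3 then show ?thesis using big_pair_cat by blast
    qed
  qed
  then show ?case unfolding u_def pc[symmetric] by simp
qed

section \<open>Matchings and components\<close>

definition matching :: "arcs \<Rightarrow> nat set set" where
  "matching w = (\<lambda>(i, j). {i, j}) ` edges 0 w"

lemma doubleton_eq: "i < j \<Longrightarrow> k < l \<Longrightarrow> {i, j} = {k, l} \<longleftrightarrow> i = k \<and> j = (l :: nat)"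
  by (auto simp: doubleton_eq_iff)

lemma crosses_iff:
  assumes "i < j" "k < l"
  shows "crosses {i, j} {k, l} \<longleftrightarrow> (i < k \<and> k < j \<and> j < l) \<or> (k < i \<and> i < l \<and> l < j)"
proof
  assume "crosses {i, j} {k, l}"
  then obtain a b c d where o: "a < c" "c < b" "b < d"
    and "{i, j} = {a, b} \<and> {k, l} = {c, d} \<or> {i, j} = {c, d} \<and> {k, l} = {a, b}"
    unfolding crosses_def by blast
  then show "(i < k \<and> k < j \<and> j < l) \<or> (k < i \<and> i < l \<and> l < j)"
    using assms doubleton_eq[of i j a b] doubleton_eq[of k l c d] doubleton_eq[of i j c d] doubleton_eq[of k l a b]
    by (metis less_trans)
next
  assume "(i < k \<and> k < j \<and> j < l) \<or> (k < i \<and> i < l \<and> l < j)"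
  then show "crosses {i, j} {k, l}" unfolding crosses_def by blast
qed

lemma matching_memI: "(i, j) \<in> edges 0 w \<Longrightarrow> {i, j} \<in> matching w"
  unfolding matching_def by (rule image_eqI[where x = "(i, j)"]) simp_all

lemma matching_memD: "e \<in> matching w \<Longrightarrow> \<exists>i j. (i, j) \<in> edges 0 w \<and> e = {i, j}"
  by (auto simp: matching_def)

lemma is_matching_matching: "is_matching (sz w) (matching w)"
  unfolding is_matching_def
proof (intro conjI allI impI ballI)
  fix e assume "e \<in> matching w"
  then show "\<exists>i j. i < j \<and> j < 2 * sz w \<and> e = {i, j}"
    by (auto simp: matching_def dest!: edges_bounds) blast
next
  fix x assume "x < 2 * sz w"
  then obtain i j where e: "(i, j) \<in> edges 0 w" "x = i \<or> x = j"
    using edges_cover[of 0 x w] by (metis add_0 fst_conv prod.collapse snd_conv zero_le)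
  have "f = {i, j}" if f: "f \<in> matching w" "x \<in> f" for f
  proof -
    obtain k l where kl: "(k, l) \<in> edges 0 w" "f = {k, l}" using f by (auto simp: matching_def)
    then show ?thesis using e f(2) edges_disjoint[OF e(1) kl(1)] edges_disjoint[OF kl(1) e(1)] by auto
  qed
  then show "\<exists>!e. e \<in> matching w \<and> x \<in> e"
    using e by (intro ex1I[of _ "{i, j}"]) (auto simp: matching_def)
next
  fix e f assume "e \<in> matching w" "f \<in> matching w"
  then obtain i j k l where "(i, j) \<in> edges 0 w" "e = {i, j}" "(k, l) \<in> edges 0 w" "f = {k, l}"
    by (auto simp: matching_def)
  then show "\<not> crosses e f"
    using edges_noncrossing[of i j 0 w k l] edges_noncrossing[of k l 0 w i j]
      edges_bounds[of i j 0 w] edges_bounds[of k l 0 w] by (simp add: crosses_iff)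
qed

lemma matching_mem_iff: "i < j \<Longrightarrow> {i, j} \<in> matching w \<longleftrightarrow> (i, j) \<in> edges 0 w"
  unfolding matching_def using edges_bounds[of _ _ 0 w] by (auto simp: doubleton_eq image_iff) 

lemma matching_eq_iff_edges: "matching u = matching v \<longleftrightarrow> edges 0 u = edges 0 v"
proof
  assume "matching u = matching v"
  then have "(i, j) \<in> edges 0 u \<longleftrightarrow> (i, j) \<in> edges 0 v" for i j
    using matching_mem_iff[of i j] edges_bounds[of i j 0 u] edges_bounds[of i j 0 v] by blast
  then show "edges 0 u = edges 0 v" by auto
qed (simp add: matching_def)

lemma edges_inj: "edges p u = edges p v \<Longrightarrow> u = v"
proof (induction u arbitrary: p v)
  case Emp then show ?case by (cases v) auto
next
  case (Arc a b)
  obtain c d where v: "v = Arc c d" using Arc.prems by (cases v) auto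
  have "(p, p + 2 * sz a + 1) \<in> edges p v" using Arc.prems[symmetric] by simp
  moreover have "(p, p + 2 * sz c + 1) \<in> edges p v" by (simp add: v)
  ultimately have ac: "sz a = sz c" using edges_disjoint by fastforce
  have split: "edges (p + 1) x = {e \<in> edges p (Arc x y). p < fst e \<and> snd e < p + 2 * sz x + 1}"
    "edges (p + 2 * sz x + 2) y = {e \<in> edges p (Arc x y). p + 2 * sz x + 1 < fst e}" for x y
    using edges_bounds[of _ _ "p + 1" x] edges_bounds[of _ _ "p + 2 * sz x + 2" y] by fastforce+
  have "edges (p + 1) a = edges (p + 1) c" "edges (p + 2 * sz c + 2) b = edges (p + 2 * sz c + 2) d"
    using split[of a b] split[of c d] by (simp_all only: Arc.prems v ac)
  then show ?case using Arc.IH v by simp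
qed

lemma matching_inj: "matching u = matching v \<longleftrightarrow> u = v"
  using edges_inj by (auto simp: matching_eq_iff_edges)

text \<open>Recovers the word from its edges. The interval is arbitrary so that the induction
  applies to the points under the edge at \<open>p\<close> and to those after it; that
  \<open>n\<close> is even comes out as a result.\<close>

lemma edges_of_pairs:
  assumes "\<And>i j. (i, j) \<in> P \<Longrightarrow> p \<le> i \<and> i < j \<and> j < p + n"
    and "\<And>x. p \<le> x \<Longrightarrow> x < p + n \<Longrightarrow> \<exists>e\<in>P. x = fst e \<or> x = snd e"
    and "\<And>i j k l. (i, j) \<in> P \<Longrightarrow> (k, l) \<in> P \<Longrightarrow> i = k \<or> j = l \<or> j = k \<Longrightarrow> i = k \<and> j = l"
    and "\<And>i j k l. (i, j) \<in> P \<Longrightarrow> (k, l) \<in> P \<Longrightarrow> \<not> (i < k \<and> k < j \<and> j < l)"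
  shows "\<exists>w. n = 2 * sz w \<and> P = edges p w"
  using assms
proof (induction n arbitrary: p P rule: less_induct)
  case (less n)
  show ?case
  proof (cases "n = 0")
    case True
    then have "P = {}" using less.prems(1) by fastforce
    then show ?thesis using True by (intro exI[of _ Emp]) simp
  next
    case False
    then obtain e where e: "e \<in> P" "p = fst e \<or> p = snd e" using less.prems(2)[of p] by auto
    then obtain j where j: "(p, j) \<in> P" "p < j" "j < p + n"
      using less.prems(1)[of "fst e" "snd e"] by (cases e) fastforce
    define P1 where "P1 = {e \<in> P. p < fst e \<and> snd e < j}"
    define P2 where "P2 = {e \<in> P. j < fst e}"
    have P: "P = insert (p, j) (P1 \<union> P2)"
    proof -
      have "(k, l) = (p, j) \<or> (k, l) \<in> P1 \<or> (k, l) \<in> P2" if kl: "(k, l) \<in> P" for k l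
      proof (cases "k = p")
        case True then show ?thesis using less.prems(3)[OF j(1) kl] by simp
      next
        case False
        then have "p < k" "k < l" "l \<noteq> j" "k \<noteq> j" "\<not> (k < j \<and> j < l)"
          using less.prems(1)[OF kl] less.prems(3)[OF j(1) kl] less.prems(4)[OF j(1) kl] by auto
        then have "l < j \<or> j < k" by linarith
        then show ?thesis using kl \<open>p < k\<close> by (auto simp: P1_def P2_def)
      qed
      then show ?thesis using j(1) unfolding P1_def P2_def by fastforce
    qed
    have "\<exists>u. j - p - 1 = 2 * sz u \<and> P1 = edges (p + 1) u"
    proof (rule less.IH)
      show "j - p - 1 < n" using j by simp
      fix x assume x: "p + 1 \<le> x" "x < p + 1 + (j - p - 1)"
      then obtain e where e: "e \<in> P" "x = fst e \<or> x = snd e" using less.prems(2)[of x] j by auto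
      moreover have "e \<notin> P2" using e x j less.prems(1)[of "fst e" "snd e"] by (auto simp: P2_def)
      moreover have "e \<noteq> (p, j)" using e x by auto
      ultimately show "\<exists>e\<in>P1. x = fst e \<or> x = snd e" using P by auto
    next
      fix i l assume "(i, l) \<in> P1"
      then show "p + 1 \<le> i \<and> i < l \<and> l < p + 1 + (j - p - 1)"
        using less.prems(1)[of i l] by (auto simp: P1_def)
    next
      fix i l i' l' assume "(i, l) \<in> P1" "(i', l') \<in> P1" "i = i' \<or> l = l' \<or> l = i'"
      then show "i = i' \<and> l = l'" using less.prems(3)[of i l i' l'] unfolding P1_def by blast
    next
      fix i l i' l' assume "(i, l) \<in> P1" "(i', l') \<in> P1"
      then show "\<not> (i < i' \<and> i' < l \<and> l < l')" using less.prems(4)[of i l i' l'] unfolding P1_def by blast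
    qed
    then obtain u where u: "j - p - 1 = 2 * sz u" "P1 = edges (p + 1) u" by blast
    have "\<exists>v. p + n - j - 1 = 2 * sz v \<and> P2 = edges (j + 1) v"
    proof (rule less.IH)
      show "p + n - j - 1 < n" using j by simp
      fix x assume x: "j + 1 \<le> x" "x < j + 1 + (p + n - j - 1)"
      then obtain e where e: "e \<in> P" "x = fst e \<or> x = snd e" using less.prems(2)[of x] j by auto
      moreover have "e \<notin> P1" using e x j less.prems(1)[of "fst e" "snd e"] by (auto simp: P1_def)
      moreover have "e \<noteq> (p, j)" using e x j by auto
      ultimately show "\<exists>e\<in>P2. x = fst e \<or> x = snd e" using P by auto
    next
      fix i l assume "(i, l) \<in> P2"
      then show "j + 1 \<le> i \<and> i < l \<and> l < j + 1 + (p + n - j - 1)"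
        using less.prems(1)[of i l] by (auto simp: P2_def)
    next
      fix i l i' l' assume "(i, l) \<in> P2" "(i', l') \<in> P2" "i = i' \<or> l = l' \<or> l = i'"
      then show "i = i' \<and> l = l'" using less.prems(3)[of i l i' l'] unfolding P2_def by blast
    next
      fix i l i' l' assume "(i, l) \<in> P2" "(i', l') \<in> P2"
      then show "\<not> (i < i' \<and> i' < l \<and> l < l')" using less.prems(4)[of i l i' l'] unfolding P2_def by blast
    qed
    then obtain v where v: "p + n - j - 1 = 2 * sz v" "P2 = edges (j + 1) v" by blast
    have "j = p + 2 * sz u + 1" "n = 2 * sz (Arc u v)" using u(1) v(1) j by auto
    then show ?thesis using P u(2) v(2) by (intro exI[of _ "Arc u v"]) simp
  qed
qed

lemma matching_surj:
  assumes M: "is_matching k M"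
  shows "\<exists>w. sz w = k \<and> M = matching w"
proof -
  define P where "P = {(i, j). i < j \<and> {i, j} \<in> M}"
  have edge: "\<exists>i j. i < j \<and> j < 2 * k \<and> e = {i, j}" if "e \<in> M" for e
    using M that unfolding is_matching_def by blast
  have uniq: "e = f" if "e \<in> M" "f \<in> M" "x \<in> e" "x \<in> f" for e f x
  proof -
    have "x < 2 * k" using edge[OF that(1)] that(3) by auto
    then have "\<exists>!e. e \<in> M \<and> x \<in> e" using M unfolding is_matching_def by simp
    then show ?thesis using that by (elim ex1E) metis
  qed
  have "\<exists>w. 2 * k = 2 * sz w \<and> P = edges 0 w"
  proof (rule edges_of_pairs)
    fix i j assume "(i, j) \<in> P"
    then show "0 \<le> i \<and> i < j \<and> j < 0 + 2 * k"
      using edge[of "{i, j}"] by (auto simp: P_def doubleton_eq_iff)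
  next
    fix x assume "x < 0 + 2 * k"
    then have "\<exists>!e. e \<in> M \<and> x \<in> e" using M unfolding is_matching_def by simp
    then obtain e where e: "e \<in> M" "x \<in> e" by (elim ex1E) blast
    then obtain i j where "i < j" "e = {i, j}" using edge by blast
    then show "\<exists>e\<in>P. x = fst e \<or> x = snd e"
      using e by (intro bexI[of _ "(i, j)"]) (auto simp: P_def)
  next
    fix i j a b assume "(i, j) \<in> P" "(a, b) \<in> P" and eq: "i = a \<or> j = b \<or> j = a"
    then have "i < j" "a < b" "{i, j} \<in> M" "{a, b} \<in> M" by (auto simp: P_def)
    moreover from this eq have "{i, j} = {a, b}" using uniq by blast
    ultimately show "i = a \<and> j = b" by (simp add: doubleton_eq)
  next
    fix i j a b assume "(i, j) \<in> P" "(a, b) \<in> P"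
    then have "i < j" "a < b" "\<not> crosses {i, j} {a, b}" using M by (auto simp: P_def is_matching_def)
    then show "\<not> (i < a \<and> a < j \<and> j < b)" by (simp add: crosses_iff)
  qed
  then obtain w where w: "2 * k = 2 * sz w" "P = edges 0 w" by blast
  have "M = matching w"
  proof -
    have "e \<in> matching w" if "e \<in> M" for e
      using edge[OF that] that matching_mem_iff[of _ _ w] w(2)[symmetric] by (auto simp: P_def)
    moreover have "e \<in> M" if "e \<in> matching w" for e
      using that w(2)[symmetric] by (auto simp: matching_def P_def)
    ultimately show ?thesis by blast
  qed
  then show ?thesis using w(1) by auto
qed

lemma dcm_adj_mt: "dcm_adj k (matching u) (matching v) \<longleftrightarrow> sz u = k \<and> nb u v"
proof -
  have m: "is_matching k (matching w) \<longleftrightarrow> sz w = k" for w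
  proof
    assume "is_matching k (matching w)"
    from matching_surj[OF this] show "sz w = k" by (auto simp: matching_inj)
  next
    assume "sz w = k"
    with is_matching_matching[of w] show "is_matching k (matching w)" by simp
  qed
  have f: "fits (i, j) (a, b) \<longleftrightarrow> {i, j} \<noteq> {a, b} \<and> \<not> crosses {i, j} {a, b}"
    if "(i, j) \<in> edges 0 u" "(a, b) \<in> edges 0 v" for i j a b
  proof -
    have "i < j" "a < b" using edges_bounds[OF that(1)] edges_bounds[OF that(2)] by simp_all
    then show ?thesis by (simp add: crosses_iff doubleton_eq)
  qed
  have *: "(\<forall>e\<in>edges 0 u. \<forall>f\<in>edges 0 v. fits e f) \<longleftrightarrow> matching u \<inter> matching v = {} \<and> (\<forall>e\<in>matching u. \<forall>f\<in>matching v. \<not> crosses e f)"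
    (is "?L \<longleftrightarrow> ?R")
  proof
    assume ?L
    have "e \<noteq> g \<and> \<not> crosses e g" if "e \<in> matching u" "g \<in> matching v" for e g
    proof -
      obtain i j where e: "(i, j) \<in> edges 0 u" "e = {i, j}" using matching_memD \<open>e \<in> matching u\<close> by blast
      obtain a b where g: "(a, b) \<in> edges 0 v" "g = {a, b}" using matching_memD \<open>g \<in> matching v\<close> by blast
      have "fits (i, j) (a, b)" using bspec[OF bspec[OF \<open>?L\<close> e(1)] g(1)] .
      then show ?thesis unfolding e(2) g(2) f[OF e(1) g(1)] .
    qed
    then show ?R by blast
  next
    assume R: ?R
    have "fits e g" if "e \<in> edges 0 u" "g \<in> edges 0 v" for e g
    proof -
      obtain i j where ij: "e = (i, j)" by (cases e)
      obtain a b where ab: "g = (a, b)" by (cases g)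
      have mem: "{i, j} \<in> matching u" "{a, b} \<in> matching v" using that by (simp_all only: ij ab matching_memI)
      have "{i, j} \<noteq> {a, b}" using R mem by (metis disjoint_iff)
      moreover have "\<not> crosses {i, j} {a, b}" using R mem by blast
      moreover have "fits (i, j) (a, b) \<longleftrightarrow> {i, j} \<noteq> {a, b} \<and> \<not> crosses {i, j} {a, b}"
        using f that unfolding ij ab by blast
      ultimately show ?thesis unfolding ij ab by blast
    qed
    then show ?L by blast
  qed
  show ?thesis unfolding dcm_adj_def nb_def m *
    by (intro iffI; elim conjE; intro conjI; (assumption | simp))
qed

section \<open>Components and their isomorphism types\<close>

definition component :: "arcs \<Rightarrow> arcs set" where
  "component u = {v. conn u v}"

lemma finite_sz: "finite {u. sz u = n}"
proof (induction n rule: less_induct)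
  case (less n)
  have "{u. sz u = n} \<subseteq> insert Emp ((\<lambda>(a, b). Arc a b) ` ((\<Union>i<n. {u. sz u = i}) \<times> (\<Union>i<n. {u. sz u = i})))"
  proof
    fix u assume "u \<in> {u. sz u = n}"
    then show "u \<in> insert Emp ((\<lambda>(a, b). Arc a b) ` ((\<Union>i<n. {u. sz u = i}) \<times> (\<Union>i<n. {u. sz u = i})))"
      by (cases u) auto
  qed
  then show ?case using less by (meson finite_SigmaI finite_UN_I finite_imageI finite_insert finite_lessThan finite_subset lessThan_iff)
qed

lemma component_cong: "conn u v \<Longrightarrow> component u = component v"
  unfolding component_def using conn_trans conn_sym by blast

lemma component_rot_pow: "component ((rot ^^ n) u) = (rot ^^ n) ` component u"
proof -
  have "v \<in> (rot ^^ n) ` component u" if c: "conn ((rot ^^ n) u) v" for v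
  proof -
    obtain m where m: "(rot ^^ m) ((rot ^^ n) v) = v" using rot_pow_inverse by blast
    then have "v = (rot ^^ n) ((rot ^^ m) v)" by (simp add: funpow_add[symmetric, THEN fun_cong, unfolded comp_def] add.commute)
    then show ?thesis using c unfolding component_def by (metis conn_rot_pow_iff image_eqI mem_Collect_eq)
  qed
  then show ?thesis unfolding component_def by auto
qed

lemma reachable_matching:
  assumes "sz u = k"
  shows "(dcm_adj k)\<^sup>*\<^sup>* (matching u) M \<longleftrightarrow> (\<exists>v. M = matching v \<and> conn u v)"
proof
  assume "(dcm_adj k)\<^sup>*\<^sup>* (matching u) M"
  then show "\<exists>v. M = matching v \<and> conn u v"
  proof (induction rule: rtranclp_induct)
    case base then show ?case by auto
  next
    case (step M M')
    then obtain v where v: "M = matching v" "conn u v" by blast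
    have "is_matching k M'" using step.hyps(2) by (simp add: dcm_adj_def)
    then obtain w where w: "M' = matching w" using matching_surj by blast
    have "nb v w" using step.hyps(2) unfolding v(1) w dcm_adj_mt by simp
    then show ?case using w v(2) conn_nb conn_trans by blast
  qed
next
  assume "\<exists>v. M = matching v \<and> conn u v"
  then obtain v where v: "M = matching v" "conn u v" by blast
  have "nb\<^sup>*\<^sup>* u v \<Longrightarrow> sz v = k \<and> (dcm_adj k)\<^sup>*\<^sup>* (matching u) (matching v)"
  proof (induction rule: rtranclp_induct)
    case base then show ?case using assms by simp
  next
    case (step v w)
    then have "dcm_adj k (matching v) (matching w)" by (simp add: dcm_adj_mt)
    then show ?case using step nb_sz by (metis rtranclp.rtrancl_into_rtrancl)
  qed
  then show "(dcm_adj k)\<^sup>*\<^sup>* (matching u) M" using v conn_rtranclp by blast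
qed

lemma dcm_components_eq: "dcm_components k = (\<lambda>u. matching ` component u) ` {u. sz u = k}"
proof -
  have "{M'. (dcm_adj k)\<^sup>*\<^sup>* (matching u) M'} = matching ` component u" if "sz u = k" for u
    using reachable_matching[OF that] by (auto simp: component_def)
  moreover have "dcm_vertices k = matching ` {u. sz u = k}"
    unfolding dcm_vertices_def using matching_surj is_matching_matching by blast
  ultimately show ?thesis unfolding dcm_components_def by (auto simp: image_iff) 
qed

lemma inj_matching: "inj matching"
  using matching_inj by (auto simp: inj_def)

lemma card_matching: "card (matching ` X) = card X"
  by (rule card_image) (use inj_matching inj_on_subset in blast)

text \<open>The isomorphism type is given by an explicit graph on labels. Components with a common
  model are isomorphic and have the order of the label set.\<close>

definition model :: "(nat \<times> nat) set \<Rightarrow> (nat \<times> nat \<Rightarrow> nat \<times> nat \<Rightarrow> bool) \<Rightarrow> arcs \<Rightarrow> bool" where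
  "model L adj u \<longleftrightarrow> (\<exists>f. bij_betw f L (component u) \<and> (\<forall>x\<in>L. \<forall>y\<in>L. nb (f x) (f y) \<longleftrightarrow> adj x y))"

lemma model_card: "model L adj u \<Longrightarrow> card (component u) = card L"
  unfolding model_def using bij_betw_same_card by metis

lemma model_conn: "model L adj u \<Longrightarrow> conn u v \<Longrightarrow> model L adj v"
  unfolding model_def using component_cong by metis

lemma model_rot_pow: "model L adj u \<Longrightarrow> model L adj ((rot ^^ n) u)"
proof -
  assume "model L adj u"
  then obtain f where f: "bij_betw f L (component u)" "\<forall>x\<in>L. \<forall>y\<in>L. nb (f x) (f y) \<longleftrightarrow> adj x y"
    by (auto simp: model_def)
  have "bij_betw (rot ^^ n) (component u) (component ((rot ^^ n) u))"
    unfolding component_rot_pow by (auto simp: bij_betw_def inj_on_def)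
  then have "bij_betw ((rot ^^ n) \<circ> f) L (component ((rot ^^ n) u))" by (rule bij_betw_trans[OF f(1)])
  then show ?thesis unfolding model_def using f(2) by (intro exI[of _ "(rot ^^ n) \<circ> f"]) simp
qed

lemma model_iso:
  assumes "model L adj u" "model L adj v" "sz u = k" "sz v = k"
  shows "dcm_comp_iso k (matching ` component u) (matching ` component v)"
proof -
  obtain f g where f: "bij_betw f L (component u)" "\<forall>x\<in>L. \<forall>y\<in>L. nb (f x) (f y) \<longleftrightarrow> adj x y"
    and g: "bij_betw g L (component v)" "\<forall>x\<in>L. \<forall>y\<in>L. nb (g x) (g y) \<longleftrightarrow> adj x y"
    using assms by (auto simp: model_def)
  have mf: "bij_betw (matching \<circ> f) L (matching ` component u)" and mg: "bij_betw (matching \<circ> g) L (matching ` component v)"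
    using bij_betw_trans[OF f(1)] bij_betw_trans[OF g(1)] inj_on_imp_bij_betw[OF inj_on_subset[OF inj_matching subset_UNIV]]
    by blast+
  define h where "h = (matching \<circ> g) \<circ> inv_into L (matching \<circ> f)"
  have "bij_betw h (matching ` component u) (matching ` component v)"
    unfolding h_def by (rule bij_betw_trans[OF bij_betw_inv_into[OF mf] mg])
  moreover have "dcm_adj k M N \<longleftrightarrow> dcm_adj k (h M) (h N)" if M: "M \<in> matching ` component u" and N: "N \<in> matching ` component u" for M N
  proof -
    have img: "f ` L = component u" using f(1) by (simp add: bij_betw_def)
    obtain x where x: "x \<in> L" "M = matching (f x)" using M unfolding img[symmetric] by blast
    obtain y where y: "y \<in> L" "N = matching (f y)" using N unfolding img[symmetric] by blast
    have hM: "h M = matching (g x)" using bij_betw_inv_into_left[OF mf x(1)] by (simp add: h_def x(2))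
    have hN: "h N = matching (g y)" using bij_betw_inv_into_left[OF mf y(1)] by (simp add: h_def y(2))
    have "f x \<in> component u" "g x \<in> component v" using bij_betwE[OF f(1)] bij_betwE[OF g(1)] x(1) by blast+
    then have "sz (f x) = k" "sz (g x) = k" using conn_sz assms(3,4) unfolding component_def by fastforce+
    then show ?thesis unfolding hM hN using f(2) g(2) x y by (simp add: dcm_adj_mt)
  qed
  ultimately show ?thesis unfolding dcm_comp_iso_def by blast
qed

text \<open>The equation for \<open>nbs\<close> makes the image of \<open>f\<close> closed under
  steps, and connectedness makes it no larger than the component.\<close>

lemma model_intro:
  assumes inj: "inj_on f L" and nbs: "\<And>x. x \<in> L \<Longrightarrow> nbs (f x) = f ` {y \<in> L. adj x y}"
    and x0: "x0 \<in> L" and conn: "\<And>x. x \<in> L \<Longrightarrow> conn (f x0) (f x)"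
  shows "model L adj (f x0)"
proof -
  have adj: "nb (f x) (f y) \<longleftrightarrow> adj x y" if "x \<in> L" "y \<in> L" for x y
  proof -
    have "nb (f x) (f y) \<longleftrightarrow> f y \<in> f ` {y \<in> L. adj x y}" using nbs[OF that(1)] mem_nbs by blast
    then show ?thesis using inj that by (auto dest: inj_onD)
  qed
  have "v \<in> f ` L" if "nb\<^sup>*\<^sup>* (f x0) v" for v
    using that
  proof (induction rule: rtranclp_induct)
    case (step v w)
    then obtain x where "x \<in> L" "v = f x" by blast
    then show ?case using nbs[of x] step.hyps(2) mem_nbs by blast
  qed (use x0 in simp)
  then have "component (f x0) = f ` L" using conn unfolding component_def conn_rtranclp by blast
  then have "bij_betw f L (component (f x0))" using inj by (simp add: bij_betw_def)
  then show ?thesis unfolding model_def using adj by blast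
qed

definition no_adj :: "nat \<times> nat \<Rightarrow> nat \<times> nat \<Rightarrow> bool" where
  "no_adj x y \<longleftrightarrow> False"

definition star_adj :: "nat \<times> nat \<Rightarrow> nat \<times> nat \<Rightarrow> bool" where
  "star_adj x y \<longleftrightarrow> fst x \<noteq> fst y"

definition star_labels :: "nat \<Rightarrow> (nat \<times> nat) set" where
  "star_labels j = insert (0, 0) ({1} \<times> {..<j})"

lemma card_star_labels: "card (star_labels j) = j + 1"
  by (simp add: star_labels_def card_cartesian_product)

lemma card_med_labels: "card (med_labels j) = 6 * j"
  by (simp add: med_labels_def)

lemma model_isolated: "\<not> has_nb u \<Longrightarrow> model {(0, 0)} no_adj u"
  using model_intro[of "\<lambda>_. u" "{(0, 0)}" no_adj "(0, 0)"] by (auto simp: no_adj_def has_nb_iff)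

lemma model_star_intro:
  assumes "finite (nbs c)" "card (nbs c) = j" "\<And>z. nb c z \<Longrightarrow> nbs z = {c}" "c \<notin> nbs c"
  shows "model (star_labels j) star_adj c"
proof -
  obtain e where e: "bij_betw e {..<j} (nbs c)" using assms(1,2) ex_bij_betw_nat_finite[OF assms(1)] by (auto simp: atLeast0LessThan)
  define f where "f x = (if fst x = 0 then c else e (snd x))" for x :: "nat \<times> nat"
  have e1: "e i \<in> nbs c" "nbs (e i) = {c}" if "i < j" for i
  proof -
    show "e i \<in> nbs c" using bij_betwE[OF e] that by blast
    then show "nbs (e i) = {c}" using assms(3) by simp
  qed
  have "model (star_labels j) star_adj (f (0, 0))"
  proof (rule model_intro)
    show "inj_on f (star_labels j)"
      using e e1 assms(4) by (auto simp: inj_on_def star_labels_def f_def bij_betw_def)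
    show "(0, 0) \<in> star_labels j" by (simp add: star_labels_def)
    fix x assume x: "x \<in> star_labels j"
    then consider "x = (0, 0)" | i where "i < j" "x = (1, i)" by (auto simp: star_labels_def)
    then show "nbs (f x) = f ` {y \<in> star_labels j. star_adj x y}"
    proof cases
      case 1
      have "{y \<in> star_labels j. star_adj x y} = {1} \<times> {..<j}" using 1 by (auto simp: star_labels_def star_adj_def)
      moreover have "f ` ({1} \<times> {..<j}) = e ` {..<j}" by (force simp: f_def)
      ultimately show ?thesis using e 1 by (simp add: bij_betw_def f_def)
    next
      case (2 i)
      have "{y \<in> star_labels j. star_adj x y} = {(0, 0)}" using 2 by (auto simp: star_labels_def star_adj_def)
      then show ?thesis using 2 e1 by (simp add: f_def)
    qed
    show "conn (f (0, 0)) (f x)" using x e1 conn_nb by (auto simp: star_labels_def f_def)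
  qed
  then show ?thesis by (simp add: f_def)
qed

lemma not_nb_self: "u \<noteq> Emp \<Longrightarrow> \<not> nb u u"
  by (cases u) (auto simp: nb_def)

lemma model_star:
  assumes "star u" "sz u = 2 * j + 1"
  shows "model (star_labels j) star_adj u"
proof -
  have hub: "model (star_labels j) star_adj c" if c0: "hub c" and sz: "sz c = 2 * j + 1" for c
  proof -
    obtain n a where c: "c = (rot ^^ n) (TT a)" using c0 unfolding hub_def by blast
    then have "length a = j" using sz by simp
    then have "model (star_labels j) star_adj (TT a)"
      using card_nbs_TT[of a] nbs_of_nb_TT[of a] not_nb_self[of "TT a"] by (intro model_star_intro) auto
    then show ?thesis unfolding c by (rule model_rot_pow)
  qed
  from assms(1) show ?thesis unfolding star_def using hub model_conn conn_nb nb_sz assms(2) by metis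
qed

text \<open>A single edge is treated as the star with one leaf.\<close>

lemma model_comb: "comb u \<Longrightarrow> model (star_labels 1) star_adj u"
proof -
  assume u: "comb u"
  then obtain v where v: "nb u v" unfolding comb_def using nb_SS_UU nb_UU_SS nb_rot_pow by blast
  have "u \<noteq> Emp"
  proof
    assume "u = Emp"
    then have "sz u = 0" by simp
    moreover obtain n a where "a \<noteq> []" "u = (rot ^^ n) (UU a) \<or> u = (rot ^^ n) (SS a)" using u unfolding comb_def by blast
    ultimately show False by (metis length_0_conv mult_eq_0_iff sz_SS sz_UU sz_rot_pow zero_neq_numeral)
  qed
  then have self: "u \<notin> nbs u" using not_nb_self by simp
  have nu: "nbs u = {v}" and nv: "nbs v = {u}" using comb_nb[OF u v] comb_nb[of v u] v nb_sym by blast+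
  show ?thesis
  proof (rule model_star_intro[OF _ _ _ self])
    show "finite (nbs u)" "card (nbs u) = 1" unfolding nu by simp_all
    show "nbs z = {u}" if "nb u z" for z using that nu nv by (metis mem_nbs singletonD)
  qed
qed

lemma model_med:
  assumes "med u" "sz u = 2 * j + 2"
  shows "model (med_labels j) med_adj u"
proof -
  obtain n a where na: "conn ((rot ^^ n) (TT a \<oplus> HH)) u" using assms(1) unfolding med_def by blast
  have j: "j = Suc (length a)" using conn_sz[OF na] assms(2) by simp
  let ?f = "med_vertex (True # a)"
  have N: "nbs (?f v) = ?f ` {w \<in> med_labels j. med_adj v w}" if "v \<in> med_labels j" for v
    using med_structure[of "True # a"] that j by simp
  have c: "conn (?f v) (?f w)" if "v \<in> med_labels j" "w \<in> med_labels j" "med_adj v w" for v w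
    using N[OF that(1)] that by (intro conn_nb) (auto simp flip: mem_nbs)
  have "model (med_labels j) med_adj (?f (1, length a))"
  proof (rule model_intro)
    show "inj_on ?f (med_labels j)" using inj_med_vertex[of "True # a"] j by simp
    show "(1, length a) \<in> med_labels j" by (simp add: med_labels_def j)
    show "nbs (?f x) = ?f ` {y \<in> med_labels j. med_adj x y}" if "x \<in> med_labels j" for x using N[OF that] .
    \<comment> \<open>The extreme vertices of the half graph are adjacent to a whole colour class of
      the core: the last of type 1 to all of type 0, the first of type 0 to all of type 1.\<close>
    have c0: "conn (?f (1, length a)) (?f (0, i))" if "i < j" for i
      by (rule c) (use that j in \<open>auto simp: med_labels_def med_adj_def\<close>)
    have c1: "conn (?f (0, 0)) (?f (1, i))" if "i < j" for i
      by (rule c) (use that j in \<open>auto simp: med_labels_def med_adj_def\<close>)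
    have c1': "conn (?f (1, length a)) (?f (1, i))" if "i < j" for i
      using conn_trans[OF c0 c1[OF that]] that by simp
    fix x assume x: "x \<in> med_labels j"
    obtain t i where ti: "x = (t, i)" by (cases x)
    have t: "t < 6" "i < j" using x by (auto simp: ti med_labels_def)
    then consider "t = 0" | "t = 1" | "t = 2 \<or> t = 3" | "t = 4 \<or> t = 5" by linarith
    then show "conn (?f (1, length a)) (?f x)"
    proof cases
      case 1 then show ?thesis using c0 t ti by simp
    next
      case 2 then show ?thesis using c1' t ti by simp
    next
      case 3
      have "conn (?f (1, i)) (?f x)" by (rule c) (use 3 t in \<open>auto simp: ti med_labels_def med_adj_def\<close>)
      then show ?thesis using c1'[OF t(2)] conn_trans by blast
    next
      case 4
      have "conn (?f (0, i)) (?f x)" by (rule c) (use 4 t in \<open>auto simp: ti med_labels_def med_adj_def\<close>)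
      then show ?thesis using c0[OF t(2)] conn_trans by blast
    qed
  qed
  moreover have "?f (1, length a) = VV \<oplus> TT a \<oplus> lf" by (simp add: newest_def hexagon_def)
  moreover have "(rot ^^ 4) (VV \<oplus> TT a \<oplus> lf) = TT a \<oplus> HH" using rot_pow_cat[of VV "TT a \<oplus> lf"] by simp
  ultimately have "model (med_labels j) med_adj (TT a \<oplus> HH)" using model_rot_pow by metis
  then show ?thesis using model_rot_pow model_conn na by blast
qed

section \<open>The order of the largest component\<close>

definition big_set :: "nat \<Rightarrow> arcs set" where
  "big_set n = {u. big u \<and> sz u = n}"

lemma finite_big_set: "finite (big_set n)"
  using finite_subset[OF _ finite_sz[of n]] by (auto simp: big_set_def)

lemma strong_conn: "strong u \<Longrightarrow> conn (ring (sz u)) u"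
  unfolding strong_def conn_def by blast

text \<open>From size 9 on \<open>big\<close> means \<open>strong\<close>, and all strong words of
  one size are joined to the same ring.\<close>

lemma component_big:
  assumes "big u" "9 \<le> sz u"
  shows "component u = big_set (sz u)"
proof
  show "component u \<subseteq> big_set (sz u)"
  proof
    fix v assume "v \<in> component u"
    then have "conn u v" by (simp add: component_def)
    then show "v \<in> big_set (sz u)" using big_conn[OF assms(1)] conn_sz[of u v] by (simp add: big_set_def)
  qed
  show "big_set (sz u) \<subseteq> component u"
  proof
    fix v assume "v \<in> big_set (sz u)"
    then have v: "big v" "sz v = sz u" by (simp_all add: big_set_def)
    then have "strong v" "strong u" using assms by (simp_all add: big_def)
    then have "conn (ring (sz u)) v" "conn (ring (sz u)) u" using strong_conn v(2) by metis+
    then have "conn u v" using conn_sym conn_trans by blast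
    then show "v \<in> component u" by (simp add: component_def)
  qed
qed

text \<open>Putting \<open>II\<close> or \<open>VV\<close> in front gives two injections with
  disjoint images.\<close>

lemma card_big_set_step: "2 * card (big_set n) \<le> card (big_set (n + 2))"
proof -
  have i: "inj_on (\<lambda>u. pair c \<oplus> u) X" for c X by (auto simp: inj_on_def)
  have d: "(\<lambda>u. pair True \<oplus> u) ` big_set n \<inter> (\<lambda>u. pair False \<oplus> u) ` big_set n = {}" by (auto simp: pair_def)
  have "card ((\<lambda>u. pair True \<oplus> u) ` big_set n \<union> (\<lambda>u. pair False \<oplus> u) ` big_set n) = 2 * card (big_set n)"
    using card_Un_disjoint[OF finite_imageI[OF finite_big_set] finite_imageI[OF finite_big_set] d]
    by (simp add: card_image[OF i])
  moreover have "(\<lambda>u. pair True \<oplus> u) ` big_set n \<union> (\<lambda>u. pair False \<oplus> u) ` big_set n \<subseteq> big_set (n + 2)"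
    using big_pair_cat by (auto simp: big_set_def)
  ultimately show ?thesis using card_mono[OF finite_big_set] by metis
qed

lemma card_big_set_pow: "2 ^ m * card (big_set n) \<le> card (big_set (n + 2 * m))"
proof (induction m)
  case (Suc m)
  then show ?case using card_big_set_step[of "n + 2 * m"] by simp
qed simp

text \<open>For \<open>k = 9 + 2 * m\<close> there are \<open>m + 2\<close> doublings, which give
  \<open>8 * 2 ^ m\<close> against the \<open>m + 5\<close> vertices of a star.\<close>

lemma card_big_set_5: "2 \<le> card (big_set 5)"
proof -
  have "{ring 5, over (ring 4)} \<subseteq> big_set 5"
    using big_ring(1) big_rot[OF big_ring(1)] by (auto simp: big_set_def)
  then show ?thesis using card_mono[OF finite_big_set, of "{ring 5, over (ring 4)}" 5] by simp
qed

text \<open>For \<open>k = 10 + 2 * m\<close> the bound is \<open>28 * 2 ^ m\<close> against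
  \<open>24 + 6 * m\<close>. Six words would give only 24 against 24 at
  \<open>k = 10\<close>.\<close>

lemma card_big_set_6: "7 \<le> card (big_set 6)"
proof -
  have "big w" if "nb (ring 6) w" for w using that big_ring(2) big_conn conn_nb by blast
  then have "{ring 6, over (ring 5), II \<oplus> over HH, over VV \<oplus> over VV, over HH \<oplus> II, II \<oplus> II \<oplus> II, over (VV \<oplus> over II)} \<subseteq> big_set 6"
    using big_ring(2) by (simp add: big_set_def nb_def)
  then show ?thesis
    using card_mono[OF finite_big_set, of "{ring 6, over (ring 5), II \<oplus> over HH, over VV \<oplus> over VV, over HH \<oplus> II, II \<oplus> II \<oplus> II, over (VV \<oplus> over II)}" 6]
    by simp
qed

text \<open>Odd and even sizes differ only in the two models. The strict inequalities between the
  orders ensure that components of equal order share a model or are both equal to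
  \<open>big_set k\<close>.\<close>

lemma three_classes:
  assumes "9 \<le> k"
    and cases: "\<And>u. sz u = k \<Longrightarrow> model L1 adj1 u \<or> model L2 adj2 u \<or> big u"
    and u1: "sz u1 = k" "model L1 adj1 u1" and u2: "sz u2 = k" "model L2 adj2 u2"
    and less: "card L1 < card L2" "card L2 < card (big_set k)"
  shows "\<exists>s1 s2 s3 :: nat. s1 < s2 \<and> s2 < s3 \<and>
           card ` dcm_components k = {s1, s2, s3} \<and>
           (\<forall>C\<in>dcm_components k. \<forall>D\<in>dcm_components k.
               card C = card D \<longrightarrow> dcm_comp_iso k C D) \<and>
           card {C \<in> dcm_components k. card C = s3} = 1"
proof (intro exI conjI ballI impI)
  show "card L1 < card L2" "card L2 < card (big_set k)" by (fact less)+
  have ring: "sz (ring k) = k" "big (ring k)" using strong_ring assms(1) by (auto simp: big_def)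
  have card_big: "component u = big_set k" if "big u" "sz u = k" for u using component_big that assms(1) by simp
  have cl: "(model L1 adj1 u \<and> card (component u) = card L1) \<or> (model L2 adj2 u \<and> card (component u) = card L2) \<or>
      (component u = big_set k \<and> card (component u) = card (big_set k))" if "sz u = k" for u
    using cases[OF that] model_card card_big that by metis
  have "(\<lambda>u. card (component u)) ` {u. sz u = k} = {card L1, card L2, card (big_set k)}"
  proof
    show "(\<lambda>u. card (component u)) ` {u. sz u = k} \<subseteq> {card L1, card L2, card (big_set k)}" using cl by auto
    have "card (component u1) = card L1" "card (component u2) = card L2" "card (component (ring k)) = card (big_set k)"
      using model_card u1(2) u2(2) card_big ring by metis+
    then show "{card L1, card L2, card (big_set k)} \<subseteq> (\<lambda>u. card (component u)) ` {u. sz u = k}"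
      using u1(1) u2(1) ring(1) by (metis (mono_tags, lifting) image_eqI insert_subset empty_subsetI mem_Collect_eq)
  qed
  then show "card ` dcm_components k = {card L1, card L2, card (big_set k)}"
    unfolding dcm_components_eq image_image card_matching .
  show "dcm_comp_iso k C D" if CD: "C \<in> dcm_components k" "D \<in> dcm_components k" "card C = card D" for C D
  proof -
    obtain u v where u: "sz u = k" "C = matching ` component u" and v: "sz v = k" "D = matching ` component v"
      using CD(1,2) unfolding dcm_components_eq by blast
    have eq: "card (component u) = card (component v)" using CD(3) u v by (simp add: card_matching)
    consider "model L1 adj1 u" "model L1 adj1 v" | "model L2 adj2 u" "model L2 adj2 v" | "component u = component v"
      using cl[OF u(1)] cl[OF v(1)] eq less by fastforce
    then show ?thesis
    proof cases
      case 3
      then have "bij_betw id C D \<and> (\<forall>x\<in>C. \<forall>y\<in>C. dcm_adj k x y \<longleftrightarrow> dcm_adj k (id x) (id y))" using u v by simp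
      then show ?thesis unfolding dcm_comp_iso_def by blast
    qed (use model_iso u v in blast)+
  qed
  have "{C \<in> dcm_components k. card C = card (big_set k)} = {matching ` big_set k}"
  proof
    show "{C \<in> dcm_components k. card C = card (big_set k)} \<subseteq> {matching ` big_set k}"
      unfolding dcm_components_eq using cl less by (fastforce simp: card_matching)
    have "matching ` component (ring k) \<in> dcm_components k" unfolding dcm_components_eq using ring(1) by blast
    then show "{matching ` big_set k} \<subseteq> {C \<in> dcm_components k. card C = card (big_set k)}"
      using card_big[OF ring(2,1)] by (simp add: card_matching)
  qed
  then show "card {C \<in> dcm_components k. card C = card (big_set k)} = 1" by simp
qed

lemma linear_less_pow: "5 + m < 8 * 2 ^ m" "24 + 6 * m < 28 * (2 :: nat) ^ m" for m :: nat
  by (induction m) auto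

theorem theorem1:
  fixes k :: nat
  assumes "k \<ge> 9"
  shows "\<exists>s1 s2 s3 :: nat. s1 < s2 \<and> s2 < s3 \<and>
           card ` dcm_components k = {s1, s2, s3} \<and>
           (\<forall>C\<in>dcm_components k. \<forall>D\<in>dcm_components k.
               card C = card D \<longrightarrow> dcm_comp_iso k C D) \<and>
           card {C \<in> dcm_components k. card C = s3} = 1"
proof (cases "odd k")
  case True
  then have "\<exists>m. k = 9 + 2 * m" using assms by presburger
  then obtain m where k: "k = 9 + 2 * m" by blast
  \<comment> \<open>The number of leaves of a star, \<open>(k - 1) / 2\<close>.\<close>
  define j where "j = m + 4"
  have kj: "k = 2 * j + 1" using k by (simp add: j_def)
  show ?thesis
  proof (rule three_classes[OF assms])
    show "model {(0, 0)} no_adj u \<or> model (star_labels j) star_adj u \<or> big u" if "sz u = k" for u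
      using odd_classification[of u] model_isolated[of u] model_star[of u j] that True kj by auto
    show "sz (lf \<oplus> SS (replicate j True)) = k" using kj by simp
    show "model {(0, 0)} no_adj (lf \<oplus> SS (replicate j True))"
      using nbs_lr_lf_SS[of True "replicate j True"] by (intro model_isolated) (simp add: has_nb_iff)
    show "sz (TT (replicate j True)) = k" using kj by simp
    have "hub (TT (replicate j True))" unfolding hub_def by (intro exI[of _ 0] exI[of _ "replicate j True"]) simp
    then have "star (TT (replicate j True))" by (simp add: star_def)
    then show "model (star_labels j) star_adj (TT (replicate j True))" using kj by (intro model_star) auto
    show "card {(0 :: nat, 0 :: nat)} < card (star_labels j)" by (simp add: card_star_labels j_def)
    have "2 ^ (m + 2) * 2 \<le> 2 ^ (m + 2) * card (big_set 5)" by (rule mult_le_mono2[OF card_big_set_5])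
    also have "\<dots> \<le> card (big_set (5 + 2 * (m + 2)))" by (rule card_big_set_pow)
    also have "5 + 2 * (m + 2) = k" using k by simp
    finally have "8 * 2 ^ m \<le> card (big_set k)" by (simp add: power_add)
    then show "card (star_labels j) < card (big_set k)"
      using linear_less_pow(1)[of m] by (simp add: card_star_labels j_def)
  qed
next
  case False
  then have "\<exists>m. k = 10 + 2 * m" using assms by presburger
  then obtain m where k: "k = 10 + 2 * m" by blast
  \<comment> \<open>The number of layers of six vertices in a medium component, whose order is thus
    \<open>6 * j = 3 * k - 6\<close>.\<close>
  define j where "j = m + 4"
  have kj: "k = 2 * j + 2" using k by (simp add: j_def)
  show ?thesis
  proof (rule three_classes[OF assms])
    show "model (star_labels 1) star_adj u \<or> model (med_labels j) med_adj u \<or> big u" if u: "sz u = k" for u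
    proof -
      have "even (sz u)" "u \<noteq> Emp" using u False kj by auto
      then show ?thesis using even_classification[of u] model_comb[of u] model_med[of u j] u kj by auto
    qed
    have r: "replicate (Suc j) True \<noteq> []" by simp
    show "sz (SS (replicate (Suc j) True)) = k" using kj by simp
    have "comb (SS (replicate (Suc j) True))" unfolding comb_def
      by (intro exI[of _ 0] exI[of _ "replicate (Suc j) True"] conjI r disjI2) simp
    then show "model (star_labels 1) star_adj (SS (replicate (Suc j) True))" by (rule model_comb)
    show s: "sz (med_word1 (replicate (j - 1) True) []) = k" using kj by (simp add: med_word1_def j_def)
    show "model (med_labels j) med_adj (med_word1 (replicate (j - 1) True) [])"
      using med_med_word1 s kj by (intro model_med) simp_all
    show "card (star_labels 1) < card (med_labels j)" by (simp add: card_star_labels card_med_labels j_def)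
    have "2 ^ (m + 2) * 7 \<le> 2 ^ (m + 2) * card (big_set 6)" by (rule mult_le_mono2[OF card_big_set_6])
    also have "\<dots> \<le> card (big_set (6 + 2 * (m + 2)))" by (rule card_big_set_pow)
    also have "6 + 2 * (m + 2) = k" using k by simp
    finally have "28 * 2 ^ m \<le> card (big_set k)" by (simp add: power_add)
    then show "card (med_labels j) < card (big_set k)"
      using linear_less_pow(2)[of m] by (simp add: card_med_labels j_def)
  qed
qed

end
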